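(* Let $N\ge1$ be an integer. For $G^\vee=SL_{n+1}(\mathbb{C})$, let $\beta^\vee$ be a positive root and let $\lambda,\mu$ be dominant weights such that (1) $\lambda+\mu-N\beta^\vee$ is dominant; and (2) for every $i$, if $\langle\alpha_i,\lambda\rangle<N$ or $\langle\alpha_i,\mu\rangle<N$, then $\beta^\vee-\alpha_i^\vee\notin\Phi_{G^\vee}\sqcup\{0\}$. Then the irreducible representation $V(\lambda+\mu-N\beta^\vee)$ appears in $V(\lambda)\otimes V(\mu)$. Moreover, if $\beta^\vee$ is not a simple root, then $V(\lambda+\mu-N\beta^\vee)$ appears in $V(\lambda)\otimes V(\mu)$ with multiplicity at least $2$.
   Context: $\Phi_{G^\vee}$ is the root system of $G^\vee$, with simple roots $\alpha_i^\vee$; the $\alpha_i$ are the corresponding simple coroots of $G^\vee$ (equivalently, the simple roots of the Langlands dual group $G=PGL_{n+1}(\mathbb{C})$), so that $\langle\alpha_i,\lambda\rangle$ is the coefficient of the $i$-th fundamental weight of $G^\vee$ in $\lambda$. For a dominant weight $\lambda$, $V(\lambda)$ denotes the finite-dimensional irreducible representation of $G^\vee$ of highest weight $\lambda$. *)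

theory Defs
  imports "Jordan_Normal_Form.VS_Connect"
begin

(* Everything below concerns SL_{n+1}(C), the standard maximal torus of diagonal
   matrices and the Borel subgroup of upper triangular matrices.  Matrix indices run over
   0, ..., n; simple roots and fundamental weights are indexed by 0, ..., n - 1. *)

definition SL :: "nat \<Rightarrow> complex mat set" where
  "SL n = {g \<in> carrier_mat (Suc n) (Suc n). det g = 1}"

(* A weight is the vector of its coordinates in the basis of fundamental weights
   om_k = eps_0 + ... + eps_k, where eps_i is the character diag(t_0,...,t_n) |-> t_i.
   So the k-th coordinate is the pairing with the k-th simple coroot. *)

definition dominant :: "nat \<Rightarrow> int vec \<Rightarrow> bool" where
  "dominant n la \<longleftrightarrow> la \<in> carrier_vec n \<and> (\<forall>k<n. 0 \<le> la $ k)"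

definition weight_char :: "nat \<Rightarrow> int vec \<Rightarrow> complex mat \<Rightarrow> complex" where
  "weight_char n la t = (\<Prod>k<n. (\<Prod>i\<le>k. t $$ (i, i)) powi (la $ k))"

(* eps_i = om_i - om_(i-1), with om_(-1) = om_n = 0 *)
definition eps :: "nat \<Rightarrow> nat \<Rightarrow> int vec" where
  "eps n i = vec n (\<lambda>k. (if k = i then 1 else 0) - (if Suc k = i then 1 else 0))"

(* eps_i - eps_j is the weight of the elementary matrix E_ij in the adjoint representation,
   and E_ij is upper triangular iff i < j *)
definition roots :: "nat \<Rightarrow> int vec set" where
  "roots n = {eps n i - eps n j | i j. i \<le> n \<and> j \<le> n \<and> i \<noteq> j}"

definition positive_roots :: "nat \<Rightarrow> int vec set" where
  "positive_roots n = {eps n i - eps n j | i j. i < j \<and> j \<le> n}"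

definition simple_root :: "nat \<Rightarrow> nat \<Rightarrow> int vec" where
  "simple_root n i = eps n i - eps n (Suc i)"

inductive polynomial_fun :: "nat \<Rightarrow> (complex mat \<Rightarrow> complex) \<Rightarrow> bool" for n where
  const: "polynomial_fun n (\<lambda>g. c)"
| entry: "i \<le> n \<Longrightarrow> j \<le> n \<Longrightarrow> polynomial_fun n (\<lambda>g. g $$ (i, j))"
| add: "polynomial_fun n p \<Longrightarrow> polynomial_fun n q \<Longrightarrow> polynomial_fun n (\<lambda>g. p g + q g)"
| mult: "polynomial_fun n p \<Longrightarrow> polynomial_fun n q \<Longrightarrow> polynomial_fun n (\<lambda>g. p g * q g)"

(* Since det = 1 on SL_{n+1}, its regular functions are exactly the restrictions of
   polynomials in the matrix entries.  Only the values of rho on SL n matter, here and in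
   all the definitions that follow. *)
definition representation :: "nat \<Rightarrow> nat \<Rightarrow> (complex mat \<Rightarrow> complex mat) \<Rightarrow> bool" where
  "representation n d \<rho> \<longleftrightarrow>
     (\<forall>g\<in>SL n. \<rho> g \<in> carrier_mat d d) \<and>
     \<rho> (1\<^sub>m (Suc n)) = 1\<^sub>m d \<and>
     (\<forall>g\<in>SL n. \<forall>h\<in>SL n. \<rho> (g * h) = \<rho> g * \<rho> h) \<and>
     (\<forall>r<d. \<forall>s<d. \<exists>p. polynomial_fun n p \<and> (\<forall>g\<in>SL n. \<rho> g $$ (r, s) = p g))"

definition irreducible_rep :: "nat \<Rightarrow> nat \<Rightarrow> (complex mat \<Rightarrow> complex mat) \<Rightarrow> bool" where
  "irreducible_rep n d \<rho> \<longleftrightarrow>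
     representation n d \<rho> \<and> 0 < d \<and>
     (\<forall>W. VectorSpace.subspace class_ring W (module_vec TYPE(complex) d) \<longrightarrow>
          (\<forall>g\<in>SL n. \<forall>w\<in>W. \<rho> g *\<^sub>v w \<in> W) \<longrightarrow>
          W = {0\<^sub>v d} \<or> W = carrier_vec d)"

(* v spans a line on which the Borel subgroup acts through the character la *)
definition highest_weight_vector ::
  "nat \<Rightarrow> nat \<Rightarrow> (complex mat \<Rightarrow> complex mat) \<Rightarrow> int vec \<Rightarrow> complex vec \<Rightarrow> bool" where
  "highest_weight_vector n d \<rho> la v \<longleftrightarrow>
     v \<in> carrier_vec d \<and> v \<noteq> 0\<^sub>v d \<and>
     (\<forall>b\<in>SL n. upper_triangular b \<longrightarrow> \<rho> b *\<^sub>v v = weight_char n la b \<cdot>\<^sub>v v)"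

definition irreducible_of_highest_weight ::
  "nat \<Rightarrow> int vec \<Rightarrow> nat \<Rightarrow> (complex mat \<Rightarrow> complex mat) \<Rightarrow> bool" where
  "irreducible_of_highest_weight n la d \<rho> \<longleftrightarrow>
     irreducible_rep n d \<rho> \<and> (\<exists>v. highest_weight_vector n d \<rho> la v)"

definition isomorphic_reps ::
  "nat \<Rightarrow> (complex mat \<Rightarrow> complex mat) \<Rightarrow> (complex mat \<Rightarrow> complex mat) \<Rightarrow> bool" where
  "isomorphic_reps n \<rho> \<sigma> \<longleftrightarrow> (\<exists>P Q. \<forall>g\<in>SL n. similar_mat_wit (\<rho> g) (\<sigma> g) P Q)"

definition kronecker :: "'a :: times mat \<Rightarrow> 'a mat \<Rightarrow> 'a mat" where
  "kronecker A B = mat (dim_row A * dim_row B) (dim_col A * dim_col B)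
     (\<lambda>(i, j). A $$ (i div dim_row B, j div dim_col B) * B $$ (i mod dim_row B, j mod dim_col B))"

definition tensor_rep ::
  "(complex mat \<Rightarrow> complex mat) \<Rightarrow> (complex mat \<Rightarrow> complex mat) \<Rightarrow> complex mat \<Rightarrow> complex mat" where
  "tensor_rep \<rho> \<sigma> = (\<lambda>g. kronecker (\<rho> g) (\<sigma> g))"

(* The largest k such that tau is isomorphic to the direct sum of k copies of sigma and some
   further (possibly zero) representation; meant for sigma irreducible, so that k is bounded
   by the dimension of tau. *)
definition multiplicity_in ::
  "nat \<Rightarrow> (complex mat \<Rightarrow> complex mat) \<Rightarrow> (complex mat \<Rightarrow> complex mat) \<Rightarrow> nat" where
  "multiplicity_in n \<sigma> \<tau> =
     Max {k. \<exists>c \<tau>'. representation n c \<tau>' \<and>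
               isomorphic_reps n \<tau> (\<lambda>g. diag_block_mat (replicate k (\<sigma> g) @ [\<tau>' g]))}"

definition appears_in ::
  "nat \<Rightarrow> (complex mat \<Rightarrow> complex mat) \<Rightarrow> (complex mat \<Rightarrow> complex mat) \<Rightarrow> bool" where
  "appears_in n \<sigma> \<tau> \<longleftrightarrow> 1 \<le> multiplicity_in n \<sigma> \<tau>"

end

theory Submission
  imports Defs "Jordan_Normal_Form.Char_Poly"
begin

text \<open>
Let \<open>D\<^sub>k\<close> be the leading \<open>k \<times> k\<close> minor and \<open>D\<^sup>\<lambda> = \<Prod>\<^sub>k D\<^sub>k ^ \<lambda>\<^sub>k\<close>. On the big cell
(lower unitriangular times upper triangular matrices) the limit of \<open>\<lambda>(t)\<inverse> \<rho>(t)\<close> along a one-parameter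
subgroup of the torus projects \<open>V(\<lambda>)\<close> onto its highest weight line, so there is a functional \<open>\<phi>\<close> with
\<open>\<phi>(\<rho>(g) v) = D\<^sup>\<lambda>(g)\<close>. By Cauchy-Binet the kernel \<open>D\<^sup>\<lambda>(g\<^sup>* h)\<close> is a Gram kernel
\<open>\<Sum>\<^sub>f cnj (f g) * f h\<close>, where \<open>f\<close> runs through products of minors on the first columns. This yields, without
any integration over a compact group, a contravariant positive definite Hermitian form on \<open>V(\<lambda>)\<close>, hence
on tensor products, and shows that all these \<open>f\<close> are matrix coefficients \<open>g \<mapsto> \<xi>(\<rho>(g) v)\<close>.

By the form, linearly independent covectors on \<open>V(\<lambda>) \<otimes> V(\<mu>)\<close> that are semi-invariant of weight \<open>\<nu>\<close> under
lower triangular matrices split off as many copies of \<open>V(\<nu>)\<close>. Write \<open>\<beta> = eps\<^sub>i - eps\<^sub>j\<close>; hypothesis (2) says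
that \<open>\<lambda>\<close> and \<open>\<mu>\<close> have coordinates at least \<open>N\<close> at \<open>i\<close> and at \<open>j - 1\<close>. Let \<open>P(g, h)\<close> be the determinant of
the first \<open>j\<close> columns of \<open>h\<close>, cut to the first \<open>j + 1\<close> rows, bordered by the column of the minors of \<open>g\<close> with
rows \<open>0, \<dots>, i - 1, s\<close> and columns \<open>0, \<dots>, i\<close>. Then \<open>P(g, h)\<^sup>N\<close> times powers of leading minors of \<open>g\<close> and
of \<open>h\<close> is such a covector for \<open>\<nu> = \<lambda> + \<mu> - N \<beta>\<close>. Exchanging the roles of \<open>g\<close> and \<open>h\<close> gives a second one, which
is independent of the first as soon as \<open>\<beta>\<close> is not simple.
\<close>

section \<open>Matrices, adjoints and Kronecker products\<close>

text \<open>The weight of \<open>P\<close> comes from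
  \<open>om_i + om_(j-1) - \<beta> = om_(i-1) + om_j\<close> (with
  \<open>om_(-1) = om_n = 0\<close>): \<open>P\<close> is built from minors of sizes
  \<open>i + 1\<close> and \<open>j\<close>, and under a lower triangular \<open>b\<close> acting on
  both arguments it picks up the minors of sizes \<open>i\<close> and \<open>j + 1\<close> of
  \<open>b\<close>. So \<open>N\<close> copies of \<open>om_i\<close> in one factor and of
  \<open>om_(j-1)\<close> in the other are spent, which is what (2) provides for both orders of the
  factors. Functions of a pair \<open>(g, h)\<close> are the right objects here, since they can be
  multiplied and raised to powers.

  The difficulty is the way back. \<open>V(\<lambda>)\<close> is only known as some irreducible
  matrix representation with a highest weight vector, and a multiplicity demands an explicit
  complement that is again a representation. Both are settled by comparing Gram kernels on orbits:
  orbits with proportional kernels are related by a linear map, and the adjoint of that map for the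
  two forms is, up to a scalar, an equivariant retraction.\<close>

lemma mat_mult_entry:
  fixes A B :: "'a :: semiring_0 mat"
  assumes "i < dim_row A" "j < dim_col B" "dim_col A = dim_row B"
  shows "(A * B) $$ (i, j) = (\<Sum>k<dim_col A. A $$ (i, k) * B $$ (k, j))"
  using assms by (simp add: scalar_prod_def atLeast0LessThan)

lemma mat_1x1_eqI:
  "A \<in> carrier_mat 1 1 \<Longrightarrow> B \<in> carrier_mat 1 1 \<Longrightarrow> A $$ (0, 0) = B $$ (0, 0) \<Longrightarrow> A = B"
  by (intro eq_matI) auto

text \<open>The Hermitian conjugate. Rectangular matrices are included because vectors are handled
  as \<open>k x 1\<close> and covectors as \<open>1 x k\<close> matrices, so that one associativity
  law serves for all pairings.\<close>

definition hc :: "complex mat \<Rightarrow> complex mat" where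
  "hc A = mat (dim_col A) (dim_row A) (\<lambda>(i, j). cnj (A $$ (j, i)))"

lemma hc_dim [simp]: "dim_row (hc A) = dim_col A" "dim_col (hc A) = dim_row A"
  by (simp_all add: hc_def)

lemma hc_carrier [simp]: "hc A \<in> carrier_mat m n \<longleftrightarrow> A \<in> carrier_mat n m"
  unfolding carrier_mat_def by (simp add: conj_commute)

lemma hc_index [simp]: "i < dim_col A \<Longrightarrow> j < dim_row A \<Longrightarrow> hc A $$ (i, j) = cnj (A $$ (j, i))"
  by (simp add: hc_def)

lemma hc_hc [simp]: "hc (hc A) = A"
  by (intro eq_matI) auto

lemma hc_eq_iff: "hc A = hc B \<longleftrightarrow> A = B"
  by (metis hc_hc)

lemma hc_one [simp]: "hc (1\<^sub>m n) = 1\<^sub>m n"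
  by (intro eq_matI) auto

lemma hc_smult: "hc (c \<cdot>\<^sub>m A) = cnj c \<cdot>\<^sub>m hc A"
  by (intro eq_matI) auto

lemma hc_mult: "dim_col A = dim_row B \<Longrightarrow> hc (A * B) = hc B * hc A"
  by (intro eq_matI) (auto simp: mat_mult_entry mult.commute simp del: index_mult_mat(1))

lemma det_hc:
  assumes "A \<in> carrier_mat n n"
  shows "det (hc A) = cnj (det A)"
proof -
  interpret cnj: comm_ring_hom cnj by standard simp_all
  have "hc A = map_mat cnj (transpose_mat A)"
    using assms by (intro eq_matI) auto
  then show ?thesis
    using det_transpose[OF assms] by simp
qed

lemma hc_self_mult_zero:
  assumes "z \<in> carrier_mat k 1" "hc z * z = 0\<^sub>m 1 1"
  shows "z = 0\<^sub>m k 1"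
proof -
  have "(\<Sum>i<k. cnj (z $$ (i, 0)) * z $$ (i, 0)) = (hc z * z) $$ (0, 0)"
    using assms(1) by (subst mat_mult_entry) (auto intro!: sum.cong)
  then have "(\<Sum>i<k. cnj (z $$ (i, 0)) * z $$ (i, 0)) = 0"
    using assms(2) by simp
  moreover have "cnj (z $$ (i, 0)) * z $$ (i, 0) = of_real ((cmod (z $$ (i, 0)))\<^sup>2)" for i
    by (metis complex_norm_square mult.commute)
  ultimately have "of_real (\<Sum>i<k. (cmod (z $$ (i, 0)))\<^sup>2) = (0 :: complex)"
    by simp
  then have "(\<Sum>i<k. (cmod (z $$ (i, 0)))\<^sup>2) = 0"
    using of_real_eq_0_iff by blast
  then have "\<forall>i\<in>{..<k}. (cmod (z $$ (i, 0)))\<^sup>2 = 0"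
    by (subst (asm) sum_nonneg_eq_0_iff) auto
  then show ?thesis
    using assms(1) by (intro eq_matI) auto
qed

section \<open>Inverses, completion of one-sided inverses, extension of functionals\<close>

lemma mult_left_cancel_det:
  fixes H :: "'a :: field mat"
  assumes "H \<in> carrier_mat d d" "det H \<noteq> 0" "A \<in> carrier_mat d k" "B \<in> carrier_mat d k"
    and "H * A = H * B"
  shows "A = B"
proof -
  obtain K where "K \<in> carrier_mat d d" "K * H = 1\<^sub>m d"
    using det_non_zero_imp_unit[OF assms(1,2), of undefined]
    by (auto simp: Units_def ring_mat_def)
  then show ?thesis
    using assoc_mult_mat[of K d d H d A k] assoc_mult_mat[of K d d H d B k] assms by simp
qed

lemma inverse_exists_det:
  fixes H :: "'a :: field mat"
  assumes "H \<in> carrier_mat d d" "det H \<noteq> 0"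
  obtains K where "K \<in> carrier_mat d d" "K * H = 1\<^sub>m d" "H * K = 1\<^sub>m d"
  using det_non_zero_imp_unit[OF assms, of undefined] by (auto simp: Units_def ring_mat_def)

lemma det_nonzeroI:
  fixes H :: "'a :: field mat"
  assumes "H \<in> carrier_mat d d"
    and "\<And>y. y \<in> carrier_mat d 1 \<Longrightarrow> H * y = 0\<^sub>m d 1 \<Longrightarrow> y = 0\<^sub>m d 1"
  shows "det H \<noteq> 0"
proof
  assume "det H = 0"
  then obtain v where v: "v \<in> carrier_vec d" "v \<noteq> 0\<^sub>v d" "H *\<^sub>v v = 0\<^sub>v d"
    using det_0_iff_vec_prod_zero[OF assms(1)] by auto
  define y where "y = mat_of_cols d [v]"
  have y: "y \<in> carrier_mat d 1" and yi: "\<And>i. i < d \<Longrightarrow> y $$ (i, 0) = v $ i"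
    by (auto simp: y_def mat_of_cols_def)
  have c: "col y 0 = v" using v y yi by (intro eq_vecI) auto
  have "(H * y) $$ (i, 0) = 0" if "i < d" for i
    using arg_cong[OF v(3), of "\<lambda>w. w $ i"] that y assms(1) c by simp
  then have "H * y = 0\<^sub>m d 1"
    using y assms(1) by (intro eq_matI) auto
  then have "y = 0\<^sub>m d 1" using assms(2)[OF y] by simp
  then have "v = 0\<^sub>v d" using yi v(1) by (intro eq_vecI) auto
  then show False using v(2) by simp
qed

lemma ex_left_null_row:
  fixes A :: "'a :: field mat"
  assumes A: "A \<in> carrier_mat d k" and "k < d"
  obtains \<xi> where "\<xi> \<in> carrier_mat 1 d" "\<xi> \<noteq> 0\<^sub>m 1 d" "\<xi> * A = 0\<^sub>m 1 k"
proof -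
  \<comment> \<open>\<open>M\<close> is the transpose of \<open>A\<close>, padded with zero rows to
    a square matrix; \<open>k < d\<close> makes its last row vanish.\<close>
  define M where "M = mat d d (\<lambda>(i, j). if i < k then A $$ (j, i) else 0)"
  have M: "M \<in> carrier_mat d d" by (simp add: M_def)
  have "det M = (\<Sum>j<d. M $$ (d - 1, j) * cofactor M (d - 1) j)"
    using assms by (intro laplace_expansion_row[OF M]) auto
  also have "\<dots> = 0" using assms by (intro sum.neutral) (auto simp: M_def)
  finally obtain v where v: "v \<in> carrier_vec d" "v \<noteq> 0\<^sub>v d" "M *\<^sub>v v = 0\<^sub>v d"
    using det_0_iff_vec_prod_zero[OF M] by auto
  define \<xi> where "\<xi> = mat 1 d (\<lambda>(i, j). v $ j)"
  have "\<xi> \<noteq> 0\<^sub>m 1 d"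
  proof
    assume z: "\<xi> = 0\<^sub>m 1 d"
    have "v $ j = 0" if "j < d" for j
    proof -
      have "v $ j = \<xi> $$ (0, j)" using that by (simp add: \<xi>_def)
      then show ?thesis using z that by simp
    qed
    then show False using v(1,2) by (auto intro!: eq_vecI)
  qed
  moreover have "\<xi> * A = 0\<^sub>m 1 k"
  proof (intro eq_matI)
    fix i j assume "i < dim_row (0\<^sub>m 1 k :: 'a mat)" "j < dim_col (0\<^sub>m 1 k :: 'a mat)"
    then have j: "i = 0" "j < k" by auto
    have "(\<xi> * A) $$ (i, j) = (\<Sum>r<d. v $ r * A $$ (r, j))"
      using A j by (subst mat_mult_entry) (auto simp: \<xi>_def)
    also have "\<dots> = (M *\<^sub>v v) $ j"
      using j assms v(1) by (auto simp: mult_mat_vec_def scalar_prod_def M_def atLeast0LessThan mult.commute intro!: sum.cong)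
    finally show "(\<xi> * A) $$ (i, j) = (0\<^sub>m 1 k) $$ (i, j)"
      using v(3) j assms by simp
  qed (use A in \<open>auto simp: \<xi>_def\<close>)
  moreover have "\<xi> \<in> carrier_mat 1 d" by (simp add: \<xi>_def)
  ultimately show thesis using that by blast
qed

text \<open>Take a covector that vanishes on the image of \<open>A\<close> and a vector
  \<open>u\<close> on which it is 1, and push \<open>u\<close> into the kernel of \<open>B\<close>
  by the projection \<open>1 - A * B\<close>. The correction lies in the image of \<open>A\<close>,
  so the pairing with the covector survives.\<close>

lemma completion_step:
  fixes A B :: "'a :: field mat"
  assumes A: "A \<in> carrier_mat d k" and B: "B \<in> carrier_mat k d" and BA: "B * A = 1\<^sub>m k" and "k < d"
  obtains \<xi> e where "\<xi> \<in> carrier_mat 1 d" "e \<in> carrier_mat d 1"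
    "\<xi> * A = 0\<^sub>m 1 k" "B * e = 0\<^sub>m k 1" "\<xi> * e = 1\<^sub>m 1"
proof -
  obtain \<xi> where x: "\<xi> \<in> carrier_mat 1 d" "\<xi> \<noteq> 0\<^sub>m 1 d" "\<xi> * A = 0\<^sub>m 1 k"
    using ex_left_null_row[OF A \<open>k < d\<close>] by blast
  obtain r where r: "r < d" "\<xi> $$ (0, r) \<noteq> (0 :: 'a)"
  proof (rule ccontr)
    assume "\<not> thesis"
    then have "\<xi> = 0\<^sub>m 1 d" using x(1) that by (intro eq_matI) auto
    then show False using x(2) by simp
  qed
  define u :: "'a mat" where "u = mat d 1 (\<lambda>(i, j). if i = r then 1 / \<xi> $$ (0, r) else 0)"
  have u: "u \<in> carrier_mat d 1" by (simp add: u_def)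
  have xu: "\<xi> * u = 1\<^sub>m 1"
    using x r by (intro eq_matI) (auto simp: mat_mult_entry u_def if_distrib cong: if_cong simp del: index_mult_mat(1))
  define e where "e = u - A * (B * u)"
  have Bu: "B * u \<in> carrier_mat k 1" "A * (B * u) \<in> carrier_mat d 1" using A B u by auto
  have e: "e \<in> carrier_mat d 1" unfolding e_def by (rule minus_carrier_mat[OF Bu(2)])
  have "B * e = B * u - B * (A * (B * u))"
    unfolding e_def by (rule mult_minus_distrib_mat[OF B u Bu(2)])
  also have "B * (A * (B * u)) = B * u"
    using assoc_mult_mat[OF B A Bu(1)] BA left_mult_one_mat[OF Bu(1)] by metis
  finally have "B * e = 0\<^sub>m k 1" using Bu by auto
  moreover have "\<xi> * e = \<xi> * u - \<xi> * (A * (B * u))"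
    unfolding e_def by (rule mult_minus_distrib_mat[OF x(1) u Bu(2)])
  moreover have "\<xi> * (A * (B * u)) = 0\<^sub>m 1 1"
    using assoc_mult_mat[OF x(1) A Bu(1)] x(3) left_mult_zero_mat[OF Bu(1)] by metis
  moreover have "1\<^sub>m 1 - 0\<^sub>m 1 1 = (1\<^sub>m 1 :: 'a mat)" by (intro eq_matI) auto
  ultimately show thesis using that[OF x(1) e x(3)] xu by metis
qed

text \<open>Applied to an equivariant inclusion \<open>A\<close> and an equivariant retraction
  \<open>B\<close>, this is the change of basis that exhibits a retract as a direct summand. Rows
  and columns are added one at a time by \<open>completion_step\<close>.\<close>

lemma extend_to_inverse_pair:
  fixes A B :: "'a :: field mat"
  assumes A: "A \<in> carrier_mat d k" and B: "B \<in> carrier_mat k d" and BA: "B * A = 1\<^sub>m k"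
  shows "k \<le> d \<and> (\<exists>P Q. P \<in> carrier_mat d d \<and> Q \<in> carrier_mat d d \<and> Q * P = 1\<^sub>m d \<and>
    (\<forall>i<d. \<forall>j<k. P $$ (i, j) = A $$ (i, j) \<and> Q $$ (j, i) = B $$ (j, i)))"
  using assms
proof (induction "d - k" arbitrary: k A B)
  case 0
  have "k = d"
  proof (rule ccontr)
    assume "k \<noteq> d"
    then have "d < k" using 0 by simp
    from ex_left_null_row[OF 0(3) this] obtain \<xi> where x: "\<xi> \<in> carrier_mat 1 k" "\<xi> \<noteq> 0\<^sub>m 1 k" "\<xi> * B = 0\<^sub>m 1 d"
      by blast
    have "\<xi> = \<xi> * (B * A)" using 0 x by simp
    also have "\<dots> = 0\<^sub>m 1 k" using assoc_mult_mat[OF x(1) 0(3) 0(2)] x(3) 0(2) by simp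
    finally show False using x by simp
  qed
  then show ?case using 0 by (intro conjI exI[of _ A] exI[of _ B]) simp_all
next
  case (Suc c)
  then have kd: "k < d" by simp
  obtain \<xi> e where xe: "\<xi> \<in> carrier_mat 1 d" "e \<in> carrier_mat d 1"
    "\<xi> * A = 0\<^sub>m 1 k" "B * e = 0\<^sub>m k 1" "\<xi> * e = 1\<^sub>m 1"
    using completion_step[OF Suc.prems kd] by blast
  define A' where "A' = mat d (Suc k) (\<lambda>(i, j). if j < k then A $$ (i, j) else e $$ (i, 0))"
  define B' where "B' = mat (Suc k) d (\<lambda>(i, j). if i < k then B $$ (i, j) else \<xi> $$ (0, j))"
  have ent: "(\<Sum>r<d. B $$ (i, r) * A $$ (r, j)) = (if i = j then 1 else 0)"
     if "i < k" "j < k" for i j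
  proof -
    have "(B * A) $$ (i, j) = (\<Sum>r<d. B $$ (i, r) * A $$ (r, j))"
      using that Suc.prems(1,2) by (subst mat_mult_entry) auto
    then show ?thesis using that by (simp add: Suc.prems(3))
  qed
  have ent2: "(\<Sum>r<d. \<xi> $$ (0, r) * A $$ (r, j)) = 0" if "j < k" for j
    using arg_cong[OF xe(3), of "\<lambda>M. M $$ (0, j)"] that Suc.prems(1,2) xe
    by (subst (asm) mat_mult_entry) auto
  have ent3: "(\<Sum>r<d. B $$ (i, r) * e $$ (r, 0)) = 0" if "i < k" for i
    using arg_cong[OF xe(4), of "\<lambda>M. M $$ (i, 0)"] that Suc.prems(1,2) xe
    by (subst (asm) mat_mult_entry) auto
  have ent4: "(\<Sum>r<d. \<xi> $$ (0, r) * e $$ (r, 0)) = 1"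
    using arg_cong[OF xe(5), of "\<lambda>M. M $$ (0, 0)"] xe
    by (subst (asm) mat_mult_entry) auto
  have "B' * A' = 1\<^sub>m (Suc k)"
  proof (intro eq_matI)
    fix i j assume "i < dim_row (1\<^sub>m (Suc k) :: 'a mat)" "j < dim_col (1\<^sub>m (Suc k) :: 'a mat)"
    then have ij: "i < Suc k" "j < Suc k" by auto
    have "(B' * A') $$ (i, j) = (\<Sum>r<d. B' $$ (i, r) * A' $$ (r, j))"
      using ij by (subst mat_mult_entry) (auto simp: A'_def B'_def)
    also have "\<dots> = (\<Sum>r<d. (if i < k then B $$ (i, r) else \<xi> $$ (0, r)) * (if j < k then A $$ (r, j) else e $$ (r, 0)))"
      using ij by (intro sum.cong) (auto simp: A'_def B'_def)
    also have "\<dots> = 1\<^sub>m (Suc k) $$ (i, j)"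
      using ij by (cases "i < k"; cases "j < k") (auto simp: ent ent2 ent3 ent4)
    finally show "(B' * A') $$ (i, j) = 1\<^sub>m (Suc k) $$ (i, j)" .
  qed (auto simp: A'_def B'_def)
  moreover have "A' \<in> carrier_mat d (Suc k)" "B' \<in> carrier_mat (Suc k) d"
    by (auto simp: A'_def B'_def)
  moreover have "c = d - Suc k" using Suc by simp
  ultimately obtain P Q where PQ: "P \<in> carrier_mat d d" "Q \<in> carrier_mat d d" "Q * P = 1\<^sub>m d"
    and eq: "\<And>i j. i < d \<Longrightarrow> j < Suc k \<Longrightarrow> P $$ (i, j) = A' $$ (i, j) \<and> Q $$ (j, i) = B' $$ (j, i)"
    using Suc.hyps(1)[of "Suc k" A' B'] by blast
  have "P $$ (i, j) = A $$ (i, j) \<and> Q $$ (j, i) = B $$ (j, i)" if "i < d" "j < k" for i j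
    using eq[OF that(1), of j] that by (simp add: A'_def B'_def)
  then show ?case using PQ kd by (intro conjI exI[of _ P] exI[of _ Q]) simp_all
qed

text \<open>The device by which a scalar function on the group becomes a covector: \<open>f\<close>
  factors through the vectors \<open>x g\<close> as soon as every finite linear relation between
  them annihilates \<open>f\<close>. The induction eliminates the last coordinate against a pivot
  \<open>g0\<close>, so \<open>X\<close> may be infinite and no basis is chosen.\<close>

lemma linear_extension:
  fixes x :: "'g \<Rightarrow> nat \<Rightarrow> 'a :: field" and f :: "'g \<Rightarrow> 'a"
  assumes "\<And>k gs c. (\<And>a. a < k \<Longrightarrow> gs a \<in> X) \<Longrightarrow> (\<And>r. r < d \<Longrightarrow> (\<Sum>a<k. c a * x (gs a) r) = 0) \<Longrightarrow>
      (\<Sum>a<(k::nat). c a * f (gs a)) = 0"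
  shows "\<exists>\<xi>. \<forall>g\<in>X. (\<Sum>r<d. \<xi> r * x g r) = f g"
  using assms
proof (induction d arbitrary: x f)
  case 0
  have "f g = 0" if "g \<in> X" for g
    using 0[of 1 "\<lambda>_. g" "\<lambda>_. 1"] that by simp
  then show ?case by simp
next
  case (Suc d)
  show ?case
  proof (cases "\<forall>g\<in>X. x g d = 0")
    case True
    have "\<exists>\<xi>. \<forall>g\<in>X. (\<Sum>r<d. \<xi> r * x g r) = f g"
    proof (rule Suc.IH)
      fix k gs c assume "\<And>a. a < k \<Longrightarrow> gs a \<in> X" "\<And>r. r < d \<Longrightarrow> (\<Sum>a<(k::nat). c a * x (gs a) r) = 0"
      then show "(\<Sum>a<k. c a * f (gs a)) = 0"
        using True by (intro Suc.prems) (auto simp: less_Suc_eq)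
    qed
    then show ?thesis using True by simp
  next
    case False
    then obtain g0 where g0: "g0 \<in> X" "x g0 d \<noteq> 0" by auto
    define x' where "x' g r = x g r - (x g d / x g0 d) * x g0 r" for g r
    define f' where "f' g = f g - (x g d / x g0 d) * f g0" for g
    have "\<exists>\<xi>. \<forall>g\<in>X. (\<Sum>r<d. \<xi> r * x' g r) = f' g"
    proof (rule Suc.IH)
      fix k gs c assume gs: "\<And>a. a < k \<Longrightarrow> gs a \<in> X" and c: "\<And>r. r < d \<Longrightarrow> (\<Sum>a<(k::nat). c a * x' (gs a) r) = 0"
      \<comment> \<open>A relation between the reduced vectors \<open>x'\<close> becomes one between
        the original vectors when \<open>g0\<close> joins in with weight \<open>t\<close>.\<close>
      define t where "t = - (\<Sum>a<k. c a * (x (gs a) d / x g0 d))"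
      define gs' where "gs' a = (if a < k then gs a else g0)" for a
      define c' where "c' a = (if a < k then c a else t)" for a
      have "(\<Sum>a<Suc k. c' a * f (gs' a)) = 0"
      proof (rule Suc.prems)
        fix r assume r: "r < Suc d"
        have "(\<Sum>a<Suc k. c' a * x (gs' a) r) = (\<Sum>a<k. c a * x (gs a) r) + t * x g0 r"
          by (simp add: c'_def gs'_def)
        also have "\<dots> = (\<Sum>a<k. c a * x' (gs a) r)"
          by (simp add: t_def x'_def algebra_simps sum_subtractf sum_distrib_left)
        also have "\<dots> = 0"
          using c r g0 by (cases "r < d") (auto simp: x'_def less_Suc_eq)
        finally show "(\<Sum>a<Suc k. c' a * x (gs' a) r) = 0" .
      qed (auto simp: gs'_def gs g0)
      then have "(\<Sum>a<k. c a * f (gs a)) + t * f g0 = 0"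
        by (simp add: c'_def gs'_def)
      then show "(\<Sum>a<k. c a * f' (gs a)) = 0"
        by (simp add: t_def f'_def algebra_simps sum_subtractf sum_distrib_left)
    qed
    then obtain \<xi> where xi: "\<And>g. g \<in> X \<Longrightarrow> (\<Sum>r<d. \<xi> r * x' g r) = f' g" by blast
    \<comment> \<open>The last coefficient is forced by the value at \<open>g0\<close>, where the
      reduced vector is zero.\<close>
    define s where "s = (f g0 - (\<Sum>r<d. \<xi> r * x g0 r)) / x g0 d"
    have "(\<Sum>r<Suc d. (\<xi>(d := s)) r * x g r) = f g" if "g \<in> X" for g
    proof -
      have "(\<Sum>r<Suc d. (\<xi>(d := s)) r * x g r) = (\<Sum>r<d. \<xi> r * x g r) + s * x g d"
        by simp
      also have "(\<Sum>r<d. \<xi> r * x g r) = f' g + (x g d / x g0 d) * (\<Sum>r<d. \<xi> r * x g0 r)"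
        unfolding xi[OF that, symmetric] x'_def
        by (simp add: algebra_simps sum_subtractf sum_distrib_left)
      also have "\<dots> + s * x g d = f g"
        using g0 by (simp add: f'_def s_def field_simps)
      finally show ?thesis .
    qed
    then show ?thesis by blast
  qed
qed

section \<open>Kronecker products\<close>

lemma sum_div_mod:
  fixes f :: "nat \<Rightarrow> nat \<Rightarrow> 'a :: comm_monoid_add"
  assumes "0 < b"
  shows "(\<Sum>k<a * b. f (k div b) (k mod b)) = (\<Sum>i<a. \<Sum>j<b. f i j)"
proof -
  have "(\<Sum>i<a. \<Sum>j<b. f i j) = (\<Sum>i<a. \<Sum>k\<in>{i * b..<i * b + b}. f (k div b) (k mod b))"
  proof (rule sum.cong[OF refl])
    fix i
    have "(\<Sum>k\<in>{i * b..<i * b + b}. f (k div b) (k mod b)) = (\<Sum>j<b. f ((j + i * b) div b) ((j + i * b) mod b))"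
      using sum.shift_bounds_nat_ivl[of "\<lambda>k. f (k div b) (k mod b)" 0 "i * b" b]
      by (simp add: atLeast0LessThan add.commute)
    also have "\<dots> = (\<Sum>j<b. f i j)"
      using assms by (intro sum.cong) auto
    finally show "(\<Sum>j<b. f i j) = (\<Sum>k\<in>{i * b..<i * b + b}. f (k div b) (k mod b))" ..
  qed
  then show ?thesis by (simp add: sum.nat_group)
qed

lemma kronecker_dim [simp]:
  "dim_row (kronecker A B) = dim_row A * dim_row B"
  "dim_col (kronecker A B) = dim_col A * dim_col B"
  by (simp_all add: kronecker_def)

lemma kronecker_carrier [intro, simp]:
  "A \<in> carrier_mat a b \<Longrightarrow> B \<in> carrier_mat c d \<Longrightarrow> kronecker A B \<in> carrier_mat (a * c) (b * d)"
  by (auto simp: kronecker_def)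

lemma kronecker_index:
  "i < dim_row A * dim_row B \<Longrightarrow> j < dim_col A * dim_col B \<Longrightarrow>
   kronecker A B $$ (i, j) = A $$ (i div dim_row B, j div dim_col B) * B $$ (i mod dim_row B, j mod dim_col B)"
  by (simp add: kronecker_def)

lemma div_mod_less:
  fixes i a b :: nat
  assumes "i < a * b" shows "i div b < a" "i mod b < b" "0 < b"
proof -
  show "0 < b" using assms by (cases b) auto
  then show "i div b < a" "i mod b < b"
    using assms by (simp_all add: less_mult_imp_div_less)
qed

lemma kronecker_mult:
  fixes A B C D :: "'a :: comm_semiring_0 mat"
  assumes "dim_col A = dim_row C" "dim_col B = dim_row D"
  shows "kronecker A B * kronecker C D = kronecker (A * C) (B * D)"
proof (intro eq_matI)
  fix i j assume "i < dim_row (kronecker (A * C) (B * D))" "j < dim_col (kronecker (A * C) (B * D))"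
  then have i: "i < dim_row A * dim_row B" and j: "j < dim_col C * dim_col D" by auto
  note [simp] = div_mod_less[OF i] div_mod_less[OF j]
  let ?i = "i div dim_row B" and ?i' = "i mod dim_row B" and ?j = "j div dim_col D" and ?j' = "j mod dim_col D"
  have "(kronecker A B * kronecker C D) $$ (i, j) =
     (\<Sum>k<dim_col A * dim_col B. kronecker A B $$ (i, k) * kronecker C D $$ (k, j))"
    using i j assms by (subst mat_mult_entry) auto
  also have "\<dots> = (\<Sum>k<dim_col A * dim_col B. A $$ (?i, k div dim_col B) * B $$ (?i', k mod dim_col B) *
      (C $$ (k div dim_col B, ?j) * D $$ (k mod dim_col B, ?j')))"
    using i j assms by (intro sum.cong) (auto simp: kronecker_index)
  also have "\<dots> = (\<Sum>k<dim_col A. \<Sum>l<dim_col B. A $$ (?i, k) * B $$ (?i', l) * (C $$ (k, ?j) * D $$ (l, ?j')))"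
  proof (cases "dim_col B = 0")
    case False
    then show ?thesis
      by (intro sum_div_mod[where f = "\<lambda>k l. A $$ (?i, k) * B $$ (?i', l) * (C $$ (k, ?j) * D $$ (l, ?j'))"]) simp
  qed simp
  also have "\<dots> = (\<Sum>k<dim_col A. A $$ (?i, k) * C $$ (k, ?j)) * (\<Sum>l<dim_col B. B $$ (?i', l) * D $$ (l, ?j'))"
    by (simp add: sum_product ac_simps)
  also have "\<dots> = kronecker (A * C) (B * D) $$ (i, j)"
    using i j assms by (simp add: kronecker_index mat_mult_entry del: index_mult_mat(1))
  finally show "(kronecker A B * kronecker C D) $$ (i, j) = kronecker (A * C) (B * D) $$ (i, j)" .
qed auto

lemma hc_kronecker: "hc (kronecker A B) = kronecker (hc A) (hc B)"
  by (intro eq_matI) (auto simp: kronecker_index div_mod_less)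

lemma kronecker_one:
  "kronecker (1\<^sub>m a) (1\<^sub>m b) = (1\<^sub>m (a * b) :: 'a :: comm_semiring_1 mat)"
proof (intro eq_matI)
  fix i j assume "i < dim_row (1\<^sub>m (a * b) :: 'a mat)" "j < dim_col (1\<^sub>m (a * b) :: 'a mat)"
  then have i: "i < a * b" and j: "j < a * b" by auto
  have "i div b = j div b \<and> i mod b = j mod b \<longleftrightarrow> i = j"
    by (metis div_mult_mod_eq)
  then show "kronecker (1\<^sub>m a) (1\<^sub>m b) $$ (i, j) = (1\<^sub>m (a * b) :: 'a mat) $$ (i, j)"
    using i j by (auto simp: kronecker_index div_mod_less)
qed auto

lemma kronecker_1x1:
  fixes A :: "'a :: comm_semiring_1 mat"
  shows "kronecker A (1\<^sub>m 1) = A" "kronecker (1\<^sub>m 1) A = A"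
  by (rule eq_matI; auto simp: kronecker_index div_mod_less)+

lemma det_kronecker_nonzero:
  fixes A B :: "'a :: field mat"
  assumes "A \<in> carrier_mat a a" "B \<in> carrier_mat b b" "det A \<noteq> 0" "det B \<noteq> 0"
  shows "det (kronecker A B) \<noteq> 0"
proof -
  obtain K where K: "K \<in> carrier_mat a a" "K * A = 1\<^sub>m a" using inverse_exists_det[OF assms(1,3)] by blast
  obtain L where L: "L \<in> carrier_mat b b" "L * B = 1\<^sub>m b" using inverse_exists_det[OF assms(2,4)] by blast
  have "kronecker K L * kronecker A B = 1\<^sub>m (a * b)"
    using assms K L by (subst kronecker_mult) (auto simp: kronecker_one)
  then have "det (kronecker K L) * det (kronecker A B) = 1"
    using det_mult[of "kronecker K L" "a * b" "kronecker A B"] assms K L by simp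
  then show ?thesis by auto
qed

section \<open>Leading minors and the big cell\<close>

definition lead :: "nat \<Rightarrow> 'a mat \<Rightarrow> 'a mat" where
  "lead k A = mat k k (\<lambda>(i, j). A $$ (i, j))"

definition leading_minor :: "nat \<Rightarrow> 'a :: comm_ring_1 mat \<Rightarrow> 'a" where
  "leading_minor k A = det (lead k A)"

text \<open>The exponent \<open>e k\<close> is the coefficient of \<open>om_k\<close>, which belongs
  to the minor of size \<open>Suc k\<close>. The minor of size \<open>Suc n\<close> is left out
  because it is 1 on the group; natural exponents keep the function polynomial.\<close>

definition flag_pow :: "nat \<Rightarrow> (nat \<Rightarrow> nat) \<Rightarrow> complex mat \<Rightarrow> complex" where
  "flag_pow n e g = (\<Prod>k<n. leading_minor (Suc k) g ^ e k)"

definition lower_triangular :: "'a :: zero mat \<Rightarrow> bool" where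
  "lower_triangular A \<longleftrightarrow> (\<forall>i<dim_row A. \<forall>j<dim_col A. i < j \<longrightarrow> A $$ (i, j) = 0)"

lemma lead_carrier [simp]: "lead k A \<in> carrier_mat k k"
  and lead_dim [simp]: "dim_row (lead k A) = k" "dim_col (lead k A) = k"
  by (simp_all add: lead_def)

lemma lead_index [simp]: "i < k \<Longrightarrow> j < k \<Longrightarrow> lead k A $$ (i, j) = A $$ (i, j)"
  by (simp add: lead_def)

lemma leading_minor_0 [simp]: "leading_minor 0 A = 1"
  by (simp add: leading_minor_def)

lemma lead_self: "A \<in> carrier_mat m m \<Longrightarrow> lead m A = A"
  by (intro eq_matI) auto

lemma leading_minor_self: "A \<in> carrier_mat m m \<Longrightarrow> leading_minor m A = det A"
  by (simp add: leading_minor_def lead_self)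

lemma sum_lessThan_truncate:
  fixes f :: "nat \<Rightarrow> 'a :: comm_monoid_add"
  assumes "k \<le> m" "\<And>i. k \<le> i \<Longrightarrow> i < m \<Longrightarrow> f i = 0"
  shows "(\<Sum>i<m. f i) = (\<Sum>i<k. f i)"
  using assms by (intro sum.mono_neutral_right) auto

text \<open>The first \<open>k\<close> rows of a lower triangular matrix vanish beyond column
  \<open>k - 1\<close>, so leading blocks multiply. This is what makes leading minors semi-invariant
  under lower triangular left factors.\<close>

lemma lead_lower_mult:
  fixes A B :: "'a :: comm_ring_1 mat"
  assumes "A \<in> carrier_mat m m" "B \<in> carrier_mat m m" "lower_triangular A" "k \<le> m"
  shows "lead k (A * B) = lead k A * lead k B"
proof (intro eq_matI)
  fix i j assume "i < dim_row (lead k A * lead k B)" "j < dim_col (lead k A * lead k B)"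
  then have ij: "i < k" "j < k" by auto
  have "(A * B) $$ (i, j) = (\<Sum>r<m. A $$ (i, r) * B $$ (r, j))"
    using ij assms by (subst mat_mult_entry) auto
  also have "\<dots> = (\<Sum>r<k. A $$ (i, r) * B $$ (r, j))"
    using ij assms by (intro sum_lessThan_truncate) (auto simp: lower_triangular_def)
  finally show "lead k (A * B) $$ (i, j) = (lead k A * lead k B) $$ (i, j)"
    using ij by (simp add: mat_mult_entry del: index_mult_mat(1))
qed auto

lemma leading_minor_lower_mult:
  fixes A B :: "'a :: comm_ring_1 mat"
  assumes "A \<in> carrier_mat m m" "B \<in> carrier_mat m m" "lower_triangular A" "k \<le> m"
  shows "leading_minor k (A * B) = leading_minor k A * leading_minor k B"
  using assms by (simp add: leading_minor_def lead_lower_mult det_mult[of _ k])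

lemma leading_minor_upper:
  assumes "A \<in> carrier_mat m m" "upper_triangular A" "k \<le> m"
  shows "leading_minor k A = (\<Prod>i<k. A $$ (i, i))"
proof -
  have "upper_triangular (lead k A)" using assms by (auto simp: upper_triangular_def)
  then have "leading_minor k A = prod_list (diag_mat (lead k A))"
    unfolding leading_minor_def by (intro det_upper_triangular) auto
  also have "\<dots> = (\<Prod>i<k. lead k A $$ (i, i))"
    by (simp add: prod_list_diag_prod atLeast0LessThan)
  also have "\<dots> = (\<Prod>i<k. A $$ (i, i))" by (intro prod.cong) auto
  finally show ?thesis .
qed

lemma leading_minor_lower_unit:
  assumes "A \<in> carrier_mat m m" "lower_triangular A" "\<And>i. i < m \<Longrightarrow> A $$ (i, i) = 1" "k \<le> m"
  shows "leading_minor k A = 1"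
proof -
  have "leading_minor k A = prod_list (diag_mat (lead k A))"
    unfolding leading_minor_def using assms by (intro det_lower_triangular[of k]) (auto simp: lower_triangular_def)
  also have "\<dots> = (\<Prod>i<k. lead k A $$ (i, i))"
    by (simp add: prod_list_diag_prod atLeast0LessThan)
  also have "\<dots> = 1" using assms by (intro prod.neutral) auto
  finally show ?thesis .
qed

lemma leading_minor_hc:
  assumes "A \<in> carrier_mat m m" "k \<le> m"
  shows "leading_minor k (hc A) = cnj (leading_minor k A)"
proof -
  have "lead k (hc A) = hc (lead k A)" using assms by (intro eq_matI) auto
  then show ?thesis by (simp add: leading_minor_def det_hc[of _ k])
qed

text \<open>Induction by bordering: the leading block of size \<open>m\<close> is already factored,
  its factors are invertible because its determinant is nonzero, and one solves for the new column,
  the new row and the corner. The corner \<open>S\<close> is the Schur complement.\<close>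

lemma lu_exists:
  fixes A :: "'a :: field mat"
  assumes "A \<in> carrier_mat m m" "\<And>k. k \<le> m \<Longrightarrow> leading_minor k A \<noteq> 0"
  shows "\<exists>L U. L \<in> carrier_mat m m \<and> U \<in> carrier_mat m m \<and> lower_triangular L \<and>
    (\<forall>i<m. L $$ (i, i) = 1) \<and> upper_triangular U \<and> A = L * U"
  using assms
proof (induction m arbitrary: A)
  case 0
  then show ?case
    by (intro exI[of _ "1\<^sub>m 0"]) (auto simp: lower_triangular_def upper_triangular_def intro!: eq_matI)
next
  case (Suc m)
  let ?A = "lead m A"
  have lead2: "leading_minor k ?A = leading_minor k A" if "k \<le> m" for k
  proof -
    have "lead k ?A = lead k A" using that by (intro eq_matI) auto
    then show ?thesis by (simp add: leading_minor_def)
  qed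
  have "\<And>k. k \<le> m \<Longrightarrow> leading_minor k ?A \<noteq> 0" using Suc.prems(2) lead2 by simp
  from Suc.IH[OF lead_carrier this] obtain L U where L: "L \<in> carrier_mat m m" and U: "U \<in> carrier_mat m m"
    and low: "lower_triangular L" "\<And>i. i < m \<Longrightarrow> L $$ (i, i) = 1" and up: "upper_triangular U"
    and A: "?A = L * U" by blast
  have "leading_minor m ?A \<noteq> 0" using Suc.prems(2)[of m] lead2[of m] by simp
  then have "det L * det U \<noteq> 0" using A det_mult[OF L U] leading_minor_self[OF lead_carrier, of m A] by simp
  then have "det L \<noteq> 0" "det U \<noteq> 0" by auto
  then obtain L' U' where L': "L' \<in> carrier_mat m m" "L * L' = 1\<^sub>m m"
      and U': "U' \<in> carrier_mat m m" "U' * U = 1\<^sub>m m"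
    by (meson inverse_exists_det[OF L] inverse_exists_det[OF U])
  define x where "x = mat m 1 (\<lambda>(i, j). A $$ (i, m))"
  define y where "y = mat 1 m (\<lambda>(i, j). A $$ (m, j))"
  define X where "X = L' * x"
  define Z where "Z = y * U'"
  define S where "S = mat 1 1 (\<lambda>_. A $$ (m, m)) - Z * X"
  have c: "x \<in> carrier_mat m 1" "y \<in> carrier_mat 1 m" by (auto simp: x_def y_def)
  have X: "X \<in> carrier_mat m 1" "L * X = x"
    using c L L' assoc_mult_mat[OF L L'(1) c(1)] by (auto simp: X_def)
  have Z: "Z \<in> carrier_mat 1 m" "Z * U = y"
    using c U U' assoc_mult_mat[OF c(2) U'(1) U] by (auto simp: Z_def)
  have S: "S \<in> carrier_mat 1 1" "Z * X + S = mat 1 1 (\<lambda>_. A $$ (m, m))"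
    using X Z by (auto simp: S_def intro!: eq_matI)
  define LL where "LL = four_block_mat L (0\<^sub>m m 1) Z (1\<^sub>m 1)"
  define UU where "UU = four_block_mat U X (0\<^sub>m 1 m) S"
  have "LL * UU = four_block_mat (L * U + 0\<^sub>m m 1 * 0\<^sub>m 1 m) (L * X + 0\<^sub>m m 1 * S)
      (Z * U + 1\<^sub>m 1 * 0\<^sub>m 1 m) (Z * X + 1\<^sub>m 1 * S)"
    unfolding LL_def UU_def by (rule mult_four_block_mat) (use L U X Z S in auto)
  also have "L * U + 0\<^sub>m m 1 * 0\<^sub>m 1 m = ?A" using A L U by (auto intro!: eq_matI)
  also have "L * X + 0\<^sub>m m 1 * S = x" using X(2) c S by (auto intro!: eq_matI)
  also have "Z * U + 1\<^sub>m 1 * 0\<^sub>m 1 m = y" using Z(2) c by (auto intro!: eq_matI)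
  also have "Z * X + 1\<^sub>m 1 * S = mat 1 1 (\<lambda>_. A $$ (m, m))" using S by simp
  also have "four_block_mat ?A x y (mat 1 1 (\<lambda>_. A $$ (m, m))) = A"
    using Suc.prems(1) by (intro eq_matI) (auto simp: x_def y_def less_Suc_eq)
  finally have "A = LL * UU" ..
  moreover have "LL \<in> carrier_mat (Suc m) (Suc m)" "UU \<in> carrier_mat (Suc m) (Suc m)"
    using L U S by (auto simp: LL_def UU_def)
  moreover have "lower_triangular LL" "upper_triangular UU"
    using low up L U S Z X by (auto simp: lower_triangular_def upper_triangular_def LL_def UU_def)
  moreover have "\<forall>i<Suc m. LL $$ (i, i) = 1" using low L Z by (auto simp: LL_def less_Suc_eq)
  ultimately show ?case by blast
qed

section \<open>The group and its big cell\<close>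

lemma SL_D: "g \<in> SL n \<Longrightarrow> g \<in> carrier_mat (Suc n) (Suc n)" "g \<in> SL n \<Longrightarrow> det g = 1"
  by (auto simp: SL_def)

lemma SL_one [simp]: "1\<^sub>m (Suc n) \<in> SL n"
  by (simp add: SL_def)

lemma SL_mult: "g \<in> SL n \<Longrightarrow> h \<in> SL n \<Longrightarrow> g * h \<in> SL n"
  by (auto simp: SL_def det_mult)

lemma SL_hc: "g \<in> SL n \<Longrightarrow> hc g \<in> SL n"
  by (auto simp: SL_def det_hc)

lemma leading_minor_SL: "g \<in> SL n \<Longrightarrow> leading_minor (Suc n) g = 1"
  by (simp add: SL_def leading_minor_self)

text \<open>Nonvanishing minors describe the open cell in a way suited to the density argument;
  \<open>big_cell_lu\<close> recovers the factorization.\<close>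

definition big_cell :: "nat \<Rightarrow> complex mat set" where
  "big_cell n = {g \<in> SL n. \<forall>k\<le>Suc n. leading_minor k g \<noteq> 0}"

lemma big_cell_lu:
  assumes "g \<in> big_cell n"
  obtains l b where "l \<in> SL n" "b \<in> SL n" "lower_triangular l" "\<And>i. i < Suc n \<Longrightarrow> l $$ (i, i) = 1"
    "upper_triangular b" "g = l * b"
proof -
  have g: "g \<in> carrier_mat (Suc n) (Suc n)" "det g = 1" using assms by (auto simp: big_cell_def SL_def)
  obtain L U where L: "L \<in> carrier_mat (Suc n) (Suc n)" and U: "U \<in> carrier_mat (Suc n) (Suc n)"
    and low: "lower_triangular L" "\<forall>i<Suc n. L $$ (i, i) = 1" and up: "upper_triangular U" "g = L * U"
    using lu_exists[OF g(1)] assms by (auto simp: big_cell_def)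
  have dL: "det L = 1" using leading_minor_lower_unit[OF L low(1), of "Suc n"] low(2) leading_minor_self[OF L] by simp
  then have "det U = 1" using det_mult[OF L U] g(2) up(2) by simp
  then show thesis using that[of L U] L U low up dL by (auto simp: SL_def)
qed

section \<open>Polynomial functions and density of the big cell\<close>

lemma polynomial_fun_sum:
  "(\<And>i. i \<in> A \<Longrightarrow> polynomial_fun n (f i)) \<Longrightarrow> polynomial_fun n (\<lambda>g. \<Sum>i\<in>A. f i g)"
  by (induction A rule: infinite_finite_induct) (auto intro: polynomial_fun.intros)

lemma polynomial_fun_prod:
  "(\<And>i. i \<in> A \<Longrightarrow> polynomial_fun n (f i)) \<Longrightarrow> polynomial_fun n (\<lambda>g. \<Prod>i\<in>A. f i g)"
  by (induction A rule: infinite_finite_induct) (auto intro: polynomial_fun.intros)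

lemma polynomial_fun_power: "polynomial_fun n f \<Longrightarrow> polynomial_fun n (\<lambda>g. f g ^ k)"
  by (induction k) (auto intro: polynomial_fun.intros)

lemma polynomial_fun_det:
  assumes "\<And>i j. i < k \<Longrightarrow> j < k \<Longrightarrow> polynomial_fun n (\<lambda>g. f g i j)"
  shows "polynomial_fun n (\<lambda>g. det (mat k k (\<lambda>(i, j). f g i j)))"
proof -
  have "det (mat k k (\<lambda>(i, j). f g i j)) =
     (\<Sum>p | p permutes {0..<k}. signof p * (\<Prod>i = 0..<k. f g i (p i)))" for g
    by (subst det_def'[of _ k]) (auto intro!: sum.cong prod.cong dest: permutes_in_image)
  moreover have "polynomial_fun n (\<lambda>g. \<Sum>p | p permutes {0..<k}. signof p * (\<Prod>i = 0..<k. f g i (p i)))"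
    using assms by (intro polynomial_fun_sum polynomial_fun.mult polynomial_fun.const polynomial_fun_prod)
       (auto dest: permutes_in_image)
  ultimately show ?thesis by simp
qed

lemma polynomial_fun_leading_minor: "k \<le> Suc n \<Longrightarrow> polynomial_fun n (leading_minor k)"
  unfolding leading_minor_def[abs_def] lead_def
  by (intro polynomial_fun_det polynomial_fun.entry) auto

lemma polynomial_fun_flag_pow: "polynomial_fun n (flag_pow n e)"
  unfolding flag_pow_def[abs_def]
  by (intro polynomial_fun_prod polynomial_fun_power polynomial_fun_leading_minor) auto

lemma polynomial_fun_tendsto:
  assumes "polynomial_fun n p"
    and "\<And>i j. i \<le> n \<Longrightarrow> j \<le> n \<Longrightarrow> ((\<lambda>z. X z $$ (i, j)) \<longlongrightarrow> Y $$ (i, j)) F"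
  shows "((\<lambda>z. p (X z)) \<longlongrightarrow> p Y) F"
  using assms by (induction) (auto intro: tendsto_intros)

lemma eventually_at_notin_finite:
  fixes a :: complex
  shows "finite S \<Longrightarrow> eventually (\<lambda>z. z \<notin> S) (at a)"
  by (induction S rule: finite_induct) (auto intro: eventually_conj eventually_neq_at_within)

text \<open>Up to sign the determinant is the characteristic polynomial of \<open>A\<close> at
  \<open>- z\<close>.\<close>

lemma finite_shift_singular:
  fixes A :: "complex mat"
  assumes "A \<in> carrier_mat k k"
  shows "finite {z. det (A + z \<cdot>\<^sub>m 1\<^sub>m k) = 0}"
proof -
  have "det (A + z \<cdot>\<^sub>m 1\<^sub>m k) = 0 \<longleftrightarrow> poly (char_poly A) (- z) = 0" for z
    using eigenvalue_root_char_poly[OF assms, of "- z"] eigenvalue_det[OF assms, of "- z"] assms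
    by (simp add: char_matrix_def)
  then have eq: "{z. det (A + z \<cdot>\<^sub>m 1\<^sub>m k) = 0} = uminus -` {z. poly (char_poly A) z = 0}"
    by auto
  have "char_poly A \<noteq> 0" using degree_monic_char_poly[OF assms] by auto
  then show ?thesis unfolding eq by (intro finite_vimageI poly_roots_finite) auto
qed

text \<open>Shift \<open>g\<close> by \<open>z\<close> times the identity: for all but finitely many
  \<open>z\<close> every leading minor becomes nonzero. Multiplying the first row by
  \<open>c z\<close> restores determinant 1 and scales every nonempty leading minor by the same
  nonzero factor, so the result lies in the big cell, and it tends to \<open>g\<close> as
  \<open>z\<close> tends to 0.\<close>

lemma big_cell_dense:
  assumes p: "polynomial_fun n p" and zero: "\<And>g. g \<in> big_cell n \<Longrightarrow> p g = 0" and g: "g \<in> SL n"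
  shows "p g = 0"
proof -
  let ?m = "Suc n"
  define G where "G z = g + z \<cdot>\<^sub>m 1\<^sub>m ?m" for z :: complex
  define c where "c z = 1 / det (G z)" for z
  define X where "X z = multrow 0 (c z) (G z)" for z
  have gc: "g \<in> carrier_mat ?m ?m" using g by (simp add: SL_D)
  have G: "G z \<in> carrier_mat ?m ?m" for z using gc by (simp add: G_def)
  have X: "X z \<in> carrier_mat ?m ?m" for z using G by (auto simp: X_def)
  have Gt: "((\<lambda>z. G z $$ (i, j)) \<longlongrightarrow> g $$ (i, j)) (at 0)" if "i \<le> n" "j \<le> n" for i j
  proof -
    have "((\<lambda>z. g $$ (i, j) + z * (if i = j then 1 else 0)) \<longlongrightarrow> g $$ (i, j) + 0 * (if i = j then 1 else 0)) (at 0)"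
      by (intro tendsto_intros)
    moreover have "G z $$ (i, j) = g $$ (i, j) + z * (if i = j then 1 else 0)" for z
      using that gc by (simp add: G_def)
    ultimately show ?thesis by simp
  qed
  have "((\<lambda>z. leading_minor ?m (G z)) \<longlongrightarrow> leading_minor ?m g) (at 0)"
    by (rule polynomial_fun_tendsto[OF polynomial_fun_leading_minor Gt]) auto
  then have "((\<lambda>z. det (G z)) \<longlongrightarrow> 1) (at 0)"
    using leading_minor_SL[OF g] leading_minor_self[OF G] by simp
  then have ct: "(c \<longlongrightarrow> 1) (at 0)" unfolding c_def[abs_def] using tendsto_divide[OF tendsto_const[of 1]] by force
  have Xt: "((\<lambda>z. X z $$ (i, j)) \<longlongrightarrow> g $$ (i, j)) (at 0)" if "i \<le> n" "j \<le> n" for i j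
  proof (cases "i = 0")
    case True
    have "((\<lambda>z. c z * G z $$ (i, j)) \<longlongrightarrow> 1 * g $$ (i, j)) (at 0)"
      by (intro tendsto_intros ct Gt that)
    moreover have "X z $$ (i, j) = c z * G z $$ (i, j)" for z
      using that G[of z] True by (simp add: X_def)
    ultimately show ?thesis by simp
  next
    case False
    then have "X z $$ (i, j) = G z $$ (i, j)" for z
      using that G[of z] by (simp add: X_def)
    then show ?thesis using Gt[OF that] by simp
  qed
  define S where "S = (\<Union>k\<in>{..?m}. {z. det (lead k g + z \<cdot>\<^sub>m 1\<^sub>m k) = 0})"
  have "finite S" by (simp add: S_def finite_shift_singular)
  have big: "X z \<in> big_cell n" if "z \<notin> S" for z
  proof -
    have lG: "leading_minor k (G z) \<noteq> 0" if "k \<le> ?m" for k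
    proof -
      have "lead k (G z) = lead k g + z \<cdot>\<^sub>m 1\<^sub>m k"
        using that gc by (intro eq_matI) (auto simp: G_def)
      then show ?thesis using \<open>z \<notin> S\<close> that by (auto simp: S_def leading_minor_def)
    qed
    have cz: "c z \<noteq> 0" using lG[of ?m] leading_minor_self[OF G] by (simp add: c_def)
    have "leading_minor k (X z) \<noteq> 0" if k: "k \<le> ?m" for k
    proof (cases "k = 0")
      case False
      then have "lead k (X z) = multrow 0 (c z) (lead k (G z))"
        using k G[of z] by (intro eq_matI) (auto simp: X_def)
      then have "leading_minor k (X z) = c z * leading_minor k (G z)"
        using False by (simp add: leading_minor_def det_multrow[of 0 k])
      then show ?thesis using cz lG k by simp
    qed simp
    moreover have "det (X z) = 1"
      using det_multrow[of 0 ?m "G z" "c z"] G[of z] cz by (simp add: X_def c_def)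
    ultimately show ?thesis using X by (simp add: big_cell_def SL_def)
  qed
  have "eventually (\<lambda>z. p (X z) = 0) (at 0)"
    using eventually_at_notin_finite[OF \<open>finite S\<close>] by eventually_elim (simp add: zero big)
  then have "((\<lambda>z. p (X z)) \<longlongrightarrow> 0) (at 0)"
    by (simp add: tendsto_eventually)
  moreover have "((\<lambda>z. p (X z)) \<longlongrightarrow> p g) (at 0)"
    by (rule polynomial_fun_tendsto[OF p Xt])
  ultimately show ?thesis using tendsto_unique at_neq_bot by blast
qed

lemma flag_pow_lower_mult:
  assumes "b \<in> SL n" "g \<in> SL n" "lower_triangular b"
  shows "flag_pow n e (b * g) = flag_pow n e b * flag_pow n e g"
proof -
  have "leading_minor (Suc k) (b * g) = leading_minor (Suc k) b * leading_minor (Suc k) g" if "k < n" for k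
    using assms that by (intro leading_minor_lower_mult[of _ "Suc n"]) (auto simp: SL_D)
  then show ?thesis by (simp add: flag_pow_def power_mult_distrib prod.distrib)
qed

lemma flag_pow_hc: "g \<in> SL n \<Longrightarrow> flag_pow n e (hc g) = cnj (flag_pow n e g)"
  by (simp add: flag_pow_def leading_minor_hc[of _ "Suc n"] SL_D)

lemma flag_pow_lower_unit:
  assumes "l \<in> SL n" "lower_triangular l" "\<And>i. i < Suc n \<Longrightarrow> l $$ (i, i) = 1"
  shows "flag_pow n e l = 1"
  unfolding flag_pow_def using assms
  by (intro prod.neutral ballI) (simp add: leading_minor_lower_unit[of _ "Suc n"] SL_D)

text \<open>The bridge from the characters of the statement to polynomial functions: dominance turns
  the integer powers into natural ones.\<close>

lemma weight_char_upper:
  assumes "b \<in> SL n" "upper_triangular b" "dominant n la"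
  shows "weight_char n la b = flag_pow n (\<lambda>k. nat (la $ k)) b"
  unfolding weight_char_def flag_pow_def
proof (rule prod.cong[OF refl])
  fix k assume "k \<in> {..<n}"
  then have k: "k < n" "0 \<le> la $ k" using assms by (auto simp: dominant_def)
  then have "leading_minor (Suc k) b = (\<Prod>i\<le>k. b $$ (i, i))"
    using assms by (subst leading_minor_upper[of _ "Suc n"]) (auto simp: SL_D lessThan_Suc_atMost)
  then show "(\<Prod>i\<le>k. b $$ (i, i)) powi (la $ k) = leading_minor (Suc k) b ^ nat (la $ k)"
    using k by (simp add: power_int_def)
qed

section \<open>Gram kernels of products of leading minors\<close>

text \<open>Only the first \<open>k\<close> columns occur, so for varying \<open>I\<close> these are
  the Pluecker coordinates of the span of the first \<open>k\<close> columns. \<open>I\<close> may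
  be neither injective nor increasing, so that Cauchy-Binet sums can run over all functions.\<close>

definition minor :: "nat \<Rightarrow> (nat \<Rightarrow> nat) \<Rightarrow> 'a :: comm_ring_1 mat \<Rightarrow> 'a" where
  "minor k I g = det (mat k k (\<lambda>(i, j). g $$ (I i, j)))"

lemma minor_cong: "(\<And>i. i < k \<Longrightarrow> I i = J i) \<Longrightarrow> minor k I g = minor k J g"
  unfolding minor_def by (rule arg_cong[where f = det]) (auto intro!: eq_matI)

lemma minor_id: "minor k (\<lambda>i. i) g = leading_minor k g"
  by (simp add: minor_def leading_minor_def lead_def)

text \<open>Multiplying out the entries of the product and collecting the permutations
  antisymmetrizes \<open>h\<close> only; the \<open>g\<close> part stays a plain product.\<close>

lemma cauchy_binet_functions:
  assumes g: "g \<in> carrier_mat m m" and h: "h \<in> carrier_mat m m" and k: "k \<le> m"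
  shows "leading_minor k (hc g * h) = (\<Sum>I\<in>PiE {0..<k} (\<lambda>_. {0..<m}). (\<Prod>i = 0..<k. cnj (g $$ (I i, i))) * minor k I h)"
proof -
  let ?P = "{p. p permutes {0..<k}}" and ?F = "PiE {0..<k} (\<lambda>_. {0..<m})"
  have "leading_minor k (hc g * h) = (\<Sum>p\<in>?P. signof p * (\<Prod>i = 0..<k. lead k (hc g * h) $$ (i, p i)))"
    unfolding leading_minor_def by (rule det_def'[OF lead_carrier])
  also have "\<dots> = (\<Sum>p\<in>?P. signof p * (\<Prod>i = 0..<k. \<Sum>r\<in>{0..<m}. cnj (g $$ (r, i)) * h $$ (r, p i)))"
  proof (intro sum.cong refl arg_cong2[where f = "(*)"] prod.cong)
    fix p i assume "p \<in> ?P" "i \<in> {0..<k}"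
    then have "i < k" "p i < k" by (auto dest: permutes_in_image)
    then show "lead k (hc g * h) $$ (i, p i) = (\<Sum>r\<in>{0..<m}. cnj (g $$ (r, i)) * h $$ (r, p i))"
      using g h k by (simp add: mat_mult_entry atLeast0LessThan del: index_mult_mat(1))
  qed
  also have "\<dots> = (\<Sum>p\<in>?P. \<Sum>I\<in>?F. signof p * (\<Prod>i = 0..<k. cnj (g $$ (I i, i)) * h $$ (I i, p i)))"
    by (simp add: prod_sum_PiE sum_distrib_left)
  also have "\<dots> = (\<Sum>I\<in>?F. \<Sum>p\<in>?P. signof p * (\<Prod>i = 0..<k. cnj (g $$ (I i, i)) * h $$ (I i, p i)))"
    by (rule sum.swap)
  also have "\<dots> = (\<Sum>I\<in>?F. (\<Prod>i = 0..<k. cnj (g $$ (I i, i))) * minor k I h)"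
  proof (intro sum.cong refl)
    fix I
    have "minor k I h = (\<Sum>p\<in>?P. signof p * (\<Prod>i = 0..<k. h $$ (I i, p i)))"
      unfolding minor_def
      by (subst det_def'[of _ k]) (auto intro!: sum.cong prod.cong dest: permutes_in_image)
    then show "(\<Sum>p\<in>?P. signof p * (\<Prod>i = 0..<k. cnj (g $$ (I i, i)) * h $$ (I i, p i))) =
        (\<Prod>i = 0..<k. cnj (g $$ (I i, i))) * minor k I h"
      by (simp add: prod.distrib sum_distrib_left ac_simps)
  qed
  finally show ?thesis .
qed

text \<open>Expand the minor of \<open>g\<close> over permutations \<open>s\<close> and replace
  \<open>I\<close> by \<open>I \<circ> s\<close>: the sign is absorbed by the minor of
  \<open>h\<close>, and each of the \<open>fact k\<close> permutations contributes the same sum. The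
  factorial appears because each set of rows is counted in every order.\<close>

lemma cauchy_binet_fact:
  assumes g: "g \<in> carrier_mat m m" and h: "h \<in> carrier_mat m m" and k: "k \<le> m"
  shows "fact k * leading_minor k (hc g * h) =
    (\<Sum>I\<in>PiE {0..<k} (\<lambda>_. {0..<m}). cnj (minor k I g) * minor k I h)"
proof -
  let ?P = "{p. p permutes {0..<k}}" and ?F = "PiE {0..<k} (\<lambda>_. {0..<m})"
  have "(\<Sum>I\<in>?F. cnj (minor k I g) * minor k I h) =
     (\<Sum>I\<in>?F. \<Sum>s\<in>?P. signof s * (\<Prod>j = 0..<k. cnj (g $$ (I (s j), j))) * minor k I h)"
  proof (intro sum.cong refl)
    fix I
    have "minor k I g = (\<Sum>s\<in>?P. signof s * (\<Prod>j = 0..<k. g $$ (I (s j), j)))"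
      unfolding minor_def
      by (subst det_col[of _ k]) (auto intro!: sum.cong prod.cong dest: permutes_in_image simp: atLeast0LessThan)
    then show "cnj (minor k I g) * minor k I h =
        (\<Sum>s\<in>?P. signof s * (\<Prod>j = 0..<k. cnj (g $$ (I (s j), j))) * minor k I h)"
      by (simp add: sum_distrib_right)
  qed
  also have "\<dots> = (\<Sum>s\<in>?P. \<Sum>I\<in>?F. signof s * (\<Prod>j = 0..<k. cnj (g $$ (I (s j), j))) * minor k I h)"
    by (rule sum.swap)
  also have "\<dots> = (\<Sum>s\<in>?P. leading_minor k (hc g * h))"
  proof (intro sum.cong refl)
    fix s assume "s \<in> ?P"
    then have s: "s permutes {0..<k}" by simp
    have sk: "s j < k \<longleftrightarrow> j < k" for j using permutes_in_image[OF s, of j] by auto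
    have "(\<Sum>I\<in>?F. signof s * (\<Prod>j = 0..<k. cnj (g $$ (I (s j), j))) * minor k I h) =
       (\<Sum>I\<in>?F. (\<Prod>j = 0..<k. cnj (g $$ ((I \<circ> s) j, j))) * minor k (I \<circ> s) h)"
    proof (intro sum.cong refl)
      fix I
      have "mat k k (\<lambda>(i, j). mat k k (\<lambda>(i, j). h $$ (I i, j)) $$ (s i, j)) = mat k k (\<lambda>(i, j). h $$ ((I \<circ> s) i, j))"
        by (intro eq_matI) (auto simp: sk)
      then have "minor k (I \<circ> s) h = signof s * minor k I h"
        unfolding minor_def using det_permute_rows[of "mat k k (\<lambda>(i, j). h $$ (I i, j))" k s] s by simp
      then show "signof s * (\<Prod>j = 0..<k. cnj (g $$ (I (s j), j))) * minor k I h =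
          (\<Prod>j = 0..<k. cnj (g $$ ((I \<circ> s) j, j))) * minor k (I \<circ> s) h"
        by simp
    qed
    also have "\<dots> = (\<Sum>I\<in>?F. (\<Prod>j = 0..<k. cnj (g $$ (I j, j))) * minor k I h)"
    \<comment> \<open>Precomposition with \<open>s\<close> permutes the extensional functions,
      because \<open>s\<close> maps \<open>{0..<k}\<close> to itself and fixes everything
      else.\<close>
    proof (rule sum.reindex_bij_witness[of _ "\<lambda>I. I \<circ> inv_into UNIV s" "\<lambda>I. I \<circ> s"])
      fix I assume I: "I \<in> ?F"
      have mem: "I \<circ> t \<in> ?F" if t: "t permutes {0..<k}" for t
      proof
        fix i assume "i \<in> {0..<k}"
        then have "t i \<in> {0..<k}" using permutes_in_image[OF t] by simp
        then show "(I \<circ> t) i \<in> {0..<m}" using I by auto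
      next
        fix i assume "i \<notin> {0..<k}"
        then have "t i = i" by (rule permutes_not_in[OF t])
        then show "(I \<circ> t) i = undefined" using I \<open>i \<notin> {0..<k}\<close> by (auto simp: PiE_def extensional_def)
      qed
      show "I \<circ> s \<in> ?F" "I \<circ> inv_into UNIV s \<in> ?F" using mem s permutes_inv[OF s] by blast+
      show "I \<circ> s \<circ> inv_into UNIV s = I" "I \<circ> inv_into UNIV s \<circ> s = I"
        using permutes_inv_o[OF s] by (simp_all add: comp_assoc)
    qed simp
    also have "\<dots> = leading_minor k (hc g * h)" using cauchy_binet_functions[OF g h k] ..
    finally show "(\<Sum>I\<in>?F. signof s * (\<Prod>j = 0..<k. cnj (g $$ (I (s j), j))) * minor k I h) = leading_minor k (hc g * h)" .
  qed
  also have "\<dots> = fact k * leading_minor k (hc g * h)"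
    by (simp add: card_permutations)
  finally show ?thesis ..
qed

text \<open>The scalar \<open>c\<close> absorbs the factorial in \<open>cauchy_binet_fact\<close>.\<close>

definition gramian :: "nat \<Rightarrow> (complex mat \<Rightarrow> complex) \<Rightarrow> (complex mat \<Rightarrow> complex) list \<Rightarrow> bool" where
  "gramian n F fs \<longleftrightarrow> (\<exists>c. c \<noteq> 0 \<and>
     (\<forall>g\<in>carrier_mat (Suc n) (Suc n). \<forall>h\<in>carrier_mat (Suc n) (Suc n).
        c * F (hc g * h) = (\<Sum>f\<leftarrow>fs. cnj (f g) * f h)))"

text \<open>These are the future matrix coefficients of a representation with kernel
  \<open>F\<close>, see \<open>hw_functional_of_section\<close>. The expansion may depend on
  \<open>f\<close>, so that each section can be certified by whichever list is at hand.\<close>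

definition flag_section :: "nat \<Rightarrow> (complex mat \<Rightarrow> complex) \<Rightarrow> (complex mat \<Rightarrow> complex) \<Rightarrow> bool" where
  "flag_section n F f \<longleftrightarrow> (\<exists>fs. gramian n F fs \<and> f \<in> set fs)"

lemma flag_section_one: "flag_section n (\<lambda>_. 1) (\<lambda>_. 1)"
  unfolding flag_section_def gramian_def
  by (intro exI[of _ "[\<lambda>_. 1]"] conjI exI[of _ 1]) auto

lemma sum_list_product_mult:
  fixes u v :: "'a \<Rightarrow> complex"
  shows "(\<Sum>x\<leftarrow>xs. u x) * (\<Sum>y\<leftarrow>ys. v y) = (\<Sum>(x, y)\<leftarrow>List.product xs ys. u x * v y)"
proof (induction xs)
  case (Cons x xs)
  have "(\<Sum>(a, b)\<leftarrow>map (Pair x) ys. u a * v b) = u x * (\<Sum>y\<leftarrow>ys. v y)"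
    by (induction ys) (auto simp: algebra_simps)
  then show ?case using Cons by (simp add: algebra_simps)
qed simp

text \<open>As in the Schur product theorem, the pointwise product of two Gram kernels is the Gram
  kernel of the pairwise products of their terms.\<close>

lemma flag_section_mult:
  assumes "flag_section n F f" "flag_section n G f'"
  shows "flag_section n (\<lambda>g. F g * G g) (\<lambda>g. f g * f' g)"
proof -
  obtain fs gs c d where f: "f \<in> set fs" "f' \<in> set gs" "c \<noteq> 0" "d \<noteq> 0"
    and 1: "\<And>g h. g \<in> carrier_mat (Suc n) (Suc n) \<Longrightarrow> h \<in> carrier_mat (Suc n) (Suc n) \<Longrightarrow>
        c * F (hc g * h) = (\<Sum>f\<leftarrow>fs. cnj (f g) * f h)"
    and 2: "\<And>g h. g \<in> carrier_mat (Suc n) (Suc n) \<Longrightarrow> h \<in> carrier_mat (Suc n) (Suc n) \<Longrightarrow>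
        d * G (hc g * h) = (\<Sum>f\<leftarrow>gs. cnj (f g) * f h)"
    using assms unfolding flag_section_def gramian_def by blast
  define ps where "ps = map (\<lambda>(u, v) g. u g * v g) (List.product fs gs)"
  have "gramian n (\<lambda>g. F g * G g) ps"
    unfolding gramian_def
  proof (intro exI[of _ "c * d"] conjI ballI)
    fix g h :: "complex mat" assume gh: "g \<in> carrier_mat (Suc n) (Suc n)" "h \<in> carrier_mat (Suc n) (Suc n)"
    have "c * d * (F (hc g * h) * G (hc g * h)) = (c * F (hc g * h)) * (d * G (hc g * h))"
      by simp
    also have "\<dots> = (\<Sum>f\<leftarrow>ps. cnj (f g) * f h)"
      unfolding 1[OF gh] 2[OF gh] sum_list_product_mult ps_def map_map
      by (rule arg_cong[where f = sum_list], rule map_cong) (auto simp: ac_simps)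
    finally show "c * d * (F (hc g * h) * G (hc g * h)) = (\<Sum>f\<leftarrow>ps. cnj (f g) * f h)" .
  qed (use f in auto)
  moreover have "(\<lambda>g. f g * f' g) \<in> set ps"
    using f by (force simp: ps_def image_iff)
  ultimately show ?thesis unfolding flag_section_def by blast
qed

lemma flag_section_power:
  assumes "flag_section n F f"
  shows "flag_section n (\<lambda>g. F g ^ e) (\<lambda>g. f g ^ e)"
  by (induction e) (auto intro: flag_section_one flag_section_mult[OF assms])

text \<open>All minors of size \<open>k\<close> are terms of the single expansion
  \<open>cauchy_binet_fact\<close>; \<open>restrict\<close> only normalizes \<open>I\<close> to an
  extensional function.\<close>

lemma flag_section_minor:
  assumes k: "k \<le> Suc n" and I: "\<And>i. i < k \<Longrightarrow> I i \<le> n"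
  shows "flag_section n (leading_minor k) (minor k I)"
proof -
  let ?F = "PiE {0..<k} (\<lambda>_. {0..<Suc n})"
  have "finite ?F" by (rule finite_PiE) simp_all
  from finite_distinct_list[OF this] obtain Is where Is: "set Is = ?F" "distinct Is" by (elim exE conjE)
  have "gramian n (leading_minor k) (map (minor k) Is)"
    unfolding gramian_def
  proof (intro exI[of _ "fact k"] conjI ballI)
    fix g h :: "complex mat" assume gh: "g \<in> carrier_mat (Suc n) (Suc n)" "h \<in> carrier_mat (Suc n) (Suc n)"
    show "fact k * leading_minor k (hc g * h) = (\<Sum>f\<leftarrow>map (minor k) Is. cnj (f g) * f h)"
      unfolding map_map sum_list_distinct_conv_sum_set[OF Is(2)] Is(1) comp_def
      by (rule cauchy_binet_fact[OF gh k])
  qed simp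
  moreover have "minor k I \<in> set (map (minor k) Is)"
  proof -
    have "restrict I {0..<k} \<in> ?F" by (intro restrict_PiE_iff[THEN iffD2] ballI) (use I in \<open>simp add: less_Suc_eq_le\<close>)
    moreover have "minor k I = minor k (restrict I {0..<k})"
      by (rule ext, rule minor_cong) simp
    ultimately show ?thesis unfolding set_map Is(1) by (metis image_eqI)
  qed
  ultimately show ?thesis unfolding flag_section_def by blast
qed

lemma flag_section_leading_minor: "k \<le> Suc n \<Longrightarrow> flag_section n (leading_minor k) (leading_minor k)"
  using flag_section_minor[of k n "\<lambda>i. i"] by (simp add: minor_id[abs_def])

lemma flag_section_flag_pow: "flag_section n (flag_pow n e) (flag_pow n e)"
proof -
  have "flag_section n (\<lambda>g. \<Prod>k<m. leading_minor (Suc k) g ^ e k) (\<lambda>g. \<Prod>k<m. leading_minor (Suc k) g ^ e k)" if "m \<le> n" for m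
    using that
    by (induction m) (auto intro!: flag_section_one flag_section_mult flag_section_power flag_section_leading_minor)
  then show ?thesis unfolding flag_pow_def[abs_def] by simp
qed

section \<open>The lowest weight functional of an irreducible representation\<close>

text \<open>Keeps the simplifier from turning \<open>carrier_mat d 1\<close> into \<open>carrier_mat d (Suc 0)\<close>.\<close>

declare One_nat_def [simp del]

lemma smult_index_carrier:
  "Y \<in> carrier_mat a b \<Longrightarrow> i < a \<Longrightarrow> j < b \<Longrightarrow> (c \<cdot>\<^sub>m Y) $$ (i, j) = c * Y $$ (i, j)"
  by (metis carrier_matD index_smult_mat(1))

lemma add_index_carrier:
  "X \<in> carrier_mat a b \<Longrightarrow> Y \<in> carrier_mat a b \<Longrightarrow> i < a \<Longrightarrow> j < b \<Longrightarrow>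
    (X + Y) $$ (i, j) = X $$ (i, j) + Y $$ (i, j)"
  by (metis carrier_matD index_add_mat(1))

section \<open>Matrix coefficients and limits along the torus\<close>

lemma representation_carrier:
  "representation n d \<rho> \<Longrightarrow> g \<in> SL n \<Longrightarrow> \<rho> g \<in> carrier_mat d d"
  by (simp add: representation_def)

lemma representation_mult:
  "representation n d \<rho> \<Longrightarrow> g \<in> SL n \<Longrightarrow> h \<in> SL n \<Longrightarrow> \<rho> (g * h) = \<rho> g * \<rho> h"
  by (simp add: representation_def)

lemma representation_one: "representation n d \<rho> \<Longrightarrow> \<rho> (1\<^sub>m (Suc n)) = 1\<^sub>m d"
  by (simp add: representation_def)

lemma representation_mult_left:
  assumes "representation n d \<rho>" "g \<in> SL n" "h \<in> SL n" "V \<in> carrier_mat d k"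
  shows "\<rho> g * (\<rho> h * V) = \<rho> (g * h) * V"
  using assoc_mult_mat[OF representation_carrier[OF assms(1,2)] representation_carrier[OF assms(1,3)] assms(4)]
    representation_mult[OF assms(1-3)] by simp

lemma polynomial_fun_matrix_coefficient:
  assumes "representation n d \<rho>" "A \<in> carrier_mat a d" "B \<in> carrier_mat d b" "i < a" "j < b"
  shows "\<exists>p. polynomial_fun n p \<and> (\<forall>g\<in>SL n. (A * (\<rho> g * B)) $$ (i, j) = p g)"
proof -
  have "\<forall>r s. r < d \<and> s < d \<longrightarrow> (\<exists>p. polynomial_fun n p \<and> (\<forall>g\<in>SL n. \<rho> g $$ (r, s) = p g))"
    using assms(1) by (auto simp: representation_def)
  then obtain p where p: "\<And>r s. r < d \<Longrightarrow> s < d \<Longrightarrow> polynomial_fun n (p r s)"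
    "\<And>r s g. r < d \<Longrightarrow> s < d \<Longrightarrow> g \<in> SL n \<Longrightarrow> \<rho> g $$ (r, s) = p r s g" by metis
  show ?thesis
  proof (intro exI[of _ "\<lambda>g. \<Sum>r<d. A $$ (i, r) * (\<Sum>s<d. p r s g * B $$ (s, j))"] conjI ballI)
    show "polynomial_fun n (\<lambda>g. \<Sum>r<d. A $$ (i, r) * (\<Sum>s<d. p r s g * B $$ (s, j)))"
      using p by (intro polynomial_fun_sum polynomial_fun.mult polynomial_fun.const) auto
  next
    fix g assume g: "g \<in> SL n"
    have \<rho>: "\<rho> g \<in> carrier_mat d d" using representation_carrier[OF assms(1) g] .
    have "(A * (\<rho> g * B)) $$ (i, j) = (\<Sum>r<d. A $$ (i, r) * (\<rho> g * B) $$ (r, j))"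
      using assms \<rho> by (subst mat_mult_entry) auto
    also have "\<dots> = (\<Sum>r<d. A $$ (i, r) * (\<Sum>s<d. p r s g * B $$ (s, j)))"
    proof (rule sum.cong[OF refl])
      fix r assume "r \<in> {..<d}"
      then have r: "r < d" by simp
      have "(\<rho> g * B) $$ (r, j) = (\<Sum>s<d. \<rho> g $$ (r, s) * B $$ (s, j))"
        using assms \<rho> r by (subst mat_mult_entry) auto
      also have "\<dots> = (\<Sum>s<d. p r s g * B $$ (s, j))"
        using p(2) r g by (intro sum.cong) auto
      finally show "A $$ (i, r) * (\<rho> g * B) $$ (r, j) = A $$ (i, r) * (\<Sum>s<d. p r s g * B $$ (s, j))" by simp
    qed
    finally show "(A * (\<rho> g * B)) $$ (i, j) = (\<Sum>r<d. A $$ (i, r) * (\<Sum>s<d. p r s g * B $$ (s, j)))" .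
  qed
qed

text \<open>The one-parameter subgroup \<open>diag (s^(-(1 + ... + n)), s, s^2, ..., s^n)\<close>.
  Its exponents increase down the diagonal, so conjugation contracts lower unitriangular matrices to
  the identity as \<open>s\<close> tends to 0; the first exponent is chosen to give determinant
  1.\<close>

definition torus_path :: "nat \<Rightarrow> complex \<Rightarrow> complex mat" where
  "torus_path n s = mat (Suc n) (Suc n) (\<lambda>(i, j). if i \<noteq> j then 0
     else if i = 0 then 1 / s ^ (\<Sum>k<n. Suc k) else s ^ i)"

lemma torus_path_carrier [simp]: "torus_path n s \<in> carrier_mat (Suc n) (Suc n)"
  by (simp add: torus_path_def)

lemma torus_path_upper: "upper_triangular (torus_path n s)"
  by (auto simp: torus_path_def upper_triangular_def)

lemma torus_path_SL:
  assumes "s \<noteq> 0" shows "torus_path n s \<in> SL n"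
proof -
  have "det (torus_path n s) = (\<Prod>i<Suc n. torus_path n s $$ (i, i))"
    using leading_minor_upper[OF torus_path_carrier torus_path_upper, of "Suc n" n s] leading_minor_self[OF torus_path_carrier]
    by simp
  also have "\<dots> = torus_path n s $$ (0, 0) * (\<Prod>i<n. torus_path n s $$ (Suc i, Suc i))"
    by (rule prod.lessThan_Suc_shift)
  also have "(\<Prod>i<n. torus_path n s $$ (Suc i, Suc i)) = (\<Prod>i<n. s ^ Suc i)"
    by (intro prod.cong) (auto simp: torus_path_def)
  also have "\<dots> = s ^ (\<Sum>k<n. Suc k)" by (rule power_sum[symmetric])
  finally show ?thesis using assms by (simp add: SL_def torus_path_def)
qed

lemma flag_pow_torus_path_nonzero:
  assumes "s \<noteq> 0" shows "flag_pow n e (torus_path n s) \<noteq> 0"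
proof -
  have "leading_minor (Suc k) (torus_path n s) \<noteq> 0" if "k < n" for k
    using that assms
    by (subst leading_minor_upper[OF torus_path_carrier torus_path_upper]) (auto simp: torus_path_def)
  then show ?thesis by (simp add: flag_pow_def)
qed

text \<open>The product \<open>t * l * t\<inverse>\<close> for \<open>t = torus_path n s\<close>, written so that it extends to \<open>s = 0\<close> with value \<open>1\<close>.\<close>

definition torus_conj :: "nat \<Rightarrow> complex mat \<Rightarrow> complex \<Rightarrow> complex mat" where
  "torus_conj n l s = mat (Suc n) (Suc n) (\<lambda>(i, j). l $$ (i, j) *
     (if i = j then 1 else if j = 0 then s ^ (i + (\<Sum>k<n. Suc k)) else s ^ (i - j)))"

lemma torus_conj_mult:
  assumes l: "l \<in> SL n" "lower_triangular l" and s: "s \<noteq> 0"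
  shows "torus_conj n l s * torus_path n s = torus_path n s * l"
proof (intro eq_matI)
  have lc: "l \<in> carrier_mat (Suc n) (Suc n)" using l SL_D by blast
  fix i j assume "i < dim_row (torus_path n s * l)" "j < dim_col (torus_path n s * l)"
  then have ij: "i < Suc n" "j < Suc n" using lc by (auto simp: torus_path_def)
  have "(torus_conj n l s * torus_path n s) $$ (i, j) =
      (\<Sum>r<Suc n. torus_conj n l s $$ (i, r) * torus_path n s $$ (r, j))"
    using ij by (subst mat_mult_entry) (auto simp: torus_conj_def torus_path_def)
  also have "\<dots> = (\<Sum>r<Suc n. if r = j then torus_conj n l s $$ (i, j) * torus_path n s $$ (j, j) else 0)"
    using ij by (intro sum.cong) (auto simp: torus_path_def)
  also have "\<dots> = torus_conj n l s $$ (i, j) * torus_path n s $$ (j, j)"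
    using ij by (subst sum.delta) auto
  also have "\<dots> = torus_path n s $$ (i, i) * l $$ (i, j)"
  proof (cases "i < j")
    case True
    then have "l $$ (i, j) = 0" using l(2) lc ij by (simp add: lower_triangular_def)
    then show ?thesis using ij by (simp add: torus_conj_def)
  next
    case False
    then consider "i = j" | "j = 0" "0 < i" | "0 < j" "j < i" by linarith
    then show ?thesis
    proof cases
      case 3
      then have "s ^ (i - j) * s ^ j = s ^ i" by (simp flip: power_add)
      then show ?thesis using ij 3 by (simp add: torus_conj_def torus_path_def)
    qed (use ij s in \<open>simp_all add: torus_conj_def torus_path_def power_add\<close>)
  qed
  also have "\<dots> = (\<Sum>r<Suc n. if r = i then torus_path n s $$ (i, i) * l $$ (i, j) else 0)"
    using ij by (subst sum.delta) auto
  also have "\<dots> = (\<Sum>r<Suc n. torus_path n s $$ (i, r) * l $$ (r, j))"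
    using ij by (intro sum.cong) (auto simp: torus_path_def)
  also have "\<dots> = (torus_path n s * l) $$ (i, j)"
    using ij lc by (subst mat_mult_entry) (auto simp: torus_path_def)
  finally show "(torus_conj n l s * torus_path n s) $$ (i, j) = (torus_path n s * l) $$ (i, j)" .
qed (use SL_D(1)[OF l(1)] in \<open>auto simp: torus_conj_def torus_path_def\<close>)

lemma torus_conj_SL:
  assumes l: "l \<in> SL n" "lower_triangular l" and s: "s \<noteq> 0"
  shows "torus_conj n l s \<in> SL n"
proof -
  have c: "torus_conj n l s \<in> carrier_mat (Suc n) (Suc n)" by (simp add: torus_conj_def)
  have "det (torus_conj n l s) * 1 = 1 * 1"
    using torus_conj_mult[OF assms] det_mult[OF c torus_path_carrier] det_mult[OF torus_path_carrier, of l n s]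
      SL_D[OF l(1)] SL_D(2)[OF torus_path_SL[OF s]] by metis
  then show ?thesis using c by (simp add: SL_def)
qed

lemma torus_conj_tendsto:
  assumes l: "l \<in> SL n" "lower_triangular l" "\<And>i. i < Suc n \<Longrightarrow> l $$ (i, i) = 1" and ij: "i \<le> n" "j \<le> n"
  shows "((\<lambda>s. torus_conj n l s $$ (i, j)) \<longlongrightarrow> 1\<^sub>m (Suc n) $$ (i, j)) (at 0)"
proof -
  have lc: "l \<in> carrier_mat (Suc n) (Suc n)" using l SL_D by blast
  have pw: "((\<lambda>s::complex. c * s ^ k) \<longlongrightarrow> 0) (at 0)" if "0 < k" for c and k :: nat
  proof -
    have "((\<lambda>s::complex. c * s ^ k) \<longlongrightarrow> c * 0 ^ k) (at 0)" by (intro tendsto_intros)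
    moreover have "c * 0 ^ k = 0" using that by simp
    ultimately show ?thesis by metis
  qed
  consider "i = j" | "i < j" | "j = 0" "0 < i" | "0 < j" "j < i" by linarith
  then show ?thesis
  proof cases
    case 1
    then show ?thesis using l(3) ij by (simp add: torus_conj_def)
  next
    case 2
    then have "l $$ (i, j) = 0" using l(2) lc ij by (simp add: lower_triangular_def)
    then show ?thesis using 2 ij by (simp add: torus_conj_def)
  next
    case 3
    then show ?thesis using ij pw[of "i + (\<Sum>k<n. Suc k)" "l $$ (i, j)"] by (simp add: torus_conj_def)
  next
    case 4
    then show ?thesis using ij pw[of "i - j" "l $$ (i, j)"] by (simp add: torus_conj_def)
  qed
qed

text \<open>Write \<open>D\<close> for \<open>flag_pow n e\<close>. If \<open>g = l * b\<close> and
  \<open>t\<close> is on the path, then \<open>\<rho> t * \<rho> g * V = D b * D t * \<rho> (t * l *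
  t^-1) * V\<close>, and the conjugate of \<open>l\<close> tends to the identity. What is left after
  division by \<open>D t\<close> is \<open>D b\<close>, which equals \<open>D g\<close> because the
  leading minors of \<open>l\<close> are 1.\<close>

lemma torus_limit:
  assumes rep: "representation n d \<rho>" and V: "V \<in> carrier_mat d 1"
    and hw: "\<And>b. b \<in> SL n \<Longrightarrow> upper_triangular b \<Longrightarrow> \<rho> b * V = flag_pow n e b \<cdot>\<^sub>m V"
    and g: "g \<in> big_cell n" and r: "r < d"
  shows "((\<lambda>s. (\<rho> (torus_path n s) * (\<rho> g * V)) $$ (r, 0) / flag_pow n e (torus_path n s))
      \<longlongrightarrow> flag_pow n e g * V $$ (r, 0)) (at 0)"
proof -
  let ?f = "flag_pow n e" and ?t = "torus_path n"
  obtain l b where l: "l \<in> SL n" "lower_triangular l" "\<And>i. i < Suc n \<Longrightarrow> l $$ (i, i) = 1"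
    and b: "b \<in> SL n" "upper_triangular b" and lb: "g = l * b"
    using big_cell_lu[OF g] by metis
  let ?X = "torus_conj n l"
  note car = representation_carrier[OF rep] and ml = representation_mult_left[OF rep _ _ V]
  have "?f g = ?f b"
    using flag_pow_lower_mult[OF l(1) b(1) l(2), of e] flag_pow_lower_unit[OF l, of e] lb by simp
  \<comment> \<open>The factor \<open>1\<^sub>m d\<close> gives the coordinate the shape of
    \<open>polynomial_fun_matrix_coefficient\<close>.\<close>
  have main: "(\<rho> (?t s) * (\<rho> g * V)) $$ (r, 0) / ?f (?t s) = ?f b * (1\<^sub>m d * (\<rho> (?X s) * V)) $$ (r, 0)"
    if s: "s \<noteq> 0" for s
  proof -
    have t: "?t s \<in> SL n" and X: "?X s \<in> SL n" using torus_path_SL torus_conj_SL l s by auto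
    have smult: "\<rho> h * (c \<cdot>\<^sub>m V) = c \<cdot>\<^sub>m (\<rho> h * V)" if "h \<in> SL n" for h c
      using car[OF that] V by (simp add: mult_smult_distrib)
    have "\<rho> (?t s) * (\<rho> g * V) = \<rho> (?t s * l) * (\<rho> b * V)"
      using ml t l(1) b(1) SL_mult lb by simp (metis SL_D(1) assoc_mult_mat torus_path_carrier)
    also have "\<dots> = ?f b \<cdot>\<^sub>m (\<rho> (?t s * l) * V)"
      using hw[OF b] smult SL_mult[OF t l(1)] by simp
    also have "\<rho> (?t s * l) * V = \<rho> (?X s) * (\<rho> (?t s) * V)"
      using torus_conj_mult[OF l(1,2) s] ml[OF X t] by simp
    also have "\<dots> = ?f (?t s) \<cdot>\<^sub>m (\<rho> (?X s) * V)"
      using hw[OF t torus_path_upper] smult[OF X] by simp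
    finally have "\<rho> (?t s) * (\<rho> g * V) = ?f b \<cdot>\<^sub>m (?f (?t s) \<cdot>\<^sub>m (\<rho> (?X s) * V))" .
    moreover have Y: "\<rho> (?X s) * V \<in> carrier_mat d 1" using car[OF X] V by simp
    moreover have "1\<^sub>m d * (\<rho> (?X s) * V) = \<rho> (?X s) * V" by (rule left_mult_one_mat[OF Y])
    ultimately show ?thesis
      using flag_pow_torus_path_nonzero[OF s, of n e] smult_index_carrier[OF Y r]
        smult_index_carrier[OF smult_carrier_mat[OF Y] r] by (simp del: index_mult_mat(1))
  qed
  obtain p where p: "polynomial_fun n p" "\<And>h. h \<in> SL n \<Longrightarrow> (1\<^sub>m d * (\<rho> h * V)) $$ (r, 0) = p h"
    using polynomial_fun_matrix_coefficient[OF rep one_carrier_mat V r, of 0] by auto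
  have "((\<lambda>s. p (?X s)) \<longlongrightarrow> p (1\<^sub>m (Suc n))) (at 0)"
    by (rule polynomial_fun_tendsto[OF p(1) torus_conj_tendsto[OF l]])
  moreover have "p (1\<^sub>m (Suc n)) = V $$ (r, 0)"
    using p(2)[OF SL_one] representation_one[OF rep] V by simp
  ultimately have "((\<lambda>s. ?f b * p (?X s)) \<longlongrightarrow> ?f g * V $$ (r, 0)) (at 0)"
    using \<open>?f g = ?f b\<close> by (auto intro: tendsto_intros)
  moreover have "eventually (\<lambda>s::complex. s \<noteq> 0) (at 0)" by (rule eventually_neq_at_within)
  then have "eventually (\<lambda>s. ?f b * p (?X s) = (\<rho> (?t s) * (\<rho> g * V)) $$ (r, 0) / ?f (?t s)) (at 0)"
    by eventually_elim (use main p(2) torus_conj_SL l in auto)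
  ultimately show ?thesis by (rule Lim_transform_eventually)
qed

text \<open>A linear relation between orbit vectors survives the operators along the torus path and
  hence the limit; read in a coordinate \<open>r\<close> where \<open>V\<close> does not vanish, it
  becomes the same relation between the values of \<open>flag_pow n e\<close>. This is the
  hypothesis of \<open>linear_extension\<close> on the big cell, and density extends the identity to
  the group.\<close>

lemma hw_functional:
  assumes rep: "representation n d \<rho>" and V: "V \<in> carrier_mat d 1" "V \<noteq> 0\<^sub>m d 1"
    and hw: "\<And>b. b \<in> SL n \<Longrightarrow> upper_triangular b \<Longrightarrow> \<rho> b * V = flag_pow n e b \<cdot>\<^sub>m V"
  shows "\<exists>\<phi>\<in>carrier_mat 1 d. \<forall>g\<in>SL n. (\<phi> * (\<rho> g * V)) $$ (0, 0) = flag_pow n e g"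
proof -
  let ?f = "flag_pow n e" and ?t = "torus_path n"
  have "\<exists>r<d. V $$ (r, 0) \<noteq> 0"
  proof (rule ccontr)
    assume "\<not> ?thesis"
    then have "V = 0\<^sub>m d 1" using V by (intro eq_matI) auto
    then show False using V by simp
  qed
  then obtain r where r: "r < d" "V $$ (r, 0) \<noteq> 0" by blast
  note car = representation_carrier[OF rep]
  have sub: "g \<in> SL n" if "g \<in> big_cell n" for g using that by (simp add: big_cell_def)
  have "\<exists>\<xi>. \<forall>g\<in>big_cell n. (\<Sum>r<d. \<xi> r * (\<rho> g * V) $$ (r, 0)) = ?f g"
  proof (rule linear_extension)
    fix k gs c assume gs: "\<And>a. a < (k::nat) \<Longrightarrow> gs a \<in> big_cell n"
      and rel: "\<And>r. r < d \<Longrightarrow> (\<Sum>a<k. c a * (\<rho> (gs a) * V) $$ (r, 0)) = 0"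
    have lim: "((\<lambda>s. \<Sum>a<k. c a * ((\<rho> (?t s) * (\<rho> (gs a) * V)) $$ (r, 0) / ?f (?t s)))
        \<longlongrightarrow> (\<Sum>a<k. c a * (?f (gs a) * V $$ (r, 0)))) (at 0)"
      using torus_limit[OF rep V(1) hw gs r(1)] by (intro tendsto_intros) auto
    have zero: "(\<Sum>a<k. c a * ((\<rho> (?t s) * (\<rho> (gs a) * V)) $$ (r, 0) / ?f (?t s))) = 0" if "s \<noteq> 0" for s
    proof -
      have t: "\<rho> (?t s) \<in> carrier_mat d d" using car torus_path_SL[OF that] by blast
      have "(\<rho> (?t s) * (\<rho> (gs a) * V)) $$ (r, 0) = (\<Sum>q<d. \<rho> (?t s) $$ (r, q) * (\<rho> (gs a) * V) $$ (q, 0))"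
        if "a < k" for a
        using t car[OF sub[OF gs[OF that]]] V r by (subst mat_mult_entry) auto
      then have "(\<Sum>a<k. c a * ((\<rho> (?t s) * (\<rho> (gs a) * V)) $$ (r, 0) / ?f (?t s))) =
          (\<Sum>a<k. \<Sum>q<d. \<rho> (?t s) $$ (r, q) / ?f (?t s) * (c a * (\<rho> (gs a) * V) $$ (q, 0)))"
        by (intro sum.cong) (auto simp: sum_distrib_left sum_divide_distrib ac_simps)
      also have "\<dots> = (\<Sum>q<d. \<Sum>a<k. \<rho> (?t s) $$ (r, q) / ?f (?t s) * (c a * (\<rho> (gs a) * V) $$ (q, 0)))"
        by (rule sum.swap)
      also have "\<dots> = (\<Sum>q<d. \<rho> (?t s) $$ (r, q) / ?f (?t s) * (\<Sum>a<k. c a * (\<rho> (gs a) * V) $$ (q, 0)))"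
        by (simp only: sum_distrib_left)
      also have "\<dots> = 0" using rel by (intro sum.neutral) auto
      finally show ?thesis .
    qed
    have "eventually (\<lambda>s::complex. s \<noteq> 0) (at 0)" by (rule eventually_neq_at_within)
    then have "eventually (\<lambda>s. (\<Sum>a<k. c a * ((\<rho> (?t s) * (\<rho> (gs a) * V)) $$ (r, 0) / ?f (?t s))) = 0) (at 0)"
      by eventually_elim (rule zero)
    then have "((\<lambda>s. \<Sum>a<k. c a * ((\<rho> (?t s) * (\<rho> (gs a) * V)) $$ (r, 0) / ?f (?t s))) \<longlongrightarrow> 0) (at 0)"
      by (rule tendsto_eventually)
    with lim have "(\<Sum>a<k. c a * (?f (gs a) * V $$ (r, 0))) = 0"
      using tendsto_unique at_neq_bot by blast
    then have "(\<Sum>a<k. c a * ?f (gs a)) * V $$ (r, 0) = 0"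
      by (simp only: sum_distrib_right mult.assoc)
    then show "(\<Sum>a<k. c a * ?f (gs a)) = 0" using r(2) mult_eq_0_iff by blast
  qed
  then obtain \<xi> where xi: "\<And>g. g \<in> big_cell n \<Longrightarrow> (\<Sum>r<d. \<xi> r * (\<rho> g * V) $$ (r, 0)) = ?f g" by blast
  define \<phi> where "\<phi> = mat 1 d (\<lambda>(i, j). \<xi> j)"
  have \<phi>: "\<phi> \<in> carrier_mat 1 d" by (simp add: \<phi>_def)
  obtain p where p: "polynomial_fun n p" "\<And>g. g \<in> SL n \<Longrightarrow> (\<phi> * (\<rho> g * V)) $$ (0, 0) = p g"
    using polynomial_fun_matrix_coefficient[OF rep \<phi> V(1), of 0 0] by auto
  have "p g + (- 1) * ?f g = 0" if "g \<in> SL n" for g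
  proof (rule big_cell_dense[of n "\<lambda>g. p g + (- 1) * ?f g", OF _ _ that])
    show "polynomial_fun n (\<lambda>g. p g + (- 1) * ?f g)"
      by (intro polynomial_fun.add polynomial_fun.mult polynomial_fun.const p(1) polynomial_fun_flag_pow)
  next
    fix g assume g: "g \<in> big_cell n"
    have "(\<phi> * (\<rho> g * V)) $$ (0, 0) = (\<Sum>r<d. \<phi> $$ (0, r) * (\<rho> g * V) $$ (r, 0))"
      using \<phi> V car[OF sub[OF g]] by (subst mat_mult_entry) auto
    also have "\<dots> = ?f g" unfolding xi[OF g, symmetric] by (intro sum.cong) (auto simp: \<phi>_def)
    finally show "p g + (- 1) * ?f g = 0" using p(2)[OF sub[OF g]] by simp
  qed
  then show ?thesis using p(2) \<phi> by (intro bexI[of _ \<phi>]) auto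
qed

text \<open>The last two conjuncts are all that is used of irreducibility later on.\<close>

definition hw_data :: "nat \<Rightarrow> nat \<Rightarrow> (complex mat \<Rightarrow> complex mat) \<Rightarrow> (complex mat \<Rightarrow> complex) \<Rightarrow>
    complex mat \<Rightarrow> complex mat \<Rightarrow> bool" where
  "hw_data n d \<rho> D V \<phi> \<longleftrightarrow> representation n d \<rho> \<and> V \<in> carrier_mat d 1 \<and> \<phi> \<in> carrier_mat 1 d \<and>
     (\<forall>g\<in>SL n. (\<phi> * (\<rho> g * V)) $$ (0, 0) = D g) \<and>
     (\<forall>\<xi>\<in>carrier_mat 1 d. (\<forall>g\<in>SL n. (\<xi> * (\<rho> g * V)) $$ (0, 0) = 0) \<longrightarrow> \<xi> = 0\<^sub>m 1 d) \<and>
     (\<forall>y\<in>carrier_mat d 1. (\<forall>g\<in>SL n. (\<phi> * (\<rho> g * y)) $$ (0, 0) = 0) \<longrightarrow> y = 0\<^sub>m d 1)"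

section \<open>Consequences of irreducibility\<close>

lemma subspace_module_vecI:
  fixes W :: "complex vec set"
  assumes "W \<subseteq> carrier_vec d" "0\<^sub>v d \<in> W"
    and "\<And>x y. x \<in> W \<Longrightarrow> y \<in> W \<Longrightarrow> x + y \<in> W" "\<And>c x. x \<in> W \<Longrightarrow> c \<cdot>\<^sub>v x \<in> W"
  shows "VectorSpace.subspace class_ring W (module_vec TYPE(complex) d)"
  unfolding VectorSpace.subspace_def submodule_def
  using assms vec_vs vec_module by (auto simp: module_vec_simps)

text \<open>Irreducibility and highest weight vectors are stated for \<open>vec\<close>, the
  computations use one-column matrices; this map translates.\<close>

definition colmat :: "'a vec \<Rightarrow> 'a mat" where
  "colmat v = mat (dim_vec v) 1 (\<lambda>(i, j). v $ i)"

lemma colmat_carrier [simp]: "v \<in> carrier_vec d \<Longrightarrow> colmat v \<in> carrier_mat d 1"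
  by (auto simp: colmat_def)

lemma colmat_index [simp]: "i < dim_vec v \<Longrightarrow> colmat v $$ (i, 0) = v $ i"
  by (simp add: colmat_def)

lemma col_colmat [simp]: "col (colmat v) 0 = v"
  by (intro eq_vecI) (auto simp: colmat_def)

lemma colmat_mult: 
  assumes "A \<in> carrier_mat k d" "v \<in> carrier_vec d"
  shows "colmat (A *\<^sub>v v) = A * colmat v"
proof (intro eq_matI)
  fix i j assume "i < dim_row (A * colmat v)" "j < dim_col (A * colmat v)"
  then have ij: "i < k" "j = 0" using assms by (auto simp: colmat_def)
  have "(A * colmat v) $$ (i, j) = row A i \<bullet> col (colmat v) 0"
    using ij assms by (subst index_mult_mat(1)) (auto simp: colmat_def)
  then show "colmat (A *\<^sub>v v) $$ (i, j) = (A * colmat v) $$ (i, j)"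
    using ij assms by simp
qed (use assms in \<open>auto simp: colmat_def\<close>)

lemma colmat_zero: "colmat (0\<^sub>v d) = 0\<^sub>m d 1"
  by (intro eq_matI) (auto simp: colmat_def)

lemma colmat_inject: "v \<in> carrier_vec d \<Longrightarrow> w \<in> carrier_vec d \<Longrightarrow> colmat v = colmat w \<Longrightarrow> v = w"
  by (metis col_colmat)

lemma colmat_add: "v \<in> carrier_vec d \<Longrightarrow> w \<in> carrier_vec d \<Longrightarrow> colmat (v + w) = colmat v + colmat w"
  by (intro eq_matI) (auto simp: colmat_def)

lemma colmat_smult: "colmat (c \<cdot>\<^sub>v v) = c \<cdot>\<^sub>m colmat v"
  by (intro eq_matI) (auto simp: colmat_def)

text \<open>The common kernel of a set of covectors stable under the group is an invariant subspace,
  hence zero or everything.\<close>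

lemma irreducible_annihilator:
  assumes irr: "irreducible_rep n d \<rho>" and R: "\<And>\<xi>. \<xi> \<in> R \<Longrightarrow> \<xi> \<in> carrier_mat 1 d"
    and inv: "\<And>\<xi> h. \<xi> \<in> R \<Longrightarrow> h \<in> SL n \<Longrightarrow> \<xi> * \<rho> h \<in> R"
  shows "(\<forall>y\<in>carrier_mat d 1. (\<forall>\<xi>\<in>R. (\<xi> * y) $$ (0, 0) = 0) \<longrightarrow> y = 0\<^sub>m d 1) \<or>
    (\<forall>y\<in>carrier_mat d 1. \<forall>\<xi>\<in>R. (\<xi> * y) $$ (0, 0) = 0)"
proof -
  have rep: "representation n d \<rho>" using irr by (simp add: irreducible_rep_def)
  note car = representation_carrier[OF rep]
  define W where "W = {w \<in> carrier_vec d. \<forall>\<xi>\<in>R. (\<xi> * colmat w) $$ (0, 0) = 0}"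
  have "VectorSpace.subspace class_ring W (module_vec TYPE(complex) d)"
  proof (rule subspace_module_vecI)
    show "W \<subseteq> carrier_vec d" by (auto simp: W_def)
    show "0\<^sub>v d \<in> W" using R by (force simp: W_def colmat_zero)
  next
    fix x y assume xy: "x \<in> W" "y \<in> W"
    have "(\<xi> * colmat (x + y)) $$ (0, 0) = 0" if "\<xi> \<in> R" for \<xi>
    proof -
      have c: "colmat x \<in> carrier_mat d 1" "colmat y \<in> carrier_mat d 1" using xy by (auto simp: W_def)
      have xyc: "x \<in> carrier_vec d" "y \<in> carrier_vec d" using xy by (auto simp: W_def)
      have "\<xi> * colmat (x + y) = \<xi> * colmat x + \<xi> * colmat y"
        using mult_add_distrib_mat[OF R[OF that] c] colmat_add[OF xyc] by simp
      moreover have "\<xi> * colmat x \<in> carrier_mat 1 1" "\<xi> * colmat y \<in> carrier_mat 1 1"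
        using c R[OF that] by simp_all
      moreover have "(\<xi> * colmat x) $$ (0, 0) = 0" "(\<xi> * colmat y) $$ (0, 0) = 0"
        using xy that by (auto simp: W_def)
      ultimately show ?thesis using add_index_carrier[of "\<xi> * colmat x" 1 1 "\<xi> * colmat y" 0 0] by simp
    qed
    then show "x + y \<in> W" using xy by (auto simp: W_def)
  next
    fix c x assume x: "x \<in> W"
    have "(\<xi> * colmat (c \<cdot>\<^sub>v x)) $$ (0, 0) = 0" if "\<xi> \<in> R" for \<xi>
    proof -
      have cx: "colmat x \<in> carrier_mat d 1" using x by (auto simp: W_def)
      have "\<xi> * colmat (c \<cdot>\<^sub>v x) = c \<cdot>\<^sub>m (\<xi> * colmat x)"
        using mult_smult_distrib[OF R[OF that] cx] by (simp add: colmat_smult)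
      moreover have "\<xi> * colmat x \<in> carrier_mat 1 1" using cx R[OF that] by simp
      moreover have "(\<xi> * colmat x) $$ (0, 0) = 0" using x that by (auto simp: W_def)
      ultimately show ?thesis using smult_index_carrier[of "\<xi> * colmat x" 1 1 0 0 c] by simp
    qed
    then show "c \<cdot>\<^sub>v x \<in> W" using x by (auto simp: W_def)
  qed
  moreover have "\<rho> g *\<^sub>v w \<in> W" if g: "g \<in> SL n" and w: "w \<in> W" for g w
  proof -
    have wc: "w \<in> carrier_vec d" using w by (simp add: W_def)
    have "\<xi> * colmat (\<rho> g *\<^sub>v w) = \<xi> * \<rho> g * colmat w" if "\<xi> \<in> R" for \<xi>
      using colmat_mult[OF car[OF g] wc] assoc_mult_mat[OF R[OF that] car[OF g] colmat_carrier[OF wc]] by simp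
    then show ?thesis using w inv[OF _ g] car[OF g] by (auto simp: W_def)
  qed
  ultimately have "W = {0\<^sub>v d} \<or> W = carrier_vec d"
    using irr unfolding irreducible_rep_def by blast
  then show ?thesis
  proof
    assume W: "W = {0\<^sub>v d}"
    have "y = 0\<^sub>m d 1" if y: "y \<in> carrier_mat d 1" and "\<forall>\<xi>\<in>R. (\<xi> * y) $$ (0, 0) = 0" for y
    proof -
      have yc: "colmat (col y 0) = y" using y by (intro eq_matI) (auto simp: colmat_def)
      moreover have "col y 0 \<in> carrier_vec d" using y by (intro col_carrier_vec[of 0 1]) auto
      ultimately have "col y 0 \<in> W" using that by (simp add: W_def)
      then show ?thesis using W yc colmat_zero[of d] by (metis singletonD)
    qed
    then show ?thesis by blast
  next
    assume W: "W = carrier_vec d"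
    have "(\<xi> * y) $$ (0, 0) = 0" if y: "y \<in> carrier_mat d 1" and "\<xi> \<in> R" for y \<xi>
    proof -
      have yc: "colmat (col y 0) = y" using y by (intro eq_matI) (auto simp: colmat_def)
      have "col y 0 \<in> W" unfolding W using y by (intro col_carrier_vec[of 0 1]) auto
      then show ?thesis using that yc by (auto simp: W_def)
    qed
    then show ?thesis by blast
  qed
qed

lemma row_zero_if_all_products_zero:
  fixes \<xi> :: "'a :: comm_ring_1 mat"
  assumes "\<xi> \<in> carrier_mat 1 d" "\<And>y. y \<in> carrier_mat d 1 \<Longrightarrow> (\<xi> * y) $$ (0, 0) = 0"
  shows "\<xi> = 0\<^sub>m 1 d"
proof (intro eq_matI)
  fix i j assume "i < dim_row (0\<^sub>m 1 d :: 'a mat)" "j < dim_col (0\<^sub>m 1 d :: 'a mat)"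
  then have ij: "i = 0" "j < d" by auto
  let ?u = "mat d 1 (\<lambda>(r, _). if r = j then 1 else 0 :: 'a)"
  have "(\<xi> * ?u) $$ (0, 0) = (\<Sum>r<d. \<xi> $$ (0, r) * (if r = j then 1 else 0))"
    using assms(1) by (subst mat_mult_entry) auto
  also have "\<dots> = \<xi> $$ (0, j)" using ij by (simp add: if_distrib cong: if_cong)
  finally show "\<xi> $$ (i, j) = 0\<^sub>m 1 d $$ (i, j)" using assms(2)[of ?u] ij by simp
qed (use assms in auto)

lemma hw_data_exists:
  assumes irr: "irreducible_of_highest_weight n la d \<rho>" and dom: "dominant n la"
  shows "\<exists>V \<phi>. hw_data n d \<rho> (flag_pow n (\<lambda>k. nat (la $ k))) V \<phi>"
proof -
  let ?f = "flag_pow n (\<lambda>k. nat (la $ k))"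
  obtain v where irr: "irreducible_rep n d \<rho>" and hv: "highest_weight_vector n d \<rho> la v"
    using irr by (auto simp: irreducible_of_highest_weight_def)
  then have rep: "representation n d \<rho>" by (simp add: irreducible_rep_def)
  have v: "v \<in> carrier_vec d" "v \<noteq> 0\<^sub>v d" using hv by (auto simp: highest_weight_vector_def)
  note car = representation_carrier[OF rep]
  define V where "V = colmat v"
  have V: "V \<in> carrier_mat d 1" using v by (simp add: V_def)
  have V0: "V \<noteq> 0\<^sub>m d 1" using v colmat_inject[OF v(1), of "0\<^sub>v d"] by (auto simp: V_def colmat_zero)
  have hw: "\<rho> b * V = ?f b \<cdot>\<^sub>m V" if "b \<in> SL n" "upper_triangular b" for b
  proof -
    have "\<rho> b *\<^sub>v v = weight_char n la b \<cdot>\<^sub>v v"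
      using hv that unfolding highest_weight_vector_def by blast
    then show ?thesis
      using colmat_mult[OF car[OF that(1)] v(1)] weight_char_upper[OF that dom]
      by (metis V_def colmat_smult)
  qed
  obtain \<phi> where \<phi>: "\<phi> \<in> carrier_mat 1 d" "\<And>g. g \<in> SL n \<Longrightarrow> (\<phi> * (\<rho> g * V)) $$ (0, 0) = ?f g"
    using hw_functional[OF rep V V0 hw] by blast
  \<comment> \<open>The covectors vanishing on the orbit of \<open>V\<close> form a stable set whose
    common kernel contains \<open>V \<noteq> 0\<close>. So the kernel is everything and these
    covectors are zero.\<close>
  have sep1: "\<xi> = 0\<^sub>m 1 d" if xi: "\<xi> \<in> carrier_mat 1 d" "\<forall>g\<in>SL n. (\<xi> * (\<rho> g * V)) $$ (0, 0) = 0" for \<xi>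
  proof -
    define R where "R = {\<xi> \<in> carrier_mat 1 d. \<forall>g\<in>SL n. (\<xi> * (\<rho> g * V)) $$ (0, 0) = 0}"
    have "(\<forall>y\<in>carrier_mat d 1. (\<forall>\<xi>\<in>R. (\<xi> * y) $$ (0, 0) = 0) \<longrightarrow> y = 0\<^sub>m d 1) \<or>
        (\<forall>y\<in>carrier_mat d 1. \<forall>\<xi>\<in>R. (\<xi> * y) $$ (0, 0) = 0)"
    proof (rule irreducible_annihilator[OF irr])
      fix \<zeta> h assume z: "\<zeta> \<in> R" and h: "h \<in> SL n"
      have zc: "\<zeta> \<in> carrier_mat 1 d" using z by (simp add: R_def)
      have "\<zeta> * \<rho> h * (\<rho> g * V) = \<zeta> * (\<rho> (h * g) * V)" if "g \<in> SL n" for g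
        using assoc_mult_mat[OF zc car[OF h], of "\<rho> g * V" 1] car[OF that] V
          representation_mult_left[OF rep h that V] by simp
      then show "\<zeta> * \<rho> h \<in> R" using z zc car[OF h] SL_mult[OF h] by (auto simp: R_def)
    qed (simp add: R_def)
    moreover have "\<forall>\<xi>\<in>R. (\<xi> * V) $$ (0, 0) = 0"
    proof
      fix \<zeta> assume "\<zeta> \<in> R"
      then have "(\<zeta> * (\<rho> (1\<^sub>m (Suc n)) * V)) $$ (0, 0) = 0" using SL_one unfolding R_def by blast
      then show "(\<zeta> * V) $$ (0, 0) = 0"
        unfolding representation_one[OF rep] left_mult_one_mat[OF V] .
    qed
    ultimately have "\<forall>y\<in>carrier_mat d 1. \<forall>\<xi>\<in>R. (\<xi> * y) $$ (0, 0) = 0" using V V0 by blast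
    moreover have "\<xi> \<in> R" using xi by (simp add: R_def)
    ultimately show ?thesis using row_zero_if_all_products_zero[OF xi(1)] by blast
  qed
  \<comment> \<open>The translates of \<open>\<phi>\<close> form a stable set whose common kernel
    misses \<open>V\<close>, because \<open>\<phi>\<close> takes the value 1 there. So the kernel is
    zero.\<close>
  have sep2: "y = 0\<^sub>m d 1" if y: "y \<in> carrier_mat d 1" "\<forall>g\<in>SL n. (\<phi> * (\<rho> g * y)) $$ (0, 0) = 0" for y
  proof -
    define R where "R = (\<lambda>g. \<phi> * \<rho> g) ` SL n"
    have as: "\<phi> * \<rho> g * z = \<phi> * (\<rho> g * z)" if "g \<in> SL n" "z \<in> carrier_mat d 1" for g z
      using assoc_mult_mat[OF \<phi>(1) car[OF that(1)] that(2)] .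
    have "(\<forall>y\<in>carrier_mat d 1. (\<forall>\<xi>\<in>R. (\<xi> * y) $$ (0, 0) = 0) \<longrightarrow> y = 0\<^sub>m d 1) \<or>
        (\<forall>y\<in>carrier_mat d 1. \<forall>\<xi>\<in>R. (\<xi> * y) $$ (0, 0) = 0)"
    proof (rule irreducible_annihilator[OF irr])
      fix \<zeta> h assume z: "\<zeta> \<in> R" and h: "h \<in> SL n"
      then obtain g where g: "g \<in> SL n" "\<zeta> = \<phi> * \<rho> g" by (auto simp: R_def)
      have "\<zeta> * \<rho> h = \<phi> * \<rho> (g * h)"
        using assoc_mult_mat[OF \<phi>(1) car[OF g(1)] car[OF h]] g representation_mult[OF rep g(1) h] by simp
      then show "\<zeta> * \<rho> h \<in> R" using SL_mult[OF g(1) h] by (auto simp: R_def)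
    next
      fix \<zeta> assume "\<zeta> \<in> R"
      then show "\<zeta> \<in> carrier_mat 1 d" using \<phi>(1) car by (auto simp: R_def)
    qed
    moreover have "(\<phi> * \<rho> (1\<^sub>m (Suc n)) * V) $$ (0, 0) \<noteq> 0"
    proof -
      have "flag_pow n (\<lambda>k. nat (la $ k)) (1\<^sub>m (Suc n)) = 1"
        by (rule flag_pow_lower_unit) (simp_all add: lower_triangular_def)
      then show ?thesis unfolding as[OF SL_one V] \<phi>(2)[OF SL_one] by simp
    qed
    then have "\<exists>y\<in>carrier_mat d 1. \<exists>\<xi>\<in>R. (\<xi> * y) $$ (0, 0) \<noteq> 0"
      using V SL_one unfolding R_def by blast
    ultimately have "(\<forall>\<xi>\<in>R. (\<xi> * y) $$ (0, 0) = 0) \<longrightarrow> y = 0\<^sub>m d 1" using y(1) by blast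
    moreover have "\<forall>\<xi>\<in>R. (\<xi> * y) $$ (0, 0) = 0"
      unfolding R_def ball_simps(9) using y(2) as[OF _ y(1)] by (metis (no_types, lifting))
    ultimately show ?thesis by (rule mp)
  qed
  have "hw_data n d \<rho> ?f V \<phi>"
    unfolding hw_data_def
  proof (intro conjI ballI impI)
    show "representation n d \<rho>" "V \<in> carrier_mat d 1" "\<phi> \<in> carrier_mat 1 d" by fact+
    show "(\<phi> * (\<rho> g * V)) $$ (0, 0) = ?f g" if "g \<in> SL n" for g using \<phi>(2)[OF that] .
  qed (rule sep1 sep2; assumption)+
  then show ?thesis by blast
qed

section \<open>Unitary forms\<close>

lemma mult_index_cong:
  fixes X X' Y Y' :: "'a :: semiring_0 mat"
  assumes "X \<in> carrier_mat a k" "X' \<in> carrier_mat a' k" "Y \<in> carrier_mat k b" "Y' \<in> carrier_mat k b'"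
    and "i < a" "i' < a'" "j < b" "j' < b'"
    and "\<And>r. r < k \<Longrightarrow> X $$ (i, r) = X' $$ (i', r)" "\<And>r. r < k \<Longrightarrow> Y $$ (r, j) = Y' $$ (r, j')"
  shows "(X * Y) $$ (i, j) = (X' * Y') $$ (i', j')"
proof -
  have "(X * Y) $$ (i, j) = (\<Sum>r<k. X $$ (i, r) * Y $$ (r, j))"
    using assms by (subst mat_mult_entry) auto
  also have "\<dots> = (\<Sum>r<k. X' $$ (i', r) * Y' $$ (r, j'))"
    using assms by (intro sum.cong) auto
  also have "\<dots> = (X' * Y') $$ (i', j')"
    using assms by (subst mat_mult_entry) auto
  finally show ?thesis .
qed

lemma hc_mult_carrier:
  "A \<in> carrier_mat m k \<Longrightarrow> B \<in> carrier_mat k l \<Longrightarrow> hc (A * B) = hc B * hc A"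
  by (rule hc_mult) auto

text \<open>Positive definiteness in algebraic form. \<open>E\<close> is rectangular because it will
  list the values of all terms of a Gram expansion; the factorization is inherited by Kronecker
  products.\<close>

definition gram_pos :: "nat \<Rightarrow> complex mat \<Rightarrow> bool" where
  "gram_pos d H \<longleftrightarrow> det H \<noteq> 0 \<and> (\<exists>a E. E \<in> carrier_mat a d \<and> H = hc E * E)"

lemma gram_pos_carrier: "gram_pos d H \<Longrightarrow> H \<in> carrier_mat d d"
  by (auto simp: gram_pos_def)

lemma gram_pos_hc: "gram_pos d H \<Longrightarrow> hc H = H"
  by (auto simp: gram_pos_def hc_mult)

lemma gram_pos_one: "gram_pos d (1\<^sub>m d)"
  unfolding gram_pos_def by (auto intro!: exI[of _ d] exI[of _ "1\<^sub>m d"])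

lemma gram_pos_zero:
  assumes H: "gram_pos d H" and z: "z \<in> carrier_mat d 1" and 0: "hc z * (H * z) = 0\<^sub>m 1 1"
  shows "z = 0\<^sub>m d 1"
proof -
  obtain a E where E: "E \<in> carrier_mat a d" "H = hc E * E" using H by (auto simp: gram_pos_def)
  have Ez: "E * z \<in> carrier_mat a 1" using E z by simp
  have hE: "hc E \<in> carrier_mat d a" using E by simp
  have hz: "hc z \<in> carrier_mat 1 d" using z by simp
  have Hz: "H * z = hc E * (E * z)" unfolding E(2) by (rule assoc_mult_mat[OF hE E(1) z])
  have "hc (E * z) * (E * z) = hc z * (H * z)"
    unfolding Hz using hc_mult[of E z] assoc_mult_mat[OF hz hE Ez] E z by simp
  then have "E * z = 0\<^sub>m a 1" using hc_self_mult_zero[OF Ez] 0 by simp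
  then have "H * z = 0\<^sub>m d 1" using Hz hE by simp
  also have "0\<^sub>m d 1 = H * 0\<^sub>m d 1" using gram_pos_carrier[OF H] by simp
  finally show ?thesis
    using mult_left_cancel_det[OF gram_pos_carrier[OF H] _ z] H by (simp add: gram_pos_def)
qed

lemma hw_dataD:
  assumes "hw_data n d \<rho> D V \<phi>"
  shows "representation n d \<rho>" "V \<in> carrier_mat d 1" "\<phi> \<in> carrier_mat 1 d"
    "\<And>g. g \<in> SL n \<Longrightarrow> (\<phi> * (\<rho> g * V)) $$ (0, 0) = D g"
    "\<And>\<xi>. \<xi> \<in> carrier_mat 1 d \<Longrightarrow> (\<And>g. g \<in> SL n \<Longrightarrow> (\<xi> * (\<rho> g * V)) $$ (0, 0) = 0) \<Longrightarrow> \<xi> = 0\<^sub>m 1 d"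
    "\<And>y. y \<in> carrier_mat d 1 \<Longrightarrow> (\<And>g. g \<in> SL n \<Longrightarrow> (\<phi> * (\<rho> g * y)) $$ (0, 0) = 0) \<Longrightarrow> y = 0\<^sub>m d 1"
    "\<And>g. g \<in> SL n \<Longrightarrow> \<rho> g \<in> carrier_mat d d" "\<And>g. g \<in> SL n \<Longrightarrow> \<rho> g * V \<in> carrier_mat d 1"
proof -
  show rep: "representation n d \<rho>" and V: "V \<in> carrier_mat d 1"
    using assms by (simp_all add: hw_data_def)
  show "\<rho> g \<in> carrier_mat d d" "\<rho> g * V \<in> carrier_mat d 1" if "g \<in> SL n" for g
    using representation_carrier[OF rep that] V by simp_all
qed (use assms in \<open>auto simp: hw_data_def\<close>)

text \<open>The orbit of \<open>V\<close> spans; the separation property in \<open>hw_data\<close>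
  is applied to the difference of corresponding rows.\<close>

lemma hw_operator_eq:
  assumes data: "hw_data n d \<rho> D V \<phi>" and A: "A \<in> carrier_mat k d" and B: "B \<in> carrier_mat k d"
    and eq: "\<And>g i. g \<in> SL n \<Longrightarrow> i < k \<Longrightarrow> (A * (\<rho> g * V)) $$ (i, 0) = (B * (\<rho> g * V)) $$ (i, 0)"
  shows "A = B"
proof (intro eq_matI)
  note hw = hw_dataD[OF data]
  fix i j assume "i < dim_row B" "j < dim_col B"
  then have ij: "i < k" "j < d" using B by auto
  define \<xi> where "\<xi> = mat 1 d (\<lambda>(_, j). A $$ (i, j) - B $$ (i, j))"
  have xi: "\<xi> \<in> carrier_mat 1 d" by (simp add: \<xi>_def)
  have "\<xi> = 0\<^sub>m 1 d"
  proof (rule hw(5)[OF xi])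
    fix g assume g: "g \<in> SL n"
    have "(\<xi> * (\<rho> g * V)) $$ (0, 0) = (\<Sum>r<d. (A $$ (i, r) - B $$ (i, r)) * (\<rho> g * V) $$ (r, 0))"
      using xi hw(8)[OF g] by (subst mat_mult_entry) (auto simp: \<xi>_def simp del: index_mult_mat(1))
    also have "\<dots> = (A * (\<rho> g * V)) $$ (i, 0) - (B * (\<rho> g * V)) $$ (i, 0)"
      using hw(8)[OF g] A B ij
      by (subst (2 3) mat_mult_entry) (auto simp: algebra_simps sum_subtractf simp del: index_mult_mat(1))
    finally show "(\<xi> * (\<rho> g * V)) $$ (0, 0) = 0" using eq[OF g ij(1)] by simp
  qed
  then have "\<xi> $$ (0, j) = 0" using ij by simp
  then show "A $$ (i, j) = B $$ (i, j)" using ij by (simp add: \<xi>_def)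
qed (use A B in auto)

lemma hw_form_eq:
  assumes data: "hw_data n d \<rho> D V \<phi>" and A: "A \<in> carrier_mat d d" and B: "B \<in> carrier_mat d d"
    and eq: "\<And>g h. g \<in> SL n \<Longrightarrow> h \<in> SL n \<Longrightarrow>
      (hc (\<rho> g * V) * A * (\<rho> h * V)) $$ (0, 0) = (hc (\<rho> g * V) * B * (\<rho> h * V)) $$ (0, 0)"
  shows "A = B"
proof -
  note hw = hw_dataD[OF data]
  have "hc A = hc B"
  proof (rule hw_operator_eq[OF data])
    fix g i assume g: "g \<in> SL n" and i: "i < d"
    let ?x = "\<rho> g * V"
    have x: "?x \<in> carrier_mat d 1" "hc ?x \<in> carrier_mat 1 d" using hw(8)[OF g] by simp_all
    have "hc ?x * A = hc ?x * B"
    proof (rule hw_operator_eq[OF data])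
      fix h i assume h: "h \<in> SL n" and "i < (1 :: nat)"
      then have "i = 0" by simp
      then show "(hc ?x * A * (\<rho> h * V)) $$ (i, 0) = (hc ?x * B * (\<rho> h * V)) $$ (i, 0)"
        using eq[OF g h] by simp
    qed (use x A B in simp_all)
    then have "hc A * ?x = hc B * ?x"
      using hc_mult[of "hc ?x" A] hc_mult[of "hc ?x" B] x A B by (metis carrier_matD hc_hc)
    then show "(hc A * ?x) $$ (i, 0) = (hc B * ?x) $$ (i, 0)" by simp
  qed (use A B in simp_all)
  then show ?thesis by (simp add: hc_eq_iff)
qed

text \<open>Orbits with proportional Gram kernels are related by a linear map. If the combination of
  the vectors \<open>\<rho> (gs a) * V\<close> with coefficients \<open>cc a\<close> vanishes, let
  \<open>z\<close> be the same combination of the \<open>f (gs a)\<close>. Its norm is a combination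
  of the values \<open>D (hc (gs a) * gs b)\<close>; written through \<open>\<phi>\<close>, these
  contain the vanishing combination as a factor. Positivity gives \<open>z = 0\<close>, and
  \<open>linear_extension\<close> applies in each coordinate.\<close>

lemma hw_extension:
  assumes data: "hw_data n d \<rho> D V \<phi>" and H: "gram_pos K H"
    and f: "\<And>g. g \<in> SL n \<Longrightarrow> f g \<in> carrier_mat K 1"
    and gram: "\<And>g h. g \<in> SL n \<Longrightarrow> h \<in> SL n \<Longrightarrow> (hc (f g) * (H * f h)) $$ (0, 0) = c * D (hc g * h)"
  shows "\<exists>J\<in>carrier_mat K d. \<forall>g\<in>SL n. J * (\<rho> g * V) = f g"
proof -
  note hw = hw_dataD[OF data]
  note Hc = gram_pos_carrier[OF H]
  have "\<exists>\<xi>. \<forall>g\<in>SL n. (\<Sum>s<d. \<xi> s * (\<rho> g * V) $$ (s, 0)) = f g $$ (r, 0)" if r: "r < K" for r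
  proof (rule linear_extension)
    fix k gs cc assume gs: "\<And>a. a < (k::nat) \<Longrightarrow> gs a \<in> SL n"
      and rel: "\<And>s. s < d \<Longrightarrow> (\<Sum>a<k. cc a * (\<rho> (gs a) * V) $$ (s, 0)) = 0"
    \<comment> \<open>The columns of \<open>F\<close> and \<open>R\<close> are the values of
      \<open>f\<close> and the orbit vectors, the rows of \<open>A\<close> are the covectors
      \<open>c \<cdot>\<^sub>m (\<phi> * \<rho> (hc (gs a)))\<close>. So \<open>A * R\<close> is the
      Gram matrix of \<open>F\<close>, while \<open>R * C = 0\<close>.\<close>
    define C where "C = mat k 1 (\<lambda>(a, _). cc a)"
    define F where "F = mat K k (\<lambda>(i, a). f (gs a) $$ (i, 0))"
    define R where "R = mat d k (\<lambda>(i, a). (\<rho> (gs a) * V) $$ (i, 0))"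
    define A where "A = mat k d (\<lambda>(a, i). (c \<cdot>\<^sub>m (\<phi> * \<rho> (hc (gs a)))) $$ (0, i))"
    have car: "C \<in> carrier_mat k 1" "F \<in> carrier_mat K k" "R \<in> carrier_mat d k" "A \<in> carrier_mat k d"
      by (simp_all add: C_def F_def R_def A_def)
    have RC: "R * C = 0\<^sub>m d 1"
    proof (intro eq_matI)
      fix s j assume "s < dim_row (0\<^sub>m d 1 :: complex mat)" "j < dim_col (0\<^sub>m d 1 :: complex mat)"
      then have s: "s < d" "j = 0" by auto
      have "(R * C) $$ (s, j) = (\<Sum>a<k. cc a * (\<rho> (gs a) * V) $$ (s, 0))"
        using s by (subst mat_mult_entry) (auto simp: R_def C_def mult.commute simp del: index_mult_mat(1))
      then show "(R * C) $$ (s, j) = 0\<^sub>m d 1 $$ (s, j)" using rel[OF s(1)] s by simp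
    qed (use car in auto)
    have FHF: "hc F * (H * F) = A * R"
    proof (intro eq_matI)
      fix a b assume "a < dim_row (A * R)" "b < dim_col (A * R)"
      then have ab: "a < k" "b < k" using car by auto
      note ga = gs[OF ab(1)] and gb = gs[OF ab(2)]
      have "(hc F * (H * F)) $$ (a, b) = (hc (f (gs a)) * (H * f (gs b))) $$ (0, 0)"
      proof (rule mult_index_cong[of _ k K _ 1 _ k _ 1])
        fix r assume r: "r < K"
        show "hc F $$ (a, r) = hc (f (gs a)) $$ (0, r)"
          using r ab f[OF ga] car(2) by (simp add: F_def)
        show "(H * F) $$ (r, b) = (H * f (gs b)) $$ (r, 0)"
          by (rule mult_index_cong[of _ K K _ K _ k _ 1])
            (use Hc r car ab f[OF gb] in \<open>auto simp: F_def\<close>)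
      qed (use car Hc f[OF ga] f[OF gb] ab in auto)
      also have "\<dots> = c * D (hc (gs a) * gs b)" by (rule gram[OF ga gb])
      also have "\<dots> = c * (\<phi> * (\<rho> (hc (gs a) * gs b) * V)) $$ (0, 0)"
        using hw(4)[OF SL_mult[OF SL_hc[OF ga] gb]] by simp
      also have "\<phi> * (\<rho> (hc (gs a) * gs b) * V) = \<phi> * \<rho> (hc (gs a)) * (\<rho> (gs b) * V)"
        using representation_mult_left[OF hw(1) SL_hc[OF ga] gb hw(2)]
          assoc_mult_mat[OF hw(3) hw(7)[OF SL_hc[OF ga]] hw(8)[OF gb]] by simp
      also have "c * (\<phi> * \<rho> (hc (gs a)) * (\<rho> (gs b) * V)) $$ (0, 0) =
          (c \<cdot>\<^sub>m (\<phi> * \<rho> (hc (gs a)) * (\<rho> (gs b) * V))) $$ (0, 0)"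
        by (rule smult_index_carrier[of _ 1 1, symmetric])
          (use hw(3) hw(7)[OF SL_hc[OF ga]] hw(8)[OF gb] in auto)
      also have "c \<cdot>\<^sub>m (\<phi> * \<rho> (hc (gs a)) * (\<rho> (gs b) * V)) = (c \<cdot>\<^sub>m (\<phi> * \<rho> (hc (gs a)))) * (\<rho> (gs b) * V)"
        by (rule mult_smult_assoc_mat[symmetric, of _ 1 d _ 1])
          (use hw(3) hw(7)[OF SL_hc[OF ga]] hw(8)[OF gb] in auto)
      also have "\<dots> $$ (0, 0) = (A * R) $$ (a, b)"
        by (rule mult_index_cong[of _ 1 d _ k _ 1 _ k])
          (use hw(3) hw(7)[OF SL_hc[OF ga]] hw(8)[OF gb] car ab in
             \<open>auto simp: A_def R_def simp del: index_mult_mat(1) index_smult_mat(1)\<close>)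
      finally show "(hc F * (H * F)) $$ (a, b) = (A * R) $$ (a, b)" .
    qed (use car Hc in auto)
    define z where "z = F * C"
    have z: "z \<in> carrier_mat K 1" using car by (simp add: z_def)
    have "H * z = (H * F) * C" unfolding z_def by (rule assoc_mult_mat[OF Hc car(2,1), symmetric])
    moreover have "hc z = hc C * hc F" unfolding z_def using car by (simp add: hc_mult)
    ultimately have "hc z * (H * z) = hc C * (hc F * (H * F * C))"
      using assoc_mult_mat[of "hc C" 1 k "hc F" K "H * F * C" 1] car Hc by simp
    also have "hc F * (H * F * C) = (A * R) * C"
      using assoc_mult_mat[of "hc F" k K "H * F" k C 1] car Hc FHF by simp
    also have "\<dots> = 0\<^sub>m k 1"
      using assoc_mult_mat[OF car(4,3,1)] RC car by simp
    finally have "hc z * (H * z) = 0\<^sub>m 1 1" using car by simp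
    then have "z = 0\<^sub>m K 1" by (rule gram_pos_zero[OF H z])
    then have "(F * C) $$ (r, 0) = 0" using r by (simp add: z_def)
    moreover have "(F * C) $$ (r, 0) = (\<Sum>a<k. cc a * f (gs a) $$ (r, 0))"
      using r by (subst mat_mult_entry) (auto simp: F_def C_def mult.commute)
    ultimately show "(\<Sum>a<k. cc a * f (gs a) $$ (r, 0)) = 0" by simp
  qed
  then have "\<forall>r. \<exists>\<xi>. r < K \<longrightarrow> (\<forall>g\<in>SL n. (\<Sum>s<d. \<xi> s * (\<rho> g * V) $$ (s, 0)) = f g $$ (r, 0))" by blast
  then obtain \<xi> where xi: "\<And>r g. r < K \<Longrightarrow> g \<in> SL n \<Longrightarrow> (\<Sum>s<d. \<xi> r s * (\<rho> g * V) $$ (s, 0)) = f g $$ (r, 0)"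
    unfolding choice_iff by blast
  define J where "J = mat K d (\<lambda>(r, s). \<xi> r s)"
  have J: "J \<in> carrier_mat K d" by (simp add: J_def)
  have "J * (\<rho> g * V) = f g" if g: "g \<in> SL n" for g
  proof (intro eq_matI)
    fix r j assume "r < dim_row (f g)" "j < dim_col (f g)"
    then have r: "r < K" "j = 0" using f[OF g] by auto
    have "(J * (\<rho> g * V)) $$ (r, j) = (\<Sum>s<d. J $$ (r, s) * (\<rho> g * V) $$ (s, 0))"
      using r J hw(8)[OF g] by (subst mat_mult_entry) auto
    also have "\<dots> = (\<Sum>s<d. \<xi> r s * (\<rho> g * V) $$ (s, 0))"
      using r by (intro sum.cong) (auto simp: J_def)
    finally show "(J * (\<rho> g * V)) $$ (r, j) = f g $$ (r, j)" using xi[OF r(1) g] r by simp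
  qed (use J f[OF g] hw(8)[OF g] in auto)
  then show ?thesis using J by blast
qed

text \<open>The adjoint of \<open>\<rho> g\<close> for \<open>H\<close> is
  \<open>\<rho> (hc g)\<close>. For unitary \<open>g\<close> this is invariance of the form; for
  triangular \<open>g\<close> it exchanges upper and lower, which turns semi-invariant covectors
  into highest weight vectors.\<close>

definition unitary_form :: "nat \<Rightarrow> nat \<Rightarrow> (complex mat \<Rightarrow> complex mat) \<Rightarrow> complex mat \<Rightarrow> bool" where
  "unitary_form n d \<rho> H \<longleftrightarrow> gram_pos d H \<and> (\<forall>g\<in>SL n. hc (\<rho> g) * H = H * \<rho> (hc g))"

text \<open>For the standard form, the tuple of the functions \<open>fs\<close> has a Gram kernel
  proportional to \<open>D\<close>, so \<open>hw_extension\<close> applies.\<close>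

lemma hw_functionals:
  assumes data: "hw_data n d \<rho> D V \<phi>" and gr: "gramian n D fs"
  shows "\<exists>E\<in>carrier_mat (length fs) d. \<forall>g\<in>SL n. E * (\<rho> g * V) = mat (length fs) 1 (\<lambda>(i, _). (fs ! i) g)"
proof -
  let ?K = "length fs"
  let ?f = "\<lambda>g. mat ?K 1 (\<lambda>(i, _). (fs ! i) g)"
  obtain c where c: "\<And>g h. g \<in> SL n \<Longrightarrow> h \<in> SL n \<Longrightarrow> c * D (hc g * h) = (\<Sum>f\<leftarrow>fs. cnj (f g) * f h)"
    using gr SL_D(1) unfolding gramian_def by blast
  show ?thesis
  proof (rule hw_extension[OF data gram_pos_one[of ?K]])
    fix g h assume gh: "g \<in> SL n" "h \<in> SL n"
    have "1\<^sub>m ?K * ?f h = ?f h" by (rule left_mult_one_mat[of _ _ 1]) simp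
    then have "(hc (?f g) * (1\<^sub>m ?K * ?f h)) $$ (0, 0) = (\<Sum>i<?K. cnj ((fs ! i) g) * (fs ! i) h)"
      by (simp add: mat_mult_entry del: index_mult_mat(1))
    also have "\<dots> = (\<Sum>f\<leftarrow>fs. cnj (f g) * f h)"
      by (simp add: sum_list_sum_nth atLeast0LessThan)
    finally show "(hc (?f g) * (1\<^sub>m ?K * ?f h)) $$ (0, 0) = c * D (hc g * h)" using c[OF gh] by simp
  qed simp
qed

lemma hw_functional_of_section:
  assumes data: "hw_data n d \<rho> D V \<phi>" and "flag_section n D f"
  shows "\<exists>\<xi>\<in>carrier_mat 1 d. \<forall>g\<in>SL n. (\<xi> * (\<rho> g * V)) $$ (0, 0) = f g"
proof -
  obtain fs where fs: "gramian n D fs" "f \<in> set fs" using assms(2) by (auto simp: flag_section_def)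
  obtain i where i: "i < length fs" "fs ! i = f" using fs(2) by (auto simp: in_set_conv_nth)
  obtain E where E: "E \<in> carrier_mat (length fs) d"
    "\<And>g. g \<in> SL n \<Longrightarrow> E * (\<rho> g * V) = mat (length fs) 1 (\<lambda>(i, _). (fs ! i) g)"
    using hw_functionals[OF data fs(1)] by blast
  show ?thesis
  proof (intro bexI[of _ "mat 1 d (\<lambda>(_, j). E $$ (i, j))"] ballI)
    fix g assume g: "g \<in> SL n"
    have "(mat 1 d (\<lambda>(_, j). E $$ (i, j)) * (\<rho> g * V)) $$ (0, 0) = (E * (\<rho> g * V)) $$ (i, 0)"
      by (rule mult_index_cong[of _ 1 d _ "length fs" _ 1 _ 1])
        (use E(1) hw_dataD(8)[OF data g] i in auto)
    then show "(mat 1 d (\<lambda>(_, j). E $$ (i, j)) * (\<rho> g * V)) $$ (0, 0) = f g"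
      using E(2)[OF g] i by simp
  qed simp
qed

text \<open>The standard form is pulled back along \<open>E\<close>. Pairing with the orbit vector
  at \<open>hc g\<close> is \<open>c \<cdot>\<^sub>m (\<phi> * \<rho> g)\<close>, so a vector in the
  radical is killed by all translates of \<open>\<phi>\<close> and vanishes. Contravariance is
  checked on orbit vectors, where both sides are the same value of \<open>D\<close>.\<close>

lemma hw_form_exists:
  assumes data: "hw_data n d \<rho> D V \<phi>" and gr: "gramian n D fs"
  shows "\<exists>H c. unitary_form n d \<rho> H \<and> c \<noteq> 0 \<and>
    (\<forall>g\<in>SL n. \<forall>h\<in>SL n. (hc (\<rho> g * V) * H * (\<rho> h * V)) $$ (0, 0) = c * D (hc g * h))"
proof -
  note hw = hw_dataD[OF data]
  let ?K = "length fs"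
  obtain c where c: "c \<noteq> 0" "\<And>g h. g \<in> SL n \<Longrightarrow> h \<in> SL n \<Longrightarrow> c * D (hc g * h) = (\<Sum>f\<leftarrow>fs. cnj (f g) * f h)"
    using gr SL_D(1) unfolding gramian_def by blast
  obtain E where E: "E \<in> carrier_mat ?K d"
    "\<And>g. g \<in> SL n \<Longrightarrow> E * (\<rho> g * V) = mat ?K 1 (\<lambda>(i, _). (fs ! i) g)"
    using hw_functionals[OF data gr] by blast
  define H where "H = hc E * E"
  have Hc: "H \<in> carrier_mat d d" using E by (simp add: H_def)
  have hE: "hc E \<in> carrier_mat d ?K" using E by simp
  have form: "(hc (\<rho> g * V) * H * (\<rho> h * V)) $$ (0, 0) = c * D (hc g * h)" if gh: "g \<in> SL n" "h \<in> SL n" for g h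
  proof -
    let ?x = "\<rho> g * V" and ?y = "\<rho> h * V"
    have x: "?x \<in> carrier_mat d 1" "hc ?x \<in> carrier_mat 1 d" and y: "?y \<in> carrier_mat d 1"
      using hw(8)[OF gh(1)] hw(8)[OF gh(2)] by simp_all
    have "hc ?x * H * ?y = hc ?x * (hc E * (E * ?y))"
      using assoc_mult_mat[OF x(2) Hc y] assoc_mult_mat[OF hE E(1) y] by (simp add: H_def)
    also have "\<dots> = hc (E * ?x) * (E * ?y)"
      using assoc_mult_mat[OF x(2) hE, of "E * ?y" 1] hc_mult_carrier[OF E(1) x(1)] E(1) x(1) y by simp
    also have "\<dots> $$ (0, 0) = (\<Sum>i<?K. cnj ((fs ! i) g) * (fs ! i) h)"
      unfolding E(2)[OF gh(1)] E(2)[OF gh(2)] by (simp add: mat_mult_entry del: index_mult_mat(1))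
    also have "\<dots> = (\<Sum>f\<leftarrow>fs. cnj (f g) * f h)"
      by (simp add: sum_list_sum_nth atLeast0LessThan)
    finally show ?thesis using c(2)[OF gh] by simp
  qed
  have det: "det H \<noteq> 0"
  proof (rule det_nonzeroI[OF Hc])
    fix y assume y: "y \<in> carrier_mat d 1" and Hy: "H * y = 0\<^sub>m d 1"
    show "y = 0\<^sub>m d 1"
    proof (rule hw(6)[OF y])
      fix g assume g: "g \<in> SL n"
      note g' = SL_hc[OF g]
      let ?x = "\<rho> (hc g) * V"
      have x: "?x \<in> carrier_mat d 1" "hc ?x \<in> carrier_mat 1 d" using hw(8)[OF g'] by simp_all
      have pg: "\<phi> * \<rho> g \<in> carrier_mat 1 d" using hw(3) hw(7)[OF g] by simp
      have "hc ?x * H = c \<cdot>\<^sub>m (\<phi> * \<rho> g)"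
      proof (rule hw_operator_eq[OF data, of _ 1])
        fix h i assume h: "h \<in> SL n" and "i < (1::nat)"
        then have i: "i = 0" by simp
        note y = hw(8)[OF h]
        have "((c \<cdot>\<^sub>m (\<phi> * \<rho> g)) * (\<rho> h * V)) = c \<cdot>\<^sub>m (\<phi> * (\<rho> (g * h) * V))"
          using mult_smult_assoc_mat[OF pg y] assoc_mult_mat[OF hw(3) hw(7)[OF g] y]
            representation_mult_left[OF hw(1) g h hw(2)] by simp
        also have "\<dots> $$ (0, 0) = c * D (g * h)"
          using smult_index_carrier[of "\<phi> * (\<rho> (g * h) * V)" 1 1 0 0 c] hw(4)[OF SL_mult[OF g h]]
            hw(3) hw(8)[OF SL_mult[OF g h]] by simp
        finally show "(hc ?x * H * (\<rho> h * V)) $$ (i, 0) = ((c \<cdot>\<^sub>m (\<phi> * \<rho> g)) * (\<rho> h * V)) $$ (i, 0)"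
          using form[OF g' h] i by simp
      qed (use x Hc pg in simp_all)
      then have "c \<cdot>\<^sub>m (\<phi> * \<rho> g * y) = hc ?x * H * y"
        using mult_smult_assoc_mat[OF pg y, of c] by simp
      also have "\<dots> = 0\<^sub>m 1 1" using assoc_mult_mat[OF x(2) Hc y] right_mult_zero_mat[OF x(2)] unfolding Hy by metis
      finally have "(c \<cdot>\<^sub>m (\<phi> * \<rho> g * y)) $$ (0, 0) = 0" by simp
      then have "(\<phi> * \<rho> g * y) $$ (0, 0) = 0"
        using smult_index_carrier[of "\<phi> * \<rho> g * y" 1 1 0 0 c] pg y c(1) by simp
      then show "(\<phi> * (\<rho> g * y)) $$ (0, 0) = 0" using assoc_mult_mat[OF hw(3) hw(7)[OF g] y] by simp
    qed
  qed
  have pos: "gram_pos d H" using det E(1) by (auto simp: gram_pos_def H_def)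
  have "hc (\<rho> g) * H = H * \<rho> (hc g)" if g: "g \<in> SL n" for g
  proof (rule hw_form_eq[OF data])
    note g' = SL_hc[OF g]
    have hg: "hc (\<rho> g) \<in> carrier_mat d d" using hw(7)[OF g] by simp
    show "hc (\<rho> g) * H \<in> carrier_mat d d" "H * \<rho> (hc g) \<in> carrier_mat d d"
      using hg Hc hw(7)[OF g'] by simp_all
    fix k h assume k: "k \<in> SL n" and h: "h \<in> SL n"
    have x: "hc (\<rho> k * V) \<in> carrier_mat 1 d" and y: "\<rho> h * V \<in> carrier_mat d 1"
      using hw(8)[OF k] hw(8)[OF h] by simp_all
    have "hc (\<rho> k * V) * (hc (\<rho> g) * H) = hc (\<rho> (g * k) * V) * H"
      using assoc_mult_mat[OF x hg Hc] hc_mult_carrier[OF hw(7)[OF g] hw(8)[OF k]]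
        representation_mult_left[OF hw(1) g k hw(2)] by simp
    then have "(hc (\<rho> k * V) * (hc (\<rho> g) * H) * (\<rho> h * V)) $$ (0, 0) = c * D (hc (g * k) * h)"
      using form[OF SL_mult[OF g k] h] by simp
    also have "hc (g * k) * h = hc k * (hc g * h)"
      using hc_mult[of g k] SL_D(1)[OF g] SL_D(1)[OF k] SL_D(1)[OF h]
        assoc_mult_mat[of "hc k" "Suc n" "Suc n" "hc g" "Suc n" h "Suc n"] by simp
    also have "c * D (hc k * (hc g * h)) = (hc (\<rho> k * V) * H * (\<rho> (hc g * h) * V)) $$ (0, 0)"
      using form[OF k SL_mult[OF g' h]] by simp
    also have "hc (\<rho> k * V) * H * (\<rho> (hc g * h) * V) = hc (\<rho> k * V) * (H * \<rho> (hc g)) * (\<rho> h * V)"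
      using representation_mult_left[OF hw(1) g' h hw(2)]
        assoc_mult_mat[of "hc (\<rho> k * V) * H" 1 d "\<rho> (hc g)" d "\<rho> h * V" 1]
        assoc_mult_mat[OF x Hc hw(7)[OF g']] x y Hc hw(7)[OF g'] by simp
    finally show "(hc (\<rho> k * V) * (hc (\<rho> g) * H) * (\<rho> h * V)) $$ (0, 0) =
        (hc (\<rho> k * V) * (H * \<rho> (hc g)) * (\<rho> h * V)) $$ (0, 0)" .
  qed
  then have "unitary_form n d \<rho> H" using pos by (simp add: unitary_form_def)
  then show ?thesis using c(1) form by blast
qed

section \<open>Intertwiners and multiplicities\<close>

lemma tensor_carrier:
  "\<lbrakk>representation n d \<rho>; representation n e \<sigma>; g \<in> SL n\<rbrakk> \<Longrightarrow> tensor_rep \<rho> \<sigma> g \<in> carrier_mat (d * e) (d * e)"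
  by (simp add: tensor_rep_def representation_carrier)

lemma representation_tensor:
  assumes r: "representation n d \<rho>" and s: "representation n e \<sigma>"
  shows "representation n (d * e) (tensor_rep \<rho> \<sigma>)"
  unfolding representation_def
proof (intro conjI ballI allI impI)
  show "tensor_rep \<rho> \<sigma> g \<in> carrier_mat (d * e) (d * e)" if "g \<in> SL n" for g
    using tensor_carrier[OF r s that] .
  show "tensor_rep \<rho> \<sigma> (1\<^sub>m (Suc n)) = 1\<^sub>m (d * e)"
    by (simp add: tensor_rep_def representation_one[OF r] representation_one[OF s] kronecker_one)
  show "tensor_rep \<rho> \<sigma> (g * h) = tensor_rep \<rho> \<sigma> g * tensor_rep \<rho> \<sigma> h" if "g \<in> SL n" "h \<in> SL n" for g h
    using representation_carrier[OF r that(1)] representation_carrier[OF s that(1)]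
      representation_carrier[OF r that(2)] representation_carrier[OF s that(2)]
    by (simp add: tensor_rep_def representation_mult[OF r that] representation_mult[OF s that] kronecker_mult)
next
  fix i j assume i: "i < d * e" and j: "j < d * e"
  have "i div e < d" "i mod e < e" "j div e < d" "j mod e < e" using div_mod_less[OF i] div_mod_less[OF j] by auto
  then obtain p q where p: "polynomial_fun n p" "\<forall>g\<in>SL n. \<rho> g $$ (i div e, j div e) = p g"
    and q: "polynomial_fun n q" "\<forall>g\<in>SL n. \<sigma> g $$ (i mod e, j mod e) = q g"
    using r s unfolding representation_def by metis
  show "\<exists>p. polynomial_fun n p \<and> (\<forall>g\<in>SL n. tensor_rep \<rho> \<sigma> g $$ (i, j) = p g)"
  proof (intro exI[of _ "\<lambda>g. p g * q g"] conjI ballI)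
    fix g assume g: "g \<in> SL n"
    show "tensor_rep \<rho> \<sigma> g $$ (i, j) = p g * q g"
      using representation_carrier[OF r g] representation_carrier[OF s g] p q g i j
      by (simp add: tensor_rep_def kronecker_index)
  qed (use p q in \<open>intro polynomial_fun.mult\<close>)
qed

lemma gram_pos_kronecker:
  assumes "gram_pos d H" "gram_pos e K" shows "gram_pos (d * e) (kronecker H K)"
proof -
  obtain a E where E: "E \<in> carrier_mat a d" "H = hc E * E" "det H \<noteq> 0" using assms(1) by (auto simp: gram_pos_def)
  obtain b F where F: "F \<in> carrier_mat b e" "K = hc F * F" "det K \<noteq> 0" using assms(2) by (auto simp: gram_pos_def)
  have "kronecker H K = hc (kronecker E F) * kronecker E F"
    unfolding hc_kronecker E(2) F(2) by (rule kronecker_mult[symmetric]) auto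
  moreover have "kronecker E F \<in> carrier_mat (a * b) (d * e)" using E F by simp
  moreover have "det (kronecker H K) \<noteq> 0"
    by (rule det_kronecker_nonzero[OF gram_pos_carrier[OF assms(1)] gram_pos_carrier[OF assms(2)] E(3) F(3)])
  ultimately show ?thesis unfolding gram_pos_def by blast
qed

lemma unitary_form_tensor:
  assumes r: "representation n d \<rho>" and s: "representation n e \<sigma>"
    and H: "unitary_form n d \<rho> H" and K: "unitary_form n e \<sigma> K"
  shows "unitary_form n (d * e) (tensor_rep \<rho> \<sigma>) (kronecker H K)"
  unfolding unitary_form_def
proof (intro conjI ballI)
  have g: "gram_pos d H" "gram_pos e K" using H K by (simp_all add: unitary_form_def)
  then show "gram_pos (d * e) (kronecker H K)" by (rule gram_pos_kronecker)
  note c = gram_pos_carrier[OF g(1)] gram_pos_carrier[OF g(2)]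
  fix g assume g: "g \<in> SL n"
  note c' = representation_carrier[OF r g] representation_carrier[OF s g]
    representation_carrier[OF r SL_hc[OF g]] representation_carrier[OF s SL_hc[OF g]]
  have "hc (tensor_rep \<rho> \<sigma> g) * kronecker H K = kronecker (hc (\<rho> g) * H) (hc (\<sigma> g) * K)"
    using c c' by (simp add: tensor_rep_def hc_kronecker kronecker_mult)
  also have "\<dots> = kronecker (H * \<rho> (hc g)) (K * \<sigma> (hc g))"
    using H K g by (simp add: unitary_form_def)
  also have "\<dots> = kronecker H K * tensor_rep \<rho> \<sigma> (hc g)"
    using c c' by (simp add: tensor_rep_def kronecker_mult)
  finally show "hc (tensor_rep \<rho> \<sigma> g) * kronecker H K = kronecker H K * tensor_rep \<rho> \<sigma> (hc g)" .
qed

lemma kronecker_left_factor: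
  fixes x y :: "'a :: comm_semiring_1 mat"
  assumes "x \<in> carrier_mat d 1" "y \<in> carrier_mat e 1"
  shows "kronecker x y = kronecker (1\<^sub>m d) y * x" "kronecker x y = kronecker x (1\<^sub>m e) * y"
proof -
  have "kronecker (1\<^sub>m d) y * kronecker x (1\<^sub>m 1) = kronecker (1\<^sub>m d * x) (y * 1\<^sub>m 1)"
    using assms by (intro kronecker_mult) auto
  then show "kronecker x y = kronecker (1\<^sub>m d) y * x" using assms by (simp add: kronecker_1x1)
  have "kronecker x (1\<^sub>m e) * kronecker (1\<^sub>m 1) y = kronecker (x * 1\<^sub>m 1) (1\<^sub>m e * y)"
    using assms by (intro kronecker_mult) auto
  then show "kronecker x y = kronecker x (1\<^sub>m e) * y" using assms by (simp add: kronecker_1x1)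
qed

text \<open>Products of orbit vectors span the tensor product: with one factor fixed,
  \<open>X\<close> becomes a covector on the other, where the orbit spans. Hence a covector is
  determined by a function of independent \<open>g\<close> and \<open>h\<close>.\<close>

lemma tensor_separation:
  assumes r: "hw_data n d \<rho> D V \<phi>" and s: "hw_data n e \<sigma> D' V' \<phi>'"
    and X: "X \<in> carrier_mat 1 (d * e)"
    and 0: "\<And>g h. g \<in> SL n \<Longrightarrow> h \<in> SL n \<Longrightarrow> (X * kronecker (\<rho> g * V) (\<sigma> h * V')) $$ (0, 0) = 0"
  shows "X = 0\<^sub>m 1 (d * e)"
proof (rule row_zero_if_all_products_zero[OF X])
  have 1: "(X * kronecker x (\<sigma> h * V')) $$ (0, 0) = 0" if x: "x \<in> carrier_mat d 1" and h: "h \<in> SL n" for x h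
  proof -
    note y = hw_dataD(8)[OF s h]
    have c: "kronecker (1\<^sub>m d) (\<sigma> h * V') \<in> carrier_mat (d * e) d"
      using kronecker_carrier[OF one_carrier_mat y, of d] by simp
    have as: "X * kronecker z (\<sigma> h * V') = X * kronecker (1\<^sub>m d) (\<sigma> h * V') * z" if "z \<in> carrier_mat d 1" for z
      using kronecker_left_factor(1)[OF that y] assoc_mult_mat[OF X c that] by simp
    have "X * kronecker (1\<^sub>m d) (\<sigma> h * V') = 0\<^sub>m 1 d"
    proof (rule hw_dataD(5)[OF r])
      fix g assume g: "g \<in> SL n"
      show "(X * kronecker (1\<^sub>m d) (\<sigma> h * V') * (\<rho> g * V)) $$ (0, 0) = 0"
        using 0[OF g h] as[OF hw_dataD(8)[OF r g]] by simp
    qed (use X c in simp)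
    then show ?thesis using as[OF x] x by simp
  qed
  have 2: "(X * kronecker x y) $$ (0, 0) = 0" if x: "x \<in> carrier_mat d 1" and y: "y \<in> carrier_mat e 1" for x y
  proof -
    have c: "kronecker x (1\<^sub>m e) \<in> carrier_mat (d * e) e"
      using kronecker_carrier[OF x one_carrier_mat, of e] by simp
    have as: "X * kronecker x z = X * kronecker x (1\<^sub>m e) * z" if "z \<in> carrier_mat e 1" for z
      using kronecker_left_factor(2)[OF x that] assoc_mult_mat[OF X c that] by simp
    have "X * kronecker x (1\<^sub>m e) = 0\<^sub>m 1 e"
    proof (rule hw_dataD(5)[OF s])
      fix h assume h: "h \<in> SL n"
      show "(X * kronecker x (1\<^sub>m e) * (\<sigma> h * V')) $$ (0, 0) = 0"
        using 1[OF x h] as[OF hw_dataD(8)[OF s h]] by simp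
    qed (use X c in simp)
    then show ?thesis using as[OF y] y by simp
  qed
  have X0: "X $$ (0, k) = 0" if k: "k < d * e" for k
  proof -
    let ?u = "\<lambda>m i. mat m 1 (\<lambda>(r, _). if r = i then 1 else 0 :: complex)"
    have "(X * kronecker (?u d (k div e)) (?u e (k mod e))) $$ (0, 0) =
        (\<Sum>l<d * e. X $$ (0, l) * kronecker (?u d (k div e)) (?u e (k mod e)) $$ (l, 0))"
      using X by (subst mat_mult_entry) auto
    also have "\<dots> = (\<Sum>l<d * e. if l = k then X $$ (0, k) else 0)"
    proof (rule sum.cong[OF refl])
      fix l assume "l \<in> {..<d * e}"
      then have l: "l < d * e" by simp
      have "l div e = k div e \<and> l mod e = k mod e \<longleftrightarrow> l = k" by (metis div_mult_mod_eq)
      then show "X $$ (0, l) * kronecker (?u d (k div e)) (?u e (k mod e)) $$ (l, 0) = (if l = k then X $$ (0, k) else 0)"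
        using div_mod_less[OF l] l by (auto simp: kronecker_index)
    qed
    also have "\<dots> = X $$ (0, k)" using k by (subst sum.delta) auto
    finally show ?thesis using 2[of "?u d (k div e)" "?u e (k mod e)"] by simp
  qed
  fix y :: "complex mat" assume y: "y \<in> carrier_mat (d * e) 1"
  have "(X * y) $$ (0, 0) = (\<Sum>l<d * e. X $$ (0, l) * y $$ (l, 0))"
    using X y by (subst mat_mult_entry) auto
  then show "(X * y) $$ (0, 0) = 0" using X0 by simp
qed

text \<open>The group acts on covectors from the right, and lower triangular matrices are used
  because leading minors are multiplicative for lower triangular left factors.\<close>

definition semi_invariant :: "nat \<Rightarrow> (complex mat \<Rightarrow> complex mat) \<Rightarrow> (complex mat \<Rightarrow> complex) \<Rightarrow> complex mat \<Rightarrow> bool" where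
  "semi_invariant n \<tau> D \<Psi> \<longleftrightarrow> (\<forall>b\<in>SL n. lower_triangular b \<longrightarrow> \<Psi> * \<tau> b = D b \<cdot>\<^sub>m \<Psi>)"

section \<open>Intertwiners attached to semi-invariant covectors\<close>

context
  fixes n K d :: nat and \<tau> \<rho> :: "complex mat \<Rightarrow> complex mat" and H H\<^sub>1 V \<phi> :: "complex mat"
    and e :: "nat \<Rightarrow> nat" and c :: complex
  assumes \<tau>: "representation n K \<tau>" and H: "unitary_form n K \<tau> H"
    and data: "hw_data n d \<rho> (flag_pow n e) V \<phi>" and H\<^sub>1: "unitary_form n d \<rho> H\<^sub>1" and c: "c \<noteq> 0"
    and form: "\<And>g h. g \<in> SL n \<Longrightarrow> h \<in> SL n \<Longrightarrow>
      (hc (\<rho> g * V) * H\<^sub>1 * (\<rho> h * V)) $$ (0, 0) = c * flag_pow n e (hc g * h)"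
begin

private abbreviation "D \<equiv> flag_pow n e"

private lemma posH: "gram_pos K H" "gram_pos d H\<^sub>1"
  using H H\<^sub>1 by (simp_all add: unitary_form_def)

private lemmas Hc = gram_pos_carrier[OF posH(1)] gram_pos_carrier[OF posH(2)]

private lemma Hrel:
  assumes "g \<in> SL n"
  shows "hc (\<tau> (hc g)) * H = H * \<tau> g" "hc (\<rho> (hc g)) * H\<^sub>1 = H\<^sub>1 * \<rho> g" "hc (\<tau> g) * H = H * \<tau> (hc g)"
  using H H\<^sub>1 assms SL_hc[OF assms] by (simp_all add: unitary_form_def)

private lemma tc: "g \<in> SL n \<Longrightarrow> \<tau> g \<in> carrier_mat K K"
  using representation_carrier[OF \<tau>] .

text \<open>\<open>w\<close> represents \<open>\<Psi>\<close> through the form. The adjoint of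
  \<open>\<tau> b\<close> is \<open>\<tau> (hc b)\<close>, and \<open>hc b\<close> is lower
  triangular, so the semi-invariance of \<open>\<Psi>\<close> passes to \<open>w\<close>.\<close>

lemma dual_vector_eigen:
  assumes P: "\<Psi> \<in> carrier_mat 1 K" "semi_invariant n \<tau> D \<Psi>" and w: "w \<in> carrier_mat K 1" "H * w = hc \<Psi>"
    and b: "b \<in> SL n" "upper_triangular b"
  shows "\<tau> b * w = D b \<cdot>\<^sub>m w"
proof (rule mult_left_cancel_det[OF Hc(1)])
  note hb = SL_hc[OF b(1)]
  have low: "lower_triangular (hc b)" using b SL_D(1)[OF b(1)] by (auto simp: lower_triangular_def upper_triangular_def)
  have "H * (\<tau> b * w) = hc (\<tau> (hc b)) * (H * w)"
    using assoc_mult_mat[OF Hc(1) tc[OF b(1)] w(1)] assoc_mult_mat[of "hc (\<tau> (hc b))" K K H K w 1]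
      Hrel(1)[OF b(1)] tc[OF hb] Hc w(1) by simp
  also have "\<dots> = hc (\<Psi> * \<tau> (hc b))" unfolding w(2) by (rule hc_mult_carrier[OF P(1) tc[OF hb], symmetric])
  also have "\<dots> = hc (D (hc b) \<cdot>\<^sub>m \<Psi>)" using P(2) hb low by (simp add: semi_invariant_def)
  also have "\<dots> = D b \<cdot>\<^sub>m (H * w)" using b(1) w(2) by (simp add: hc_smult flag_pow_hc)
  also have "\<dots> = H * (D b \<cdot>\<^sub>m w)" by (rule mult_smult_distrib[OF Hc(1) w(1), symmetric])
  finally show "H * (\<tau> b * w) = H * (D b \<cdot>\<^sub>m w)" .
  show "det H \<noteq> 0" using posH(1) by (simp add: gram_pos_def)
  show "\<tau> b * w \<in> carrier_mat K 1" by (rule mult_carrier_mat[OF tc[OF b(1)] w(1)])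
  show "D b \<cdot>\<^sub>m w \<in> carrier_mat K 1" using w(1) by simp
qed

text \<open>On the big cell \<open>g = l * b\<close>, where \<open>l\<close> is absorbed by
  \<open>\<Psi>\<close> and \<open>b\<close> by \<open>w\<close>. Both sides are polynomial, so
  density does the rest.\<close>

lemma matrix_coefficient_eq:
  assumes P: "\<Psi> \<in> carrier_mat 1 K" "semi_invariant n \<tau> D \<Psi>" and w: "w \<in> carrier_mat K 1"
    and eig: "\<And>b. b \<in> SL n \<Longrightarrow> upper_triangular b \<Longrightarrow> \<tau> b * w = D b \<cdot>\<^sub>m w" and g: "g \<in> SL n"
  shows "(\<Psi> * (\<tau> g * w)) $$ (0, 0) = D g * (\<Psi> * w) $$ (0, 0)"
proof -
  let ?t = "(\<Psi> * w) $$ (0, 0)"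
  obtain p where p: "polynomial_fun n p" "\<And>g. g \<in> SL n \<Longrightarrow> (\<Psi> * (\<tau> g * w)) $$ (0, 0) = p g"
    using polynomial_fun_matrix_coefficient[OF \<tau> P(1) w, of 0 0] by auto
  have Pw: "\<Psi> * w \<in> carrier_mat 1 1" using P w by simp
  have "p g + (- ?t) * D g = 0"
  proof (rule big_cell_dense[of n "\<lambda>g. p g + (- ?t) * D g", OF _ _ g])
    show "polynomial_fun n (\<lambda>g. p g + (- ?t) * D g)"
      by (intro polynomial_fun.add polynomial_fun.mult polynomial_fun.const p(1) polynomial_fun_flag_pow)
  next
    fix g assume gb: "g \<in> big_cell n"
    then have g: "g \<in> SL n" by (simp add: big_cell_def)
    obtain l b where l: "l \<in> SL n" "lower_triangular l"
      and b: "b \<in> SL n" "upper_triangular b" and lb: "g = l * b"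
      using big_cell_lu[OF gb] by metis
    have "\<Psi> * (\<tau> g * w) = \<Psi> * (\<tau> l * (\<tau> b * w))"
      using representation_mult_left[OF \<tau> l(1) b(1) w] lb by simp
    also have "\<dots> = (\<Psi> * \<tau> l) * (\<tau> b * w)"
      using assoc_mult_mat[OF P(1) tc[OF l(1)], of "\<tau> b * w" 1] tc[OF b(1)] w by simp
    also have "\<dots> = (D l \<cdot>\<^sub>m \<Psi>) * (D b \<cdot>\<^sub>m w)"
      using P(2) l eig[OF b] by (simp add: semi_invariant_def)
    also have "\<dots> = D l \<cdot>\<^sub>m (D b \<cdot>\<^sub>m (\<Psi> * w))"
      using mult_smult_assoc_mat[OF P(1), of "D b \<cdot>\<^sub>m w" 1 "D l"] mult_smult_distrib[OF P(1) w, of "D b"] w by simp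
    also have "\<dots> $$ (0, 0) = D l * (D b * ?t)"
      using smult_index_carrier[OF Pw, of 0 0 "D b"] smult_index_carrier[OF smult_carrier_mat[OF Pw], of 0 0 "D l" "D b"]
      by simp
    also have "D l * (D b * ?t) = D g * ?t"
      using flag_pow_lower_mult[OF l(1) b(1) l(2), of e] lb by simp
    finally show "p g + (- ?t) * D g = 0" using p(2)[OF g] by simp
  qed
  then show ?thesis using p(2)[OF g] by (simp add: algebra_simps)
qed

text \<open>Moving \<open>\<tau> g\<close> across the form leaves a matrix coefficient at
  \<open>hc g * h\<close>. With equal indices this is the Gram hypothesis of
  \<open>hw_extension\<close>; with different indices it measures the overlap of two copies.\<close>

lemma orbit_pairing:
  assumes P: "\<Psi>\<^sub>1 \<in> carrier_mat 1 K" "semi_invariant n \<tau> D \<Psi>\<^sub>1" and w1: "w\<^sub>1 \<in> carrier_mat K 1" "H * w\<^sub>1 = hc \<Psi>\<^sub>1"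
    and P2: "\<Psi>\<^sub>2 \<in> carrier_mat 1 K" "semi_invariant n \<tau> D \<Psi>\<^sub>2" and w2: "w\<^sub>2 \<in> carrier_mat K 1" "H * w\<^sub>2 = hc \<Psi>\<^sub>2"
    and g: "g \<in> SL n" and h: "h \<in> SL n"
  shows "(hc (\<tau> g * w\<^sub>1) * (H * (\<tau> h * w\<^sub>2))) $$ (0, 0) = (\<Psi>\<^sub>1 * w\<^sub>2) $$ (0, 0) * D (hc g * h)"
proof -
  note hg = SL_hc[OF g]
  let ?y = "\<tau> h * w\<^sub>2"
  have y: "?y \<in> carrier_mat K 1" using tc[OF h] w2 by simp
  have x: "hc w\<^sub>1 \<in> carrier_mat 1 K" using w1 by simp
  have wH: "hc w\<^sub>1 * H = \<Psi>\<^sub>1"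
    using hc_mult_carrier[OF Hc(1) w1(1)] w1(2) gram_pos_hc[OF posH(1)] by simp
  have "hc (\<tau> g * w\<^sub>1) * (H * ?y) = hc w\<^sub>1 * hc (\<tau> g) * (H * ?y)"
    using hc_mult_carrier[OF tc[OF g] w1(1)] by simp
  also have "\<dots> = hc w\<^sub>1 * (hc (\<tau> g) * H * ?y)"
    using assoc_mult_mat[OF x, of "hc (\<tau> g)" K "H * ?y" 1] assoc_mult_mat[of "hc (\<tau> g)" K K H K ?y 1] tc[OF g] Hc y by simp
  also have "hc (\<tau> g) * H = H * \<tau> (hc g)" by (rule Hrel(3)[OF g])
  also have "hc w\<^sub>1 * (H * \<tau> (hc g) * ?y) = \<Psi>\<^sub>1 * (\<tau> (hc g) * ?y)"
    using assoc_mult_mat[OF Hc(1) tc[OF hg] y] assoc_mult_mat[OF x Hc(1), of "\<tau> (hc g) * ?y" 1] tc[OF hg] y wH by simp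
  also have "\<tau> (hc g) * ?y = \<tau> (hc g * h) * w\<^sub>2" by (rule representation_mult_left[OF \<tau> hg h w2(1)])
  finally show ?thesis
    using matrix_coefficient_eq[OF P w2(1) dual_vector_eigen[OF P2 w2] SL_mult[OF hg h]] by simp
qed

text \<open>\<open>J\<close> comes from \<open>hw_extension\<close>. \<open>L\<close> is its adjoint
  for the two forms, that is \<open>H\<^sub>1^-1 * hc J * H\<close>, and the adjoint of an
  intertwiner is an intertwiner because both forms are contravariant.\<close>

lemma intertwiners_exist:
  assumes P: "\<Psi> \<in> carrier_mat 1 K" "semi_invariant n \<tau> D \<Psi>" and w: "w \<in> carrier_mat K 1" "H * w = hc \<Psi>"
  shows "\<exists>J L. J \<in> carrier_mat K d \<and> L \<in> carrier_mat d K \<and> (\<forall>g\<in>SL n. J * (\<rho> g * V) = \<tau> g * w) \<and>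
    (\<forall>g\<in>SL n. J * \<rho> g = \<tau> g * J) \<and> (\<forall>g\<in>SL n. L * \<tau> g = \<rho> g * L) \<and> H\<^sub>1 * L = hc J * H"
proof -
  note hw = hw_dataD[OF data]
  have "\<exists>J\<in>carrier_mat K d. \<forall>g\<in>SL n. J * (\<rho> g * V) = \<tau> g * w"
    by (rule hw_extension[OF data posH(1) mult_carrier_mat[OF tc w(1)] orbit_pairing[OF P w P w]])
  then obtain J where J: "J \<in> carrier_mat K d" "\<And>g. g \<in> SL n \<Longrightarrow> J * (\<rho> g * V) = \<tau> g * w" by blast
  have JJ: "J * \<rho> g = \<tau> g * J" if g: "g \<in> SL n" for g
  proof (rule hw_operator_eq[OF data])
    fix h i assume h: "h \<in> SL n"
    have "J * \<rho> g * (\<rho> h * V) = \<tau> (g * h) * w"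
      using assoc_mult_mat[OF J(1) hw(7)[OF g] hw(8)[OF h]] representation_mult_left[OF hw(1) g h hw(2)]
        J(2)[OF SL_mult[OF g h]] by simp
    also have "\<dots> = \<tau> g * J * (\<rho> h * V)"
      using assoc_mult_mat[OF tc[OF g] J(1) hw(8)[OF h]] representation_mult_left[OF \<tau> g h w(1)] J(2)[OF h] by simp
    finally show "(J * \<rho> g * (\<rho> h * V)) $$ (i, 0) = (\<tau> g * J * (\<rho> h * V)) $$ (i, 0)" by simp
  qed (use J hw(7)[OF g] tc[OF g] in auto)
  have det1: "det H\<^sub>1 \<noteq> 0" using posH by (simp add: gram_pos_def)
  obtain M where M: "M \<in> carrier_mat d d" "H\<^sub>1 * M = 1\<^sub>m d"
    using inverse_exists_det[OF Hc(2) det1] by blast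
  define L where "L = M * (hc J * H)"
  have hJH: "hc J * H \<in> carrier_mat d K" and hJ: "hc J \<in> carrier_mat d K" using J(1) Hc by simp_all
  have L: "L \<in> carrier_mat d K" using M hJH by (simp add: L_def)
  have HL: "H\<^sub>1 * L = hc J * H"
    unfolding L_def using assoc_mult_mat[OF Hc(2) M(1) hJH] M(2) left_mult_one_mat[OF hJH] by metis
  have "L * \<tau> g = \<rho> g * L" if g: "g \<in> SL n" for g
  proof (rule mult_left_cancel_det[OF Hc(2) det1])
    note hg = SL_hc[OF g]
    have hr: "hc (\<rho> (hc g)) \<in> carrier_mat d d" and ht: "hc (\<tau> (hc g)) \<in> carrier_mat K K"
      using hw(7)[OF hg] tc[OF hg] by simp_all
    have "H\<^sub>1 * (L * \<tau> g) = hc J * H * \<tau> g"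
      using assoc_mult_mat[OF Hc(2) L tc[OF g]] HL by simp
    also have "\<dots> = hc J * hc (\<tau> (hc g)) * H"
      using assoc_mult_mat[OF hJ Hc(1) tc[OF g]] assoc_mult_mat[OF hJ ht Hc(1)] Hrel(1)[OF g] by simp
    also have "hc J * hc (\<tau> (hc g)) = hc (\<rho> (hc g)) * hc J"
      using hc_mult_carrier[OF tc[OF hg] J(1)] hc_mult_carrier[OF J(1) hw(7)[OF hg]] JJ[OF hg] by simp
    also have "hc (\<rho> (hc g)) * hc J * H = hc (\<rho> (hc g)) * (H\<^sub>1 * L)"
      using assoc_mult_mat[OF hr hJ Hc(1)] HL by simp
    also have "\<dots> = H\<^sub>1 * (\<rho> g * L)"
      using assoc_mult_mat[OF hr Hc(2) L] Hrel(2)[OF g] assoc_mult_mat[OF Hc(2) hw(7)[OF g] L] by simp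
    finally show "H\<^sub>1 * (L * \<tau> g) = H\<^sub>1 * (\<rho> g * L)" .
  qed (use L hw(7)[OF g] tc[OF g] in auto)
  then show ?thesis using J JJ L HL by blast
qed

text \<open>Schur's lemma with the scalar made explicit: on the orbit of \<open>V\<close> the form
  \<open>H\<close>, transported by \<open>J\<^sub>1\<close> and \<open>J\<^sub>2\<close>, and the
  form \<open>H\<^sub>1\<close> both have kernels proportional to \<open>D\<close>. Orthogonal
  covectors give scalar 0, which keeps two copies apart.\<close>

lemma intertwiners_product:
  assumes P1: "\<Psi>\<^sub>1 \<in> carrier_mat 1 K" "semi_invariant n \<tau> D \<Psi>\<^sub>1" and w1: "w\<^sub>1 \<in> carrier_mat K 1" "H * w\<^sub>1 = hc \<Psi>\<^sub>1"
    and P2: "\<Psi>\<^sub>2 \<in> carrier_mat 1 K" "semi_invariant n \<tau> D \<Psi>\<^sub>2" and w2: "w\<^sub>2 \<in> carrier_mat K 1" "H * w\<^sub>2 = hc \<Psi>\<^sub>2"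
    and J1: "J\<^sub>1 \<in> carrier_mat K d" "\<And>g. g \<in> SL n \<Longrightarrow> J\<^sub>1 * (\<rho> g * V) = \<tau> g * w\<^sub>1"
    and J2: "J\<^sub>2 \<in> carrier_mat K d" "\<And>g. g \<in> SL n \<Longrightarrow> J\<^sub>2 * (\<rho> g * V) = \<tau> g * w\<^sub>2"
    and L: "L \<in> carrier_mat d K" "H\<^sub>1 * L = hc J\<^sub>1 * H"
  shows "L * J\<^sub>2 = ((\<Psi>\<^sub>1 * w\<^sub>2) $$ (0, 0) / c) \<cdot>\<^sub>m 1\<^sub>m d"
proof -
  note hw = hw_dataD[OF data]
  let ?t = "(\<Psi>\<^sub>1 * w\<^sub>2) $$ (0, 0)"
  have det1: "det H\<^sub>1 \<noteq> 0" using posH by (simp add: gram_pos_def)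
  have hJ: "hc J\<^sub>1 \<in> carrier_mat d K" using J1 by simp
  have "hc J\<^sub>1 * H * J\<^sub>2 = (?t / c) \<cdot>\<^sub>m H\<^sub>1"
  proof (rule hw_form_eq[OF data])
    fix g h assume g: "g \<in> SL n" and h: "h \<in> SL n"
    let ?x = "\<rho> g * V" and ?y = "\<rho> h * V"
    have x: "hc ?x \<in> carrier_mat 1 d" and y: "?y \<in> carrier_mat d 1"
      using hw(8)[OF g] hw(8)[OF h] by simp_all
    have Jy: "J\<^sub>2 * ?y \<in> carrier_mat K 1" by (rule mult_carrier_mat[OF J2(1) y])
    have "hc ?x * (hc J\<^sub>1 * H * J\<^sub>2) * ?y = hc ?x * (hc J\<^sub>1 * H * J\<^sub>2 * ?y)"
      by (rule assoc_mult_mat[OF x mult_carrier_mat[OF mult_carrier_mat[OF hJ Hc(1)] J2(1)] y])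
    also have "hc J\<^sub>1 * H * J\<^sub>2 * ?y = hc J\<^sub>1 * H * (J\<^sub>2 * ?y)"
      by (rule assoc_mult_mat[OF mult_carrier_mat[OF hJ Hc(1)] J2(1) y])
    also have "hc J\<^sub>1 * H * (J\<^sub>2 * ?y) = hc J\<^sub>1 * (H * (J\<^sub>2 * ?y))"
      by (rule assoc_mult_mat[OF hJ Hc(1) Jy])
    also have "hc ?x * (hc J\<^sub>1 * (H * (J\<^sub>2 * ?y))) = hc ?x * hc J\<^sub>1 * (H * (J\<^sub>2 * ?y))"
      by (rule assoc_mult_mat[OF x hJ mult_carrier_mat[OF Hc(1) Jy], symmetric])
    also have "hc ?x * hc J\<^sub>1 = hc (J\<^sub>1 * ?x)"
      by (rule hc_mult_carrier[OF J1(1) hw(8)[OF g], symmetric])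
    also have "(hc (J\<^sub>1 * ?x) * (H * (J\<^sub>2 * ?y))) $$ (0, 0) = ?t * D (hc g * h)"
      unfolding J1(2)[OF g] J2(2)[OF h] by (rule orbit_pairing[OF P1 w1 P2 w2 g h])
    also have "\<dots> = (?t / c) * (hc ?x * H\<^sub>1 * ?y) $$ (0, 0)"
      using form[OF g h] c by simp
    also have "\<dots> = ((?t / c) \<cdot>\<^sub>m (hc ?x * H\<^sub>1 * ?y)) $$ (0, 0)"
      by (rule smult_index_carrier[of _ 1 1, symmetric]) (use x Hc y in auto)
    also have "(?t / c) \<cdot>\<^sub>m (hc ?x * H\<^sub>1 * ?y) = hc ?x * ((?t / c) \<cdot>\<^sub>m H\<^sub>1) * ?y"
      using mult_smult_distrib[OF x Hc(2), of "?t / c"] mult_smult_assoc_mat[of "hc ?x * H\<^sub>1" 1 d ?y 1 "?t / c"] x Hc y by simp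
    finally show "(hc ?x * (hc J\<^sub>1 * H * J\<^sub>2) * ?y) $$ (0, 0) = (hc ?x * ((?t / c) \<cdot>\<^sub>m H\<^sub>1) * ?y) $$ (0, 0)" .
  next
    show "hc J\<^sub>1 * H * J\<^sub>2 \<in> carrier_mat d d"
      by (rule mult_carrier_mat[OF mult_carrier_mat[OF hJ Hc(1)] J2(1)])
    show "(?t / c) \<cdot>\<^sub>m H\<^sub>1 \<in> carrier_mat d d" using Hc(2) by simp
  qed
  moreover have "H\<^sub>1 * (L * J\<^sub>2) = hc J\<^sub>1 * H * J\<^sub>2"
    using assoc_mult_mat[OF Hc(2) L(1) J2(1)] L(2) by simp
  moreover have "H\<^sub>1 * ((?t / c) \<cdot>\<^sub>m 1\<^sub>m d) = (?t / c) \<cdot>\<^sub>m H\<^sub>1"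
    using mult_smult_distrib[OF Hc(2) one_carrier_mat, of "?t / c"] Hc(2) by simp
  ultimately have "H\<^sub>1 * (L * J\<^sub>2) = H\<^sub>1 * ((?t / c) \<cdot>\<^sub>m 1\<^sub>m d)" by metis
  then show ?thesis
    by (rule mult_left_cancel_det[OF Hc(2) det1 mult_carrier_mat[OF L(1) J2(1)] smult_carrier_mat[OF one_carrier_mat]])
qed

end

text \<open>In the basis obtained by completing \<open>J\<close> and \<open>L\<close>, equivariance
  of \<open>L\<close> clears the upper right block and equivariance of \<open>J\<close> the lower
  left one. The remaining diagonal block is then multiplicative and provides the complement.\<close>

lemma split_off_subrepresentation:
  assumes \<tau>: "representation n K \<tau>" and \<sigma>: "\<And>g. g \<in> SL n \<Longrightarrow> \<sigma> g \<in> carrier_mat s s"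
    and J: "J \<in> carrier_mat K s" and L: "L \<in> carrier_mat s K" and LJ: "L * J = 1\<^sub>m s"
    and Ji: "\<And>g. g \<in> SL n \<Longrightarrow> J * \<sigma> g = \<tau> g * J" and Li: "\<And>g. g \<in> SL n \<Longrightarrow> L * \<tau> g = \<sigma> g * L"
  shows "\<exists>c \<tau>' P Q. representation n c \<tau>' \<and> (\<forall>g\<in>SL n. similar_mat_wit (\<tau> g)
      (four_block_mat (\<sigma> g) (0\<^sub>m s c) (0\<^sub>m c s) (\<tau>' g)) P Q)"
proof -
  note tc = representation_carrier[OF \<tau>]
  obtain P Q where sK: "s \<le> K" and P: "P \<in> carrier_mat K K" and Q: "Q \<in> carrier_mat K K" and QP: "Q * P = 1\<^sub>m K"
    and PJ: "\<And>i j. i < K \<Longrightarrow> j < s \<Longrightarrow> P $$ (i, j) = J $$ (i, j)" and QL: "\<And>i j. i < K \<Longrightarrow> j < s \<Longrightarrow> Q $$ (j, i) = L $$ (j, i)"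
    using extend_to_inverse_pair[OF J L LJ] by blast
  have PQ: "P * Q = 1\<^sub>m K" by (rule mat_mult_left_right_inverse[OF Q P QP])
  define c where "c = K - s"
  have K: "K = s + c" using sK by (simp add: c_def)
  define M where "M g = Q * (\<tau> g * P)" for g
  have M: "M g \<in> carrier_mat K K" if "g \<in> SL n" for g using Q P tc[OF that] by (simp add: M_def)
  define \<tau>' where "\<tau>' g = mat c c (\<lambda>(i, j). M g $$ (s + i, s + j))" for g
  have tc': "\<tau>' g \<in> carrier_mat c c" for g by (simp add: \<tau>'_def)
  have LP: "(L * P) $$ (r, j) = (if r = j then 1 else 0)" if "r < s" "j < K" for r j
  proof -
    have "(L * P) $$ (r, j) = (Q * P) $$ (r, j)"
      by (rule mult_index_cong[of _ s K _ K _ K _ K]) (use L Q P that sK QL in auto)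
    then show ?thesis using QP that sK by simp
  qed
  have QJ: "(Q * J) $$ (i, r) = (if i = r then 1 else 0)" if "i < K" "r < s" for r i
  proof -
    have "(Q * J) $$ (i, r) = (Q * P) $$ (i, r)"
      by (rule mult_index_cong[of _ K K _ K _ s _ K]) (use J Q P that sK PJ in auto)
    then show ?thesis using QP that sK by simp
  qed
  have block: "M g = four_block_mat (\<sigma> g) (0\<^sub>m s c) (0\<^sub>m c s) (\<tau>' g)" if g: "g \<in> SL n" for g
  proof (intro eq_matI)
    fix i j assume "i < dim_row (four_block_mat (\<sigma> g) (0\<^sub>m s c) (0\<^sub>m c s) (\<tau>' g))"
      "j < dim_col (four_block_mat (\<sigma> g) (0\<^sub>m s c) (0\<^sub>m c s) (\<tau>' g))"
    then have ij: "i < K" "j < K" using \<sigma>[OF g] tc' K by (auto simp: \<tau>'_def)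
    \<comment> \<open>The first \<open>s\<close> rows of \<open>Q\<close> are those of
      \<open>L\<close>, so here \<open>\<tau> g\<close> can be moved past \<open>L\<close>.\<close>
    have top: "M g $$ (i, j) = (\<sigma> g * (L * P)) $$ (i, j)" if i: "i < s"
    proof -
      have "M g $$ (i, j) = (L * (\<tau> g * P)) $$ (i, j)"
        unfolding M_def by (rule mult_index_cong[of _ K K _ s _ K _ K]) (use L Q P tc[OF g] ij i QL in auto)
      also have "L * (\<tau> g * P) = \<sigma> g * (L * P)"
        using assoc_mult_mat[OF L tc[OF g] P] assoc_mult_mat[OF \<sigma>[OF g] L P] Li[OF g] by simp
      finally show ?thesis .
    qed
    consider (tl) "i < s" "j < s" | (tr) "i < s" "s \<le> j" | (bl) "s \<le> i" "j < s" | (br) "s \<le> i" "s \<le> j" by linarith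
    then show "M g $$ (i, j) = four_block_mat (\<sigma> g) (0\<^sub>m s c) (0\<^sub>m c s) (\<tau>' g) $$ (i, j)"
    proof cases
      case tl
      have "(\<sigma> g * (L * P)) $$ (i, j) = (\<sigma> g * 1\<^sub>m s) $$ (i, j)"
        by (rule mult_index_cong[of _ s s _ s _ K _ s])
          (use \<sigma>[OF g] L P tl ij LP in \<open>auto simp del: index_mult_mat(1)\<close>)
      then show ?thesis using top[OF tl(1)] tl ij \<sigma>[OF g] tc'[of g] K by simp
    next
      case tr
      have "(\<sigma> g * (L * P)) $$ (i, j) = (\<sigma> g * 0\<^sub>m s 1) $$ (i, 0)"
        by (rule mult_index_cong[of _ s s _ s _ K _ 1])
          (use \<sigma>[OF g] L P tr ij LP in \<open>auto simp del: index_mult_mat(1)\<close>)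
      then show ?thesis using top[OF tr(1)] tr ij \<sigma>[OF g] tc'[of g] K by simp
    next
      case bl
      have "M g $$ (i, j) = (Q * (\<tau> g * J)) $$ (i, j)"
        unfolding M_def
      proof (rule mult_index_cong[of _ K K _ K _ K _ s])
        fix r assume r: "r < K"
        show "(\<tau> g * P) $$ (r, j) = (\<tau> g * J) $$ (r, j)"
          by (rule mult_index_cong[of _ K K _ K _ K _ s]) (use tc[OF g] P J r ij bl PJ in auto)
      qed (use Q tc[OF g] P J ij bl in auto)
      also have "Q * (\<tau> g * J) = Q * J * \<sigma> g"
        using assoc_mult_mat[OF Q J \<sigma>[OF g]] Ji[OF g] by simp
      also have "(Q * J * \<sigma> g) $$ (i, j) = (0\<^sub>m 1 s * \<sigma> g) $$ (0, j)"
        by (rule mult_index_cong[of _ K s _ 1 _ s _ s])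
          (use \<sigma>[OF g] Q J bl ij QJ in \<open>auto simp del: index_mult_mat(1)\<close>)
      finally show ?thesis using bl ij \<sigma>[OF g] tc'[of g] K by simp
    next
      case br
      then show ?thesis using ij \<sigma>[OF g] tc'[of g] K by (simp add: \<tau>'_def)
    qed
  qed (use M[OF g] \<sigma>[OF g] tc'[of g] K in auto)
  have Mmult: "M (g * h) = M g * M h" if g: "g \<in> SL n" and h: "h \<in> SL n" for g h
  proof -
    have th: "\<tau> h * P \<in> carrier_mat K K" using tc[OF h] P by simp
    have "M g * M h = Q * (\<tau> g * P * (Q * (\<tau> h * P)))"
      unfolding M_def using assoc_mult_mat[OF Q, of "\<tau> g * P" K "Q * (\<tau> h * P)" K] tc[OF g] P Q th by simp
    also have "\<tau> g * P * (Q * (\<tau> h * P)) = \<tau> g * (P * Q * (\<tau> h * P))"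
      using assoc_mult_mat[OF tc[OF g] P, of "Q * (\<tau> h * P)" K] assoc_mult_mat[OF P Q th] Q th by simp
    also have "\<dots> = \<tau> g * (\<tau> h * P)" unfolding PQ left_mult_one_mat[OF th] ..
    also have "\<dots> = \<tau> (g * h) * P" by (rule representation_mult_left[OF \<tau> g h P])
    finally show ?thesis by (simp add: M_def)
  qed
  have "representation n c \<tau>'"
    unfolding representation_def
  proof (intro conjI ballI allI impI)
    show "\<tau>' g \<in> carrier_mat c c" for g by (rule tc')
    have "M (1\<^sub>m (Suc n)) = 1\<^sub>m K"
      unfolding M_def representation_one[OF \<tau>] using QP P by simp
    then show "\<tau>' (1\<^sub>m (Suc n)) = 1\<^sub>m c"
      using K by (intro eq_matI) (auto simp: \<tau>'_def)
  next
    fix g h assume g: "g \<in> SL n" and h: "h \<in> SL n"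
    have "M g * M h = four_block_mat (\<sigma> g * \<sigma> h + 0\<^sub>m s c * 0\<^sub>m c s) (\<sigma> g * 0\<^sub>m s c + 0\<^sub>m s c * \<tau>' h)
        (0\<^sub>m c s * \<sigma> h + \<tau>' g * 0\<^sub>m c s) (0\<^sub>m c s * 0\<^sub>m s c + \<tau>' g * \<tau>' h)"
      unfolding block[OF g] block[OF h]
      by (rule mult_four_block_mat) (use \<sigma>[OF g] \<sigma>[OF h] tc' in auto)
    also have "0\<^sub>m c s * 0\<^sub>m s c + \<tau>' g * \<tau>' h = \<tau>' g * \<tau>' h"
      using tc'[of g] tc'[of h] by simp
    finally have eq: "M (g * h) = four_block_mat (\<sigma> g * \<sigma> h + 0\<^sub>m s c * 0\<^sub>m c s) (\<sigma> g * 0\<^sub>m s c + 0\<^sub>m s c * \<tau>' h)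
        (0\<^sub>m c s * \<sigma> h + \<tau>' g * 0\<^sub>m c s) (\<tau>' g * \<tau>' h)" using Mmult[OF g h] by simp
    show "\<tau>' (g * h) = \<tau>' g * \<tau>' h"
    proof (intro eq_matI)
      fix i j assume "i < dim_row (\<tau>' g * \<tau>' h)" "j < dim_col (\<tau>' g * \<tau>' h)"
      then have ij: "i < c" "j < c" using tc'[of g] tc'[of h] by auto
      have "\<tau>' (g * h) $$ (i, j) = M (g * h) $$ (s + i, s + j)" using ij by (simp add: \<tau>'_def)
      also have "\<dots> = (\<tau>' g * \<tau>' h) $$ (i, j)"
        unfolding eq using ij \<sigma>[OF g] \<sigma>[OF h] tc'[of g] tc'[of h]
        by (subst index_mat_four_block(1)) (auto simp del: index_mult_mat(1))
      finally show "\<tau>' (g * h) $$ (i, j) = (\<tau>' g * \<tau>' h) $$ (i, j)" .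
    qed (use tc'[of g] tc'[of h] tc'[of "g * h"] in auto)
  next
    fix i j assume "i < c" "j < c"
    then obtain p where "polynomial_fun n p" "\<forall>g\<in>SL n. (Q * (\<tau> g * P)) $$ (s + i, s + j) = p g"
      using polynomial_fun_matrix_coefficient[OF \<tau> Q P, of "s + i" "s + j"] K by auto
    then show "\<exists>p. polynomial_fun n p \<and> (\<forall>g\<in>SL n. \<tau>' g $$ (i, j) = p g)"
      using \<open>i < c\<close> \<open>j < c\<close> by (intro exI[of _ p]) (auto simp: \<tau>'_def M_def)
  qed
  moreover have "similar_mat_wit (\<tau> g) (four_block_mat (\<sigma> g) (0\<^sub>m s c) (0\<^sub>m c s) (\<tau>' g)) P Q" if g: "g \<in> SL n" for g
  proof (rule similar_mat_witI[OF PQ QP])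
    have tP: "\<tau> g * P \<in> carrier_mat K K" using tc[OF g] P by simp
    have "P * M g = P * Q * (\<tau> g * P)" unfolding M_def by (rule assoc_mult_mat[OF P Q tP, symmetric])
    also have "\<dots> = \<tau> g * P" unfolding PQ by (rule left_mult_one_mat[OF tP])
    finally have "P * M g * Q = \<tau> g * P * Q" by simp
    also have "\<dots> = \<tau> g * (P * Q)" by (rule assoc_mult_mat[OF tc[OF g] P Q])
    also have "\<dots> = \<tau> g" unfolding PQ by (rule right_mult_one_mat[OF tc[OF g]])
    finally show "\<tau> g = P * four_block_mat (\<sigma> g) (0\<^sub>m s c) (0\<^sub>m c s) (\<tau>' g) * Q" using block[OF g] by simp
  qed (use tc[OF g] P Q M[OF g] block[OF g] in auto)
  ultimately show ?thesis by blast
qed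

text \<open>\<open>Max\<close> bounds its elements only for a finite set. A decomposition with
  \<open>m\<close> copies satisfies \<open>m * d + c' = K\<close>, so \<open>0 < d\<close> gives
  \<open>m \<le> K\<close>.\<close>

lemma multiplicity_ge:
  assumes \<tau>: "representation n K \<tau>" and \<sigma>: "representation n d \<sigma>" and d: "0 < d"
    and \<tau>': "representation n c \<tau>'"
    and iso: "isomorphic_reps n \<tau> (\<lambda>g. diag_block_mat (replicate k (\<sigma> g) @ [\<tau>' g]))"
  shows "k \<le> multiplicity_in n \<sigma> \<tau>"
proof -
  define S where "S = {k. \<exists>c \<tau>'. representation n c \<tau>' \<and>
    isomorphic_reps n \<tau> (\<lambda>g. diag_block_mat (replicate k (\<sigma> g) @ [\<tau>' g]))}"
  have "m \<le> K" if "m \<in> S" for m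
  proof -
    obtain c' \<tau>'' where c': "representation n c' \<tau>''"
      and i: "isomorphic_reps n \<tau> (\<lambda>g. diag_block_mat (replicate m (\<sigma> g) @ [\<tau>'' g]))"
      using \<open>m \<in> S\<close> unfolding S_def by blast
    let ?g = "1\<^sub>m (Suc n)"
    let ?B = "diag_block_mat (replicate m (\<sigma> ?g) @ [\<tau>'' ?g])"
    obtain P Q where w: "similar_mat_wit (\<tau> ?g) ?B P Q"
      using i SL_one unfolding isomorphic_reps_def by blast
    have "dim_row ?B = K"
      using similar_mat_witD2(5)[OF representation_carrier[OF \<tau> SL_one] w] by auto
    moreover have "dim_row ?B = m * d + c'"
      using representation_carrier[OF \<sigma> SL_one] representation_carrier[OF c' SL_one]
      by (simp add: dim_diag_block_mat sum_list_replicate)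
    ultimately show ?thesis using d by (metis le_add1 le_trans mult.commute mult_le_mono2 mult_1_right Suc_leI One_nat_def)
  qed
  then have "finite S" by (meson finite_nat_set_iff_bounded_le)
  moreover have "k \<in> S" using \<tau>' iso by (auto simp: S_def)
  ultimately show ?thesis unfolding multiplicity_in_def S_def[symmetric] by (rule Max_ge)
qed

section \<open>Covariants built from Pluecker relations\<close>

text \<open>Sums of products of a section in \<open>g\<close> and a section in \<open>h\<close>: a
  class of functions closed under multiplication, each of which comes from a covector on a tensor
  product by \<open>bisection_functional\<close>.\<close>

inductive bisection :: "nat \<Rightarrow> (complex mat \<Rightarrow> complex) \<Rightarrow> (complex mat \<Rightarrow> complex) \<Rightarrow>
    (complex mat \<Rightarrow> complex mat \<Rightarrow> complex) \<Rightarrow> bool" for n F G where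
  base: "flag_section n F f \<Longrightarrow> flag_section n G k \<Longrightarrow> bisection n F G (\<lambda>g h. c * (f g * k h))"
| add: "bisection n F G Q \<Longrightarrow> bisection n F G Q' \<Longrightarrow> bisection n F G (\<lambda>g h. Q g h + Q' g h)"

lemma bisection_swap: "bisection n F G Q \<Longrightarrow> bisection n G F (\<lambda>g h. Q h g)"
proof (induction rule: bisection.induct)
  case (base f k c)
  then show ?case using bisection.base[OF base(2,1), of c] by (simp add: mult.commute)
qed (rule bisection.add)

lemma bisection_mult:
  assumes "bisection n F G Q" "bisection n F' G' Q'"
  shows "bisection n (\<lambda>g. F g * F' g) (\<lambda>g. G g * G' g) (\<lambda>g h. Q g h * Q' g h)"
  using assms(1)
proof (induction rule: bisection.induct)
  case (base f k c)
  note fk = base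
  show ?case using assms(2)
  proof (induction rule: bisection.induct)
    case (base f' k' c')
    have "bisection n (\<lambda>g. F g * F' g) (\<lambda>g. G g * G' g) (\<lambda>g h. (c * c') * ((f g * f' g) * (k h * k' h)))"
      by (rule bisection.base[OF flag_section_mult[OF fk(1) base(1)] flag_section_mult[OF fk(2) base(2)]])
    moreover have "(\<lambda>g h. (c * c') * ((f g * f' g) * (k h * k' h))) = (\<lambda>g h. c * (f g * k h) * (c' * (f' g * k' h)))"
      by (intro ext) simp
    ultimately show ?case by simp
  next
    case (add Q Q')
    then show ?case using bisection.add[OF add.IH] by (simp add: distrib_left)
  qed
next
  case (add Q Q')
  then show ?case using bisection.add[OF add.IH] by (simp add: distrib_right)
qed

lemma bisection_power:
  assumes "bisection n F G Q"
  shows "bisection n (\<lambda>g. F g ^ N) (\<lambda>g. G g ^ N) (\<lambda>g h. Q g h ^ N)"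
proof (induction N)
  case 0
  show ?case using bisection.base[OF flag_section_one flag_section_one, of n 1] by simp
next
  case (Suc N)
  show ?case using bisection_mult[OF assms Suc] by simp
qed

lemma bisection_sum:
  assumes "\<And>s. s \<le> (m :: nat) \<Longrightarrow> bisection n F G (Q s)"
  shows "bisection n F G (\<lambda>g h. \<Sum>s\<le>m. Q s g h)"
  using assms
proof (induction m)
  case (Suc m)
  then show ?case using bisection.add[of n F G _ "Q (Suc m)"] by simp
qed simp

text \<open>A product of two sections is represented by the Kronecker product of their covectors, a
  sum by the sum.\<close>

lemma bisection_functional:
  assumes r: "hw_data n d \<rho> F V \<phi>" and s: "hw_data n e \<sigma> G V' \<phi>'" and Q: "bisection n F G Q"
  shows "\<exists>\<Psi>\<in>carrier_mat 1 (d * e). \<forall>g\<in>SL n. \<forall>h\<in>SL n. (\<Psi> * kronecker (\<rho> g * V) (\<sigma> h * V')) $$ (0, 0) = Q g h"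
  using Q
proof (induction rule: bisection.induct)
  case (base f k c)
  obtain \<xi> where x: "\<xi> \<in> carrier_mat 1 d" "\<And>g. g \<in> SL n \<Longrightarrow> (\<xi> * (\<rho> g * V)) $$ (0, 0) = f g"
    using hw_functional_of_section[OF r base(1)] by blast
  obtain \<zeta> where z: "\<zeta> \<in> carrier_mat 1 e" "\<And>g. g \<in> SL n \<Longrightarrow> (\<zeta> * (\<sigma> g * V')) $$ (0, 0) = k g"
    using hw_functional_of_section[OF s base(2)] by blast
  have kc: "kronecker \<xi> \<zeta> \<in> carrier_mat 1 (d * e)" using kronecker_carrier[OF x(1) z(1)] by simp
  show ?case
  proof (intro bexI[of _ "c \<cdot>\<^sub>m kronecker \<xi> \<zeta>"] ballI)
    fix g h assume g: "g \<in> SL n" and h: "h \<in> SL n"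
    note vg = hw_dataD(8)[OF r g] and vh = hw_dataD(8)[OF s h]
    let ?X = "\<xi> * (\<rho> g * V)" and ?Y = "\<zeta> * (\<sigma> h * V')"
    have c1: "?X \<in> carrier_mat 1 1" "?Y \<in> carrier_mat 1 1"
      by (rule mult_carrier_mat[OF x(1) vg] mult_carrier_mat[OF z(1) vh])+
    have vv: "kronecker (\<rho> g * V) (\<sigma> h * V') \<in> carrier_mat (d * e) 1" using kronecker_carrier[OF vg vh] by simp
    have "(c \<cdot>\<^sub>m kronecker \<xi> \<zeta>) * kronecker (\<rho> g * V) (\<sigma> h * V') =
        c \<cdot>\<^sub>m (kronecker \<xi> \<zeta> * kronecker (\<rho> g * V) (\<sigma> h * V'))"
      by (rule mult_smult_assoc_mat[OF kc vv])
    also have "kronecker \<xi> \<zeta> * kronecker (\<rho> g * V) (\<sigma> h * V') = kronecker ?X ?Y"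
      by (rule kronecker_mult) (use x(1) z(1) vg vh in \<open>simp_all only: carrier_matD\<close>)
    also have "(c \<cdot>\<^sub>m kronecker ?X ?Y) $$ (0, 0) = c * kronecker ?X ?Y $$ (0, 0)"
      using kronecker_carrier[OF c1] by (intro smult_index_carrier[of _ 1 1]) auto
    also have "kronecker ?X ?Y $$ (0, 0) = ?X $$ (0, 0) * ?Y $$ (0, 0)"
      by (subst kronecker_index) (simp_all only: carrier_matD[OF c1(1)] carrier_matD[OF c1(2)], simp_all)
    finally show "((c \<cdot>\<^sub>m kronecker \<xi> \<zeta>) * kronecker (\<rho> g * V) (\<sigma> h * V')) $$ (0, 0) = c * (f g * k h)"
      using x(2)[OF g] z(2)[OF h] by simp
  qed (use kc in simp)
next
  case (add Q Q')
  then obtain \<Psi> \<Psi>' where P: "\<Psi> \<in> carrier_mat 1 (d * e)" "\<Psi>' \<in> carrier_mat 1 (d * e)"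
    and eq: "\<And>g h. g \<in> SL n \<Longrightarrow> h \<in> SL n \<Longrightarrow> (\<Psi> * kronecker (\<rho> g * V) (\<sigma> h * V')) $$ (0, 0) = Q g h"
    "\<And>g h. g \<in> SL n \<Longrightarrow> h \<in> SL n \<Longrightarrow> (\<Psi>' * kronecker (\<rho> g * V) (\<sigma> h * V')) $$ (0, 0) = Q' g h"
    by blast
  show ?case
  proof (intro bexI[of _ "\<Psi> + \<Psi>'"] ballI)
    fix g h assume g: "g \<in> SL n" and h: "h \<in> SL n"
    let ?v = "kronecker (\<rho> g * V) (\<sigma> h * V')"
    have v: "?v \<in> carrier_mat (d * e) 1"
      using kronecker_carrier[OF hw_dataD(8)[OF r g] hw_dataD(8)[OF s h]] by simp
    have "(\<Psi> + \<Psi>') * ?v = \<Psi> * ?v + \<Psi>' * ?v" by (rule add_mult_distrib_mat[OF P v])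
    also have "\<dots> $$ (0, 0) = (\<Psi> * ?v) $$ (0, 0) + (\<Psi>' * ?v) $$ (0, 0)"
      by (rule add_index_carrier[OF mult_carrier_mat[OF P(1) v] mult_carrier_mat[OF P(2) v]]) simp_all
    finally show "((\<Psi> + \<Psi>') * ?v) $$ (0, 0) = Q g h + Q' g h" using eq[OF g h] by simp
  qed (use P in simp)
qed

text \<open>The map \<open>\<lambda>a. if a < s then a else Suc a\<close> skips row
  \<open>s\<close>, so the cofactors are, up to sign, minors on the first \<open>j\<close> columns
  of \<open>h\<close>, which are sections.\<close>

lemma det_last_column:
  fixes h :: "'a :: comm_ring_1 mat"
  shows "det (mat (Suc j) (Suc j) (\<lambda>(s, b). if b < j then h $$ (s, b) else x s)) =
    (\<Sum>s\<le>j. x s * ((- 1) ^ (s + j) * minor j (\<lambda>a. if a < s then a else Suc a) h))"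
proof -
  let ?M = "mat (Suc j) (Suc j) (\<lambda>(s, b). if b < j then h $$ (s, b) else x s)"
  have "det ?M = (\<Sum>s<Suc j. ?M $$ (s, j) * cofactor ?M s j)"
    by (rule laplace_expansion_column) auto
  also have "\<dots> = (\<Sum>s\<le>j. x s * ((- 1) ^ (s + j) * minor j (\<lambda>a. if a < s then a else Suc a) h))"
    unfolding lessThan_Suc_atMost
  proof (rule sum.cong[OF refl])
    fix s assume "s \<in> {..j}"
    then have s: "s < Suc j" by simp
    have "mat_delete ?M s j = mat j j (\<lambda>(a, b). h $$ (if a < s then a else Suc a, b))"
      using s by (intro eq_matI) (auto simp: mat_delete_def)
    then show "?M $$ (s, j) * cofactor ?M s j = x s * ((- 1) ^ (s + j) * minor j (\<lambda>a. if a < s then a else Suc a) h)"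
      using s by (simp add: cofactor_def minor_def)
  qed
  finally show ?thesis .
qed

lemma det_last_row:
  fixes g :: "'a :: comm_ring_1 mat"
  shows "det (mat (Suc i) (Suc i) (\<lambda>(a, c). if a < i then g $$ (a, c) else y c)) =
    (\<Sum>c<Suc i. y c * ((- 1) ^ (i + c) * det (mat i i (\<lambda>(a, b). g $$ (a, if b < c then b else Suc b)))))"
proof -
  let ?M = "mat (Suc i) (Suc i) (\<lambda>(a, c). if a < i then g $$ (a, c) else y c)"
  have "det ?M = (\<Sum>c<Suc i. ?M $$ (i, c) * cofactor ?M i c)"
    by (rule laplace_expansion_row) auto
  also have "\<dots> = (\<Sum>c<Suc i. y c * ((- 1) ^ (i + c) * det (mat i i (\<lambda>(a, b). g $$ (a, if b < c then b else Suc b)))))"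
  proof (rule sum.cong[OF refl])
    fix c assume "c \<in> {..<Suc i}"
    then have c: "c < Suc i" by simp
    have "mat_delete ?M i c = mat i i (\<lambda>(a, b). g $$ (a, if b < c then b else Suc b))"
      using c by (intro eq_matI) (auto simp: mat_delete_def)
    then show "?M $$ (i, c) * cofactor ?M i c = y c * ((- 1) ^ (i + c) * det (mat i i (\<lambda>(a, b). g $$ (a, if b < c then b else Suc b))))"
      using c by (simp add: cofactor_def)
  qed
  finally show ?thesis .
qed

text \<open>As a function of \<open>s\<close> this is a combination of the first
  \<open>i + 1\<close> columns of \<open>g\<close>, whose coefficients are signed minors of rows
  \<open>0, ..., i - 1\<close>. So it transforms like a column of \<open>g\<close>, up to the factor
  \<open>leading_minor i b\<close>. For \<open>s < i\<close> it vanishes, a row being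
  repeated.\<close>

definition last_row_minor :: "nat \<Rightarrow> nat \<Rightarrow> 'a :: comm_ring_1 mat \<Rightarrow> 'a" where
  "last_row_minor i s g = minor (Suc i) (\<lambda>a. if a < i then a else s) g"

lemma last_row_minor_det:
  "last_row_minor i s g = det (mat (Suc i) (Suc i) (\<lambda>(a, c). if a < i then g $$ (a, c) else g $$ (s, c)))"
  unfolding last_row_minor_def minor_def by (rule arg_cong[where f = det]) (auto intro!: eq_matI)

text \<open>For \<open>g = h\<close> and \<open>i < j\<close> the last column is a combination of
  the others and the determinant vanishes, which is a Pluecker relation. With independent arguments
  it is a covariant of weight \<open>om_(i-1) + om_j\<close> inside the product of the sections for
  \<open>om_i\<close> and \<open>om_(j-1)\<close>.\<close>

definition plucker :: "nat \<Rightarrow> nat \<Rightarrow> 'a :: comm_ring_1 mat \<Rightarrow> 'a mat \<Rightarrow> 'a" where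
  "plucker i j g h = det (mat (Suc j) (Suc j) (\<lambda>(s, b). if b < j then h $$ (s, b) else last_row_minor i s g))"

lemma det_lower_triangular_prod:
  assumes "A \<in> carrier_mat k k" "\<And>a c. a < c \<Longrightarrow> c < k \<Longrightarrow> A $$ (a, c) = 0"
  shows "det A = (\<Prod>a<k. A $$ (a, a))"
proof -
  have "det A = prod_list (diag_mat A)" by (rule det_lower_triangular[OF assms(2,1)])
  then show ?thesis using assms(1) by (simp add: prod_list_diag_prod atLeast0LessThan)
qed

lemma det_upper_triangular_prod:
  assumes "A \<in> carrier_mat k k" "\<And>a c. c < a \<Longrightarrow> a < k \<Longrightarrow> A $$ (a, c) = 0"
  shows "det A = (\<Prod>a<k. A $$ (a, a))"
proof -
  have "det A = prod_list (diag_mat A)"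
    by (rule det_upper_triangular[OF _ assms(1)]) (use assms in \<open>auto simp: upper_triangular_def\<close>)
  then show ?thesis using assms(1) by (simp add: prod_list_diag_prod atLeast0LessThan)
qed

lemma last_row_minor_lower_mult:
  fixes b g :: "'a :: comm_ring_1 mat"
  assumes b: "b \<in> carrier_mat m m" "lower_triangular b" and g: "g \<in> carrier_mat m m" and i: "i < m" and s: "s < m"
  shows "last_row_minor i s (b * g) = leading_minor i b * (\<Sum>r<m. b $$ (s, r) * last_row_minor i r g)"
proof -
  \<comment> \<open>Only the first \<open>i\<close> rows are factored: \<open>X\<close> holds the
    leading block of \<open>b\<close>, while the last row of \<open>Y\<close> is row
    \<open>s\<close> of the product itself, to be expanded linearly in row \<open>s\<close> of
    \<open>b\<close>.\<close>
  define X where "X = mat (Suc i) (Suc i) (\<lambda>(a, r). if a < i \<and> r < i then b $$ (a, r) else if a = r then 1 else 0)"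
  define Y where "Y = mat (Suc i) (Suc i) (\<lambda>(a, c). if a < i then g $$ (a, c) else (b * g) $$ (s, c))"
  have X: "X \<in> carrier_mat (Suc i) (Suc i)" and Y: "Y \<in> carrier_mat (Suc i) (Suc i)" by (simp_all add: X_def Y_def)
  have low: "b $$ (a, r) = 0" if "a < r" "r < m" for a r
    using b that by (auto simp: lower_triangular_def)
  have "mat (Suc i) (Suc i) (\<lambda>(a, c). if a < i then (b * g) $$ (a, c) else (b * g) $$ (s, c)) = X * Y"
  proof (intro eq_matI)
    fix a c assume "a < dim_row (X * Y)" "c < dim_col (X * Y)"
    then have ac: "a < Suc i" "c < Suc i" using X Y by auto
    have XY: "(X * Y) $$ (a, c) = (\<Sum>r<Suc i. X $$ (a, r) * Y $$ (r, c))"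
      using X Y ac by (subst mat_mult_entry) auto
    show "mat (Suc i) (Suc i) (\<lambda>(a, c). if a < i then (b * g) $$ (a, c) else (b * g) $$ (s, c)) $$ (a, c) = (X * Y) $$ (a, c)"
    proof (cases "a < i")
      case True
      have "(X * Y) $$ (a, c) = (\<Sum>r<i. b $$ (a, r) * g $$ (r, c))"
        unfolding XY using True ac by (simp add: X_def Y_def)
      also have "\<dots> = (\<Sum>r<m. b $$ (a, r) * g $$ (r, c))"
        using i True low by (intro sum_lessThan_truncate[symmetric]) auto
      also have "\<dots> = (b * g) $$ (a, c)"
        using b g ac i True by (subst mat_mult_entry) auto
      finally show ?thesis using True ac by (simp del: index_mult_mat(1))
    next
      case False
      then have a: "a = i" using ac by simp
      have "(X * Y) $$ (a, c) = (\<Sum>r<Suc i. if r = i then Y $$ (i, c) else 0)"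
        unfolding XY using a ac by (intro sum.cong) (auto simp: X_def)
      also have "\<dots> = (b * g) $$ (s, c)"
        using ac by (subst sum.delta) (auto simp: Y_def simp del: index_mult_mat(1))
      finally show ?thesis using a ac by (simp del: index_mult_mat(1))
    qed
  qed (use X Y in auto)
  then have "last_row_minor i s (b * g) = det X * det Y"
    unfolding last_row_minor_det by (simp add: det_mult[OF X Y])
  also have "det X = leading_minor i b"
  proof -
    have "det X = (\<Prod>a<Suc i. X $$ (a, a))"
      by (rule det_lower_triangular_prod[OF X]) (use low i in \<open>auto simp: X_def\<close>)
    also have "\<dots> = (\<Prod>a<i. b $$ (a, a))" by (simp add: X_def)
    also have "\<dots> = (\<Prod>a<i. lead i b $$ (a, a))" by simp
    also have "\<dots> = leading_minor i b" unfolding leading_minor_def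
      by (rule det_lower_triangular_prod[symmetric, OF lead_carrier]) (use low i in auto)
    finally show ?thesis .
  qed
  also have "det Y = (\<Sum>r<m. b $$ (s, r) * last_row_minor i r g)"
  proof -
    let ?C = "\<lambda>c. (- 1) ^ (i + c) * det (mat i i (\<lambda>(a, b). g $$ (a, if b < c then b else Suc b)))"
    have "det Y = (\<Sum>c<Suc i. (b * g) $$ (s, c) * ?C c)" unfolding Y_def by (rule det_last_row)
    also have "\<dots> = (\<Sum>c<Suc i. \<Sum>r<m. b $$ (s, r) * (g $$ (r, c) * ?C c))"
    proof (rule sum.cong[OF refl])
      fix c assume "c \<in> {..<Suc i}"
      then have "(b * g) $$ (s, c) = (\<Sum>r<m. b $$ (s, r) * g $$ (r, c))"
        using b g i s by (subst mat_mult_entry) auto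
      then show "(b * g) $$ (s, c) * ?C c = (\<Sum>r<m. b $$ (s, r) * (g $$ (r, c) * ?C c))"
        by (simp only: sum_distrib_right mult.assoc)
    qed
    also have "\<dots> = (\<Sum>r<m. \<Sum>c<Suc i. b $$ (s, r) * (g $$ (r, c) * ?C c))" by (rule sum.swap)
    also have "\<dots> = (\<Sum>r<m. b $$ (s, r) * last_row_minor i r g)"
      unfolding last_row_minor_det det_last_row by (simp only: sum_distrib_left)
    finally show ?thesis .
  qed
  finally show ?thesis .
qed

text \<open>All columns, the bordering one included, get multiplied by the leading block of
  \<open>b\<close> of size \<open>j + 1\<close>; the extra factor of the bordering column comes out
  by linearity.\<close>

lemma plucker_lower_mult:
  fixes b g h :: "'a :: comm_ring_1 mat"
  assumes b: "b \<in> carrier_mat m m" "lower_triangular b" and g: "g \<in> carrier_mat m m" and h: "h \<in> carrier_mat m m"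
    and i: "i < m" and j: "j < m"
  shows "plucker i j (b * g) (b * h) = leading_minor i b * leading_minor (Suc j) b * plucker i j g h"
proof -
  define M where "M = mat (Suc j) (Suc j) (\<lambda>(s, c). if c < j then h $$ (s, c) else leading_minor i b * last_row_minor i s g)"
  have M: "M \<in> carrier_mat (Suc j) (Suc j)" by (simp add: M_def)
  have low: "b $$ (a, r) = 0" if "a < r" "r < m" for a r
    using b that by (auto simp: lower_triangular_def)
  have "mat (Suc j) (Suc j) (\<lambda>(s, c). if c < j then (b * h) $$ (s, c) else last_row_minor i s (b * g)) = lead (Suc j) b * M"
  proof (intro eq_matI)
    fix s c assume "s < dim_row (lead (Suc j) b * M)" "c < dim_col (lead (Suc j) b * M)"
    then have sc: "s < Suc j" "c < Suc j" using M by auto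
    have e: "(lead (Suc j) b * M) $$ (s, c) = (\<Sum>r<Suc j. b $$ (s, r) * M $$ (r, c))"
      using M sc by (subst mat_mult_entry) auto
    have tr: "(\<Sum>r<Suc j. b $$ (s, r) * x r) = (\<Sum>r<m. b $$ (s, r) * x r)" for x
      using j low sc by (intro sum_lessThan_truncate[symmetric]) auto
    show "mat (Suc j) (Suc j) (\<lambda>(s, c). if c < j then (b * h) $$ (s, c) else last_row_minor i s (b * g)) $$ (s, c) =
        (lead (Suc j) b * M) $$ (s, c)"
    proof (cases "c < j")
      case True
      have "(lead (Suc j) b * M) $$ (s, c) = (\<Sum>r<Suc j. b $$ (s, r) * h $$ (r, c))"
        unfolding e using True sc by (intro sum.cong) (auto simp: M_def)
      also have "\<dots> = (b * h) $$ (s, c)"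
        unfolding tr using b h sc j True by (subst mat_mult_entry) auto
      finally show ?thesis using True sc by (simp del: index_mult_mat(1))
    next
      case False
      have "(lead (Suc j) b * M) $$ (s, c) = (\<Sum>r<Suc j. b $$ (s, r) * (leading_minor i b * last_row_minor i r g))"
        unfolding e using False sc by (intro sum.cong) (auto simp: M_def)
      also have "\<dots> = leading_minor i b * (\<Sum>r<m. b $$ (s, r) * last_row_minor i r g)"
        unfolding tr by (simp add: sum_distrib_left ac_simps)
      also have "\<dots> = last_row_minor i s (b * g)"
        using last_row_minor_lower_mult[OF b g i, of s] sc j by simp
      finally show ?thesis using False sc by (simp del: index_mult_mat(1))
    qed
  qed (use M in auto)
  then have "plucker i j (b * g) (b * h) = leading_minor (Suc j) b * det M"
    unfolding plucker_def by (simp add: det_mult[OF lead_carrier M] leading_minor_def)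
  also have "det M = leading_minor i b * plucker i j g h"
    unfolding M_def plucker_def det_last_column sum_distrib_left by (simp add: ac_simps)
  finally show ?thesis by (simp add: ac_simps)
qed

lemma bisection_plucker:
  assumes "i < j" "j \<le> n"
  shows "bisection n (leading_minor (Suc i)) (leading_minor j) (plucker i j)"
proof -
  have "bisection n (leading_minor (Suc i)) (leading_minor j)
     (\<lambda>g h. \<Sum>s\<le>j. (- 1) ^ (s + j) * (last_row_minor i s g * minor j (\<lambda>a. if a < s then a else Suc a) h))"
  proof (rule bisection_sum, rule bisection.base)
    fix s assume s: "s \<le> j"
    show "flag_section n (leading_minor (Suc i)) (last_row_minor i s)"
      unfolding last_row_minor_def[abs_def] using assms s by (intro flag_section_minor) auto
    show "flag_section n (leading_minor j) (minor j (\<lambda>a. if a < s then a else Suc a))"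
      using assms s by (intro flag_section_minor) auto
  qed
  moreover have "plucker i j = (\<lambda>g h. \<Sum>s\<le>j. (- 1) ^ (s + j) *
      (last_row_minor i s g * minor j (\<lambda>a. if a < s then a else Suc a) h :: complex))"
    unfolding plucker_def[abs_def] det_last_column by (intro ext sum.cong) auto
  ultimately show ?thesis by simp
qed

lemma last_row_minor_lower_unit:
  fixes g :: "'a :: comm_ring_1 mat"
  assumes g: "g \<in> carrier_mat m m" "lower_triangular g" "\<And>a. a < m \<Longrightarrow> g $$ (a, a) = 1" and "i < m"
  shows "last_row_minor i s g = g $$ (s, i)"
proof -
  have low: "g $$ (a, r) = 0" if "a < r" "r < m" for a r
    using g that by (auto simp: lower_triangular_def)
  have "last_row_minor i s g = (\<Prod>a<Suc i. mat (Suc i) (Suc i) (\<lambda>(a, c). if a < i then g $$ (a, c) else g $$ (s, c)) $$ (a, a))"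
    unfolding last_row_minor_det by (rule det_lower_triangular_prod) (use low assms in auto)
  also have "\<dots> = g $$ (s, i)" using assms by simp
  finally show ?thesis .
qed

lemma plucker_one_right:
  assumes "j < m"
  shows "plucker i j g (1\<^sub>m m) = last_row_minor i j g"
proof -
  let ?M = "mat (Suc j) (Suc j) (\<lambda>(s, b). if b < j then 1\<^sub>m m $$ (s, b) else last_row_minor i s g)"
  have "plucker i j g (1\<^sub>m m) = (\<Prod>a<Suc j. ?M $$ (a, a))"
    unfolding plucker_def by (rule det_upper_triangular_prod) (use assms in auto)
  then show ?thesis using assms by simp
qed

lemma plucker_one_left:
  assumes "i < j" "j < m"
  shows "plucker i j (1\<^sub>m m) h = (- 1) ^ (i + j) * minor j (\<lambda>a. if a < i then a else Suc a) h"
proof -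
  have "last_row_minor i s (1\<^sub>m m) = (if s = i then 1 else 0 :: 'a)" if "s \<le> j" for s
    using that assms by (subst last_row_minor_lower_unit[of _ m]) (auto simp: lower_triangular_def)
  then have "plucker i j (1\<^sub>m m) h = (\<Sum>s\<le>j. if s = i then (- 1) ^ (i + j) * minor j (\<lambda>a. if a < i then a else Suc a) h else 0)"
    unfolding plucker_def det_last_column by (intro sum.cong) auto
  also have "\<dots> = (- 1) ^ (i + j) * minor j (\<lambda>a. if a < i then a else Suc a) h"
    using assms by (subst sum.delta) auto
  finally show ?thesis .
qed

lemma lower_unit_SL:
  assumes "g \<in> carrier_mat (Suc n) (Suc n)" "lower_triangular g" "\<And>a. a < Suc n \<Longrightarrow> g $$ (a, a) = 1"
  shows "g \<in> SL n"
  using leading_minor_lower_unit[OF assms, of "Suc n"] leading_minor_self[OF assms(1)] assms(1) by (simp add: SL_def)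

lemma flag_pow_split:
  assumes "i < n" "N \<le> e i"
  shows "flag_pow n e g = leading_minor (Suc i) g ^ N * flag_pow n (e(i := e i - N)) g"
proof -
  have "flag_pow n e g = leading_minor (Suc i) g ^ e i * (\<Prod>k\<in>{..<n} - {i}. leading_minor (Suc k) g ^ e k)"
    unfolding flag_pow_def using assms(1) by (subst prod.remove[of _ i]) auto
  moreover have "flag_pow n (e(i := e i - N)) g = leading_minor (Suc i) g ^ (e i - N) * (\<Prod>k\<in>{..<n} - {i}. leading_minor (Suc k) g ^ e k)"
    unfolding flag_pow_def using assms(1) by (subst prod.remove[of _ i]) auto
  moreover have "leading_minor (Suc i) g ^ e i = leading_minor (Suc i) g ^ N * leading_minor (Suc i) g ^ (e i - N)"
    using assms(2) by (simp flip: power_add)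
  ultimately show ?thesis by simp
qed

text \<open>The power of \<open>plucker\<close> uses up \<open>N\<close> copies of
  \<open>om_i\<close> in \<open>g\<close> and of \<open>om_(j-1)\<close> in \<open>h\<close>; the
  minor of size \<open>j\<close> carries the exponent index \<open>j - 1\<close>. The truncated
  subtractions are genuine when \<open>N \<le> d i\<close> and \<open>N \<le> e (j - 1)\<close>,
  which is what hypothesis (2) supplies.\<close>

definition plucker_section :: "nat \<Rightarrow> nat \<Rightarrow> nat \<Rightarrow> nat \<Rightarrow> (nat \<Rightarrow> nat) \<Rightarrow> (nat \<Rightarrow> nat) \<Rightarrow>
    complex mat \<Rightarrow> complex mat \<Rightarrow> complex" where
  "plucker_section n N i j d e g h = plucker i j g h ^ N *
     (flag_pow n (d(i := d i - N)) g * flag_pow n (e(j - 1 := e (j - 1) - N)) h)"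

lemma bisection_plucker_section:
  assumes "i < j" "j \<le> n" "N \<le> d i" "N \<le> e (j - 1)"
  shows "bisection n (flag_pow n d) (flag_pow n e) (plucker_section n N i j d e)"
proof -
  let ?d = "d(i := d i - N)" and ?e = "e(j - 1 := e (j - 1) - N)"
  have "flag_pow n d = (\<lambda>g. leading_minor (Suc i) g ^ N * flag_pow n ?d g)"
    using flag_pow_split[of i n N d] assms by (intro ext) auto
  moreover have "flag_pow n e = (\<lambda>g. leading_minor j g ^ N * flag_pow n ?e g)"
    using flag_pow_split[of "j - 1" n N e] assms by (intro ext) auto
  moreover have "bisection n (flag_pow n ?d) (flag_pow n ?e) (\<lambda>g h. 1 * (flag_pow n ?d g * flag_pow n ?e h))"
    by (rule bisection.base[OF flag_section_flag_pow flag_section_flag_pow])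
  then have "bisection n (\<lambda>g. leading_minor (Suc i) g ^ N * flag_pow n ?d g) (\<lambda>g. leading_minor j g ^ N * flag_pow n ?e g)
      (\<lambda>g h. plucker i j g h ^ N * (1 * (flag_pow n ?d g * flag_pow n ?e h)))"
    by (rule bisection_mult[OF bisection_power[OF bisection_plucker[OF assms(1,2)]]])
  ultimately show ?thesis by (simp add: plucker_section_def[abs_def])
qed

text \<open>The assumption on \<open>f\<close> says \<open>f = d + e - N * \<beta>\<close> in
  coordinates, with the negative terms moved across so that it is an identity of natural
  numbers.\<close>

lemma plucker_section_lower_mult:
  assumes ij: "i < j" "j \<le> n" and N: "N \<le> d i" "N \<le> e (j - 1)"
    and f: "\<And>k. k < n \<Longrightarrow> f k + (if k = i then N else 0) + (if Suc k = j then N else 0) =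
      d k + e k + (if Suc k = i then N else 0) + (if k = j then N else 0)"
    and b: "b \<in> SL n" "lower_triangular b" and g: "g \<in> SL n" and h: "h \<in> SL n"
  shows "plucker_section n N i j d e (b * g) (b * h) = flag_pow n f b * plucker_section n N i j d e g h"
proof -
  let ?d = "d(i := d i - N)" and ?e = "e(j - 1 := e (j - 1) - N)"
  \<comment> \<open>For \<open>i = 0\<close> the minor is empty and equals 1, in accordance with no
    \<open>k\<close> satisfying \<open>Suc k = 0\<close>.\<close>
  have 1: "leading_minor i b ^ N = (\<Prod>k<n. leading_minor (Suc k) b ^ (if Suc k = i then N else 0))"
  proof (cases i)
    case (Suc k)
    then have "(\<Prod>k<n. leading_minor (Suc k) b ^ (if Suc k = i then N else 0)) = (\<Prod>l<n. if l = k then leading_minor i b ^ N else 1)"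
      by (intro prod.cong) auto
    then show ?thesis using Suc ij by simp
  qed simp
  \<comment> \<open>For \<open>j = n\<close> the minor is the determinant and equals 1, in
    accordance with no \<open>k < n\<close> being equal to \<open>j\<close>.\<close>
  have 2: "leading_minor (Suc j) b ^ N = (\<Prod>k<n. leading_minor (Suc k) b ^ (if k = j then N else 0))"
  proof (cases "j = n")
    case True
    then show ?thesis using leading_minor_SL[OF b(1)] by simp
  next
    case False
    have "(\<Prod>k<n. leading_minor (Suc k) b ^ (if k = j then N else 0)) = (\<Prod>k<n. if k = j then leading_minor (Suc j) b ^ N else 1)"
      by (intro prod.cong) auto
    then show ?thesis using False ij by simp
  qed
  have "flag_pow n f b = (\<Prod>k<n. leading_minor (Suc k) b ^ ((if Suc k = i then N else 0) + (if k = j then N else 0) + ?d k + ?e k))"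
    unfolding flag_pow_def
  proof (rule prod.cong[OF refl])
    fix k assume "k \<in> {..<n}"
    then have "f k = (if Suc k = i then N else 0) + (if k = j then N else 0) + ?d k + ?e k"
      using f[of k] N ij by (auto split: if_splits)
    then show "leading_minor (Suc k) b ^ f k = leading_minor (Suc k) b ^ ((if Suc k = i then N else 0) + (if k = j then N else 0) + ?d k + ?e k)"
      by simp
  qed
  also have "\<dots> = leading_minor i b ^ N * leading_minor (Suc j) b ^ N * flag_pow n ?d b * flag_pow n ?e b"
    unfolding 1 2 flag_pow_def by (simp only: power_add prod.distrib)
  finally have "flag_pow n f b = leading_minor i b ^ N * leading_minor (Suc j) b ^ N * flag_pow n ?d b * flag_pow n ?e b" .
  moreover have "plucker i j (b * g) (b * h) = leading_minor i b * leading_minor (Suc j) b * plucker i j g h"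
    using SL_D(1)[OF b(1)] SL_D(1)[OF g] SL_D(1)[OF h] ij b(2) by (intro plucker_lower_mult[of _ "Suc n"]) auto
  ultimately show ?thesis
    unfolding plucker_section_def flag_pow_lower_mult[OF b(1) g b(2)] flag_pow_lower_mult[OF b(1) h b(2)]
    by (simp add: power_mult_distrib)
qed

text \<open>When a lower unitriangular \<open>g\<close> is paired with the identity, all leading
  minors are 1 and the two orders of the arguments become powers of two functions of
  \<open>g\<close> that can be compared: an entry, and up to sign the minor omitting row
  \<open>i\<close>.\<close>

lemma plucker_section_one_right:
  assumes ij: "i < j" "j \<le> n"
    and g: "g \<in> carrier_mat (Suc n) (Suc n)" "lower_triangular g" "\<And>a. a < Suc n \<Longrightarrow> g $$ (a, a) = 1"
  shows "plucker_section n N i j d e g (1\<^sub>m (Suc n)) = (g $$ (j, i)) ^ N"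
    and "plucker_section n N i j d e (1\<^sub>m (Suc n)) g =
      ((- 1) ^ (i + j) * minor j (\<lambda>a. if a < i then a else Suc a) g) ^ N"
proof -
  have f: "flag_pow n k g = 1" "flag_pow n k (1\<^sub>m (Suc n)) = 1" for k
    using flag_pow_lower_unit[OF lower_unit_SL[OF g] g(2,3)] flag_pow_lower_unit[OF SL_one, of n k]
    by (simp_all add: lower_triangular_def)
  show "plucker_section n N i j d e g (1\<^sub>m (Suc n)) = (g $$ (j, i)) ^ N"
    using ij plucker_one_right[of j "Suc n" i g] last_row_minor_lower_unit[OF g, of i j]
    by (simp add: plucker_section_def f)
  show "plucker_section n N i j d e (1\<^sub>m (Suc n)) g =
      ((- 1) ^ (i + j) * minor j (\<lambda>a. if a < i then a else Suc a) g) ^ N"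
    using ij plucker_one_left[of i j "Suc n" g] by (simp add: plucker_section_def f)
qed

lemma plucker_section_nonzero:
  assumes ij: "i < j" "j \<le> n"
  shows "\<exists>g\<in>SL n. plucker_section n N i j d e g (1\<^sub>m (Suc n)) \<noteq> 0"
proof -
  \<comment> \<open>The elementary matrix \<open>1 + E_ji\<close>, for which the entry that gives
    the value is 1.\<close>
  define g :: "complex mat" where
    "g = mat (Suc n) (Suc n) (\<lambda>(r, s). if r = s \<or> r = j \<and> s = i then 1 else 0)"
  have g: "g \<in> carrier_mat (Suc n) (Suc n)" "lower_triangular g" "\<And>a. a < Suc n \<Longrightarrow> g $$ (a, a) = 1"
    using ij by (auto simp: g_def lower_triangular_def)
  have "g $$ (j, i) = 1" using ij by (simp add: g_def)
  then show ?thesis using plucker_section_one_right(1)[OF ij g] lower_unit_SL[OF g] by (intro bexI[of _ g]) auto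
qed

text \<open>The witness has ones on the diagonal and, in columns \<open>i, ..., j - 1\<close>, also
  directly below it. As \<open>j > i + 1\<close>, its entry \<open>(j, i)\<close> is 0, and
  \<open>0 < N\<close> keeps the power 0. Deleting row \<open>i\<close> moves the subdiagonal ones
  onto the diagonal, so the minor is 1.\<close>

lemma plucker_section_separating:
  assumes ij: "Suc i < j" "j \<le> n" and N: "0 < N"
  shows "\<exists>g\<in>SL n. plucker_section n N i j d e g (1\<^sub>m (Suc n)) = 0 \<and>
    plucker_section n N i j d' e' (1\<^sub>m (Suc n)) g \<noteq> 0"
proof -
  define g :: "complex mat" where
    "g = mat (Suc n) (Suc n) (\<lambda>(r, s). if r = s \<or> r = Suc s \<and> i \<le> s \<and> s < j then 1 else 0)"
  have g: "g \<in> carrier_mat (Suc n) (Suc n)" "lower_triangular g" "\<And>a. a < Suc n \<Longrightarrow> g $$ (a, a) = 1"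
    using ij by (auto simp: g_def lower_triangular_def)
  have ij': "i < j" using ij by simp
  have "g $$ (j, i) = 0" using ij by (simp add: g_def)
  moreover have "minor j (\<lambda>a. if a < i then a else Suc a) g = 1"
  proof -
    let ?M = "mat j j (\<lambda>(a, c). g $$ (if a < i then a else Suc a, c))"
    have "minor j (\<lambda>a. if a < i then a else Suc a) g = (\<Prod>a<j. ?M $$ (a, a))"
      unfolding minor_def by (rule det_upper_triangular_prod) (use ij in \<open>auto simp: g_def\<close>)
    also have "\<dots> = 1" using ij by (intro prod.neutral) (auto simp: g_def)
    finally show ?thesis .
  qed
  ultimately show ?thesis
    using plucker_section_one_right[OF ij' ij(2) g] lower_unit_SL[OF g] N by (intro bexI[of _ g]) auto
qed

section \<open>The multiplicity bound\<close>

lemma tensor_functional_eq: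
  assumes r: "hw_data n d \<rho> D V \<phi>" and s: "hw_data n e \<sigma> D' V' \<phi>'"
    and X: "X \<in> carrier_mat 1 (d * e)" and Y: "Y \<in> carrier_mat 1 (d * e)"
    and eq: "\<And>g h. g \<in> SL n \<Longrightarrow> h \<in> SL n \<Longrightarrow>
      (X * kronecker (\<rho> g * V) (\<sigma> h * V')) $$ (0, 0) = (Y * kronecker (\<rho> g * V) (\<sigma> h * V')) $$ (0, 0)"
  shows "X = Y"
proof -
  have mc: "- Y \<in> carrier_mat 1 (d * e)" using Y by simp
  have c: "X + - Y \<in> carrier_mat 1 (d * e)" using mc by simp
  have "X + - Y = 0\<^sub>m 1 (d * e)"
  proof (rule tensor_separation[OF r s c])
    fix g h assume g: "g \<in> SL n" and h: "h \<in> SL n"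
    let ?v = "kronecker (\<rho> g * V) (\<sigma> h * V')"
    have v: "?v \<in> carrier_mat (d * e) 1"
      using kronecker_carrier[OF hw_dataD(8)[OF r g] hw_dataD(8)[OF s h]] by simp
    have m: "- Y * ?v = - (Y * ?v)" by (rule uminus_mult_left_mat) (use Y v in auto)
    have "((X + - Y) * ?v) $$ (0, 0) = (X * ?v) $$ (0, 0) + (- Y * ?v) $$ (0, 0)"
      unfolding add_mult_distrib_mat[OF X mc v]
      by (rule add_index_carrier[OF mult_carrier_mat[OF X v] mult_carrier_mat[OF mc v]]) simp_all
    also have "(- Y * ?v) $$ (0, 0) = - ((Y * ?v) $$ (0, 0))"
      unfolding m using mult_carrier_mat[OF Y v] by (subst index_uminus_mat(1)) auto
    finally show "((X + - Y) * ?v) $$ (0, 0) = 0" using eq[OF g h] by simp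
  qed
  have "X $$ (0, k) = Y $$ (0, k)" if k: "k < d * e" for k
  proof -
    have "(X + - Y) $$ (0, k) = X $$ (0, k) - Y $$ (0, k)" using X Y k by simp
    then show ?thesis using \<open>X + - Y = 0\<^sub>m 1 (d * e)\<close> k by simp
  qed
  then show ?thesis using X Y by (intro eq_matI) auto
qed

text \<open>On products of orbit vectors the tensor action is simultaneous left translation of
  \<open>g\<close> and \<open>h\<close>, and these products span.\<close>

lemma tensor_semi_invariant:
  assumes r: "hw_data n d \<rho> F V \<phi>" and s: "hw_data n e \<sigma> G V' \<phi>'"
    and P: "\<Psi> \<in> carrier_mat 1 (d * e)"
    and Q: "\<And>g h. g \<in> SL n \<Longrightarrow> h \<in> SL n \<Longrightarrow> (\<Psi> * kronecker (\<rho> g * V) (\<sigma> h * V')) $$ (0, 0) = Q g h"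
    and inv: "\<And>b g h. b \<in> SL n \<Longrightarrow> lower_triangular b \<Longrightarrow> g \<in> SL n \<Longrightarrow> h \<in> SL n \<Longrightarrow> Q (b * g) (b * h) = D b * Q g h"
  shows "semi_invariant n (tensor_rep \<rho> \<sigma>) D \<Psi>"
  unfolding semi_invariant_def
proof (intro ballI impI)
  fix b assume b: "b \<in> SL n" "lower_triangular b"
  note rep = hw_dataD(1)[OF r] hw_dataD(1)[OF s]
  have t: "tensor_rep \<rho> \<sigma> b \<in> carrier_mat (d * e) (d * e)" by (rule tensor_carrier[OF rep b(1)])
  show "\<Psi> * tensor_rep \<rho> \<sigma> b = D b \<cdot>\<^sub>m \<Psi>"
  proof (rule tensor_functional_eq[OF r s mult_carrier_mat[OF P t] smult_carrier_mat[OF P]])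
    fix g h assume g: "g \<in> SL n" and h: "h \<in> SL n"
    let ?v = "kronecker (\<rho> g * V) (\<sigma> h * V')"
    have v: "?v \<in> carrier_mat (d * e) 1"
      using kronecker_carrier[OF hw_dataD(8)[OF r g] hw_dataD(8)[OF s h]] by simp
    have "tensor_rep \<rho> \<sigma> b * ?v = kronecker (\<rho> b * (\<rho> g * V)) (\<sigma> b * (\<sigma> h * V'))"
      unfolding tensor_rep_def
      by (rule kronecker_mult)
        (use hw_dataD(7)[OF r b(1)] hw_dataD(7)[OF s b(1)] hw_dataD(8)[OF r g] hw_dataD(8)[OF s h] in
          \<open>simp_all only: carrier_matD\<close>)
    then have "\<Psi> * tensor_rep \<rho> \<sigma> b * ?v = \<Psi> * kronecker (\<rho> (b * g) * V) (\<sigma> (b * h) * V')"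
      using assoc_mult_mat[OF P t v] representation_mult_left[OF rep(1) b(1) g hw_dataD(2)[OF r]]
        representation_mult_left[OF rep(2) b(1) h hw_dataD(2)[OF s]] by simp
    then have "(\<Psi> * tensor_rep \<rho> \<sigma> b * ?v) $$ (0, 0) = D b * Q g h"
      using Q[OF SL_mult[OF b(1) g] SL_mult[OF b(1) h]] inv[OF b g h] by simp
    moreover have "((D b \<cdot>\<^sub>m \<Psi>) * ?v) $$ (0, 0) = D b * Q g h"
      unfolding mult_smult_assoc_mat[OF P v] Q[OF g h, symmetric]
      by (rule smult_index_carrier[OF mult_carrier_mat[OF P v]]) simp_all
    ultimately show "(\<Psi> * tensor_rep \<rho> \<sigma> b * ?v) $$ (0, 0) = ((D b \<cdot>\<^sub>m \<Psi>) * ?v) $$ (0, 0)" by simp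
  qed
qed

lemma gram_pos_solve:
  assumes H: "gram_pos K H" and P: "\<Psi> \<in> carrier_mat 1 K"
  obtains w where "w \<in> carrier_mat K 1" "H * w = hc \<Psi>"
proof -
  have d: "det H \<noteq> 0" using H by (simp add: gram_pos_def)
  have h: "hc \<Psi> \<in> carrier_mat K 1" using P by simp
  obtain M where M: "M \<in> carrier_mat K K" "H * M = 1\<^sub>m K"
    using inverse_exists_det[OF gram_pos_carrier[OF H] d] by blast
  have "H * (M * hc \<Psi>) = H * M * hc \<Psi>" by (rule assoc_mult_mat[OF gram_pos_carrier[OF H] M(1) h, symmetric])
  also have "\<dots> = hc \<Psi>" unfolding M(2) by (rule left_mult_one_mat[OF h])
  finally show thesis by (rule that[OF mult_carrier_mat[OF M(1) h]])
qed

text \<open>Since \<open>\<Psi> = hc w * H\<close>, the pairing is the squared norm of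
  \<open>w\<close>.\<close>

lemma gram_pos_pairing_nonzero:
  assumes H: "gram_pos K H" and P: "\<Psi> \<in> carrier_mat 1 K" "\<Psi> \<noteq> 0\<^sub>m 1 K"
    and w: "w \<in> carrier_mat K 1" "H * w = hc \<Psi>"
  shows "(\<Psi> * w) $$ (0, 0) \<noteq> 0"
proof
  assume 0: "(\<Psi> * w) $$ (0, 0) = 0"
  have Hc: "H \<in> carrier_mat K K" by (rule gram_pos_carrier[OF H])
  have wc: "hc w \<in> carrier_mat 1 K" using w by simp
  have "\<Psi> = hc w * H"
    using hc_mult_carrier[OF Hc w(1)] w(2) gram_pos_hc[OF H] by simp
  then have "hc w * (H * w) = \<Psi> * w" using assoc_mult_mat[OF wc Hc w(1)] by simp
  also have "\<dots> = 0\<^sub>m 1 1" by (rule mat_1x1_eqI[OF mult_carrier_mat[OF P(1) w(1)]]) (use 0 in auto)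
  finally have "w = 0\<^sub>m K 1" by (rule gram_pos_zero[OF H w(1)])
  then have "hc \<Psi> = 0\<^sub>m K 1" using w(2) right_mult_zero_mat[OF Hc, of 1] by simp
  then have "\<Psi> = hc (0\<^sub>m K 1)" by (metis hc_hc)
  also have "\<dots> = 0\<^sub>m 1 K" by (intro eq_matI) auto
  finally show False using P(2) by simp
qed

lemma smult_intertwiner:
  fixes L :: "complex mat"
  assumes L: "L \<in> carrier_mat d K" and t: "t \<in> carrier_mat K K" and s: "s \<in> carrier_mat d d" and i: "L * t = s * L"
  shows "(k \<cdot>\<^sub>m L) * t = s * (k \<cdot>\<^sub>m L)"
  using mult_smult_assoc_mat[OF L t, of k] mult_smult_distrib[OF s L, of k] i by simp

lemma multiplicity_ge_1:
  assumes \<tau>: "representation n K \<tau>" and H: "unitary_form n K \<tau> H"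
    and data: "hw_data n d \<rho> (flag_pow n e) V \<phi>" and d: "0 < d"
    and P: "\<Psi> \<in> carrier_mat 1 K" "semi_invariant n \<tau> (flag_pow n e) \<Psi>" "\<Psi> \<noteq> 0\<^sub>m 1 K"
  shows "1 \<le> multiplicity_in n \<rho> \<tau>"
proof -
  obtain fs where fs: "gramian n (flag_pow n e) fs"
    using flag_section_flag_pow[of n e] by (auto simp: flag_section_def)
  obtain H\<^sub>1 c where H1: "unitary_form n d \<rho> H\<^sub>1" and c: "c \<noteq> 0" and form: "\<And>g h. g \<in> SL n \<Longrightarrow> h \<in> SL n \<Longrightarrow>
      (hc (\<rho> g * V) * H\<^sub>1 * (\<rho> h * V)) $$ (0, 0) = c * flag_pow n e (hc g * h)"
    using hw_form_exists[OF data fs] by blast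
  have pos: "gram_pos K H" using H by (simp add: unitary_form_def)
  obtain w where w: "w \<in> carrier_mat K 1" "H * w = hc \<Psi>" using gram_pos_solve[OF pos P(1)] .
  let ?t = "(\<Psi> * w) $$ (0, 0) / c"
  have t: "?t \<noteq> 0" using gram_pos_pairing_nonzero[OF pos P(1,3) w] c by simp
  obtain J L where J: "J \<in> carrier_mat K d" "\<And>g. g \<in> SL n \<Longrightarrow> J * (\<rho> g * V) = \<tau> g * w"
    "\<And>g. g \<in> SL n \<Longrightarrow> J * \<rho> g = \<tau> g * J"
    and L: "L \<in> carrier_mat d K" "\<And>g. g \<in> SL n \<Longrightarrow> L * \<tau> g = \<rho> g * L" "H\<^sub>1 * L = hc J * H"
    using intertwiners_exist[OF \<tau> H data H1 c form P(1,2) w] by blast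
  have LJ: "L * J = ?t \<cdot>\<^sub>m 1\<^sub>m d"
    by (rule intertwiners_product[OF \<tau> H data H1 c form P(1,2) w P(1,2) w J(1,2) J(1,2) L(1,3)])
  \<comment> \<open>\<open>L * J\<close> is a nonzero scalar, so rescaling \<open>L\<close> gives a
    left inverse of \<open>J\<close>.\<close>
  have "(1 / ?t \<cdot>\<^sub>m L) * J = 1 / ?t \<cdot>\<^sub>m (?t \<cdot>\<^sub>m 1\<^sub>m d)"
    unfolding LJ[symmetric] by (rule mult_smult_assoc_mat[OF L(1) J(1)])
  also have "\<dots> = 1\<^sub>m d" using t by (intro eq_matI) auto
  finally have "(1 / ?t \<cdot>\<^sub>m L) * J = 1\<^sub>m d" .
  from split_off_subrepresentation[OF \<tau> hw_dataD(7)[OF data] J(1) smult_carrier_mat[OF L(1)] this J(3)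
      smult_intertwiner[OF L(1) representation_carrier[OF \<tau>] hw_dataD(7)[OF data] L(2)]]
  obtain m \<tau>' P Q where rep': "representation n m \<tau>'" and sim: "\<And>g. g \<in> SL n \<Longrightarrow> similar_mat_wit (\<tau> g)
      (four_block_mat (\<rho> g) (0\<^sub>m d m) (0\<^sub>m m d) (\<tau>' g)) P Q" by blast
  have "isomorphic_reps n \<tau> (\<lambda>g. diag_block_mat (replicate 1 (\<rho> g) @ [\<tau>' g]))"
    unfolding isomorphic_reps_def
  proof (intro exI ballI)
    fix g assume g: "g \<in> SL n"
    have "diag_block_mat (replicate 1 (\<rho> g) @ [\<tau>' g]) = four_block_mat (\<rho> g) (0\<^sub>m d m) (0\<^sub>m m d) (\<tau>' g)"
      using hw_dataD(7)[OF data g] representation_carrier[OF rep' g]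
      by (simp add: diag_block_mat.simps(2)[of "\<rho> g" "[\<tau>' g]"] One_nat_def Let_def del: diag_block_mat.simps)
    then show "similar_mat_wit (\<tau> g) (diag_block_mat (replicate 1 (\<rho> g) @ [\<tau>' g])) P Q" using sim[OF g] by simp
  qed
  then show ?thesis by (rule multiplicity_ge[OF \<tau> hw_dataD(1)[OF data] d rep'])
qed

lemma semi_invariant_diff:
  assumes \<tau>: "representation n K \<tau>" and P: "\<Psi>\<^sub>1 \<in> carrier_mat 1 K" "semi_invariant n \<tau> D \<Psi>\<^sub>1"
    "\<Psi>\<^sub>2 \<in> carrier_mat 1 K" "semi_invariant n \<tau> D \<Psi>\<^sub>2"
  shows "semi_invariant n \<tau> D (\<Psi>\<^sub>2 + k \<cdot>\<^sub>m \<Psi>\<^sub>1)"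
  unfolding semi_invariant_def
proof (intro ballI impI)
  fix b assume b: "b \<in> SL n" "lower_triangular b"
  note t = representation_carrier[OF \<tau> b(1)]
  have "(\<Psi>\<^sub>2 + k \<cdot>\<^sub>m \<Psi>\<^sub>1) * \<tau> b = \<Psi>\<^sub>2 * \<tau> b + (k \<cdot>\<^sub>m \<Psi>\<^sub>1) * \<tau> b"
    by (rule add_mult_distrib_mat[OF P(3) smult_carrier_mat[OF P(1)] t])
  also have "\<dots> = \<Psi>\<^sub>2 * \<tau> b + k \<cdot>\<^sub>m (\<Psi>\<^sub>1 * \<tau> b)"
    by (simp only: mult_smult_assoc_mat[OF P(1) t])
  also have "\<dots> = D b \<cdot>\<^sub>m \<Psi>\<^sub>2 + k \<cdot>\<^sub>m (D b \<cdot>\<^sub>m \<Psi>\<^sub>1)"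
    using P(2,4) b by (simp add: semi_invariant_def)
  also have "\<dots> = D b \<cdot>\<^sub>m (\<Psi>\<^sub>2 + k \<cdot>\<^sub>m \<Psi>\<^sub>1)"
    using P(1,3) by (intro eq_matI) (auto simp: algebra_simps)
  finally show "(\<Psi>\<^sub>2 + k \<cdot>\<^sub>m \<Psi>\<^sub>1) * \<tau> b = D b \<cdot>\<^sub>m (\<Psi>\<^sub>2 + k \<cdot>\<^sub>m \<Psi>\<^sub>1)" .
qed

text \<open>A Gram-Schmidt step makes \<open>\<Psi>\<^sub>2'\<close> orthogonal to
  \<open>\<Psi>\<^sub>1\<close> in the form that \<open>H\<close> induces on covectors, and
  \<open>indep\<close> keeps the result nonzero. Then the mixed products \<open>L1 * J2\<close> and
  \<open>L2 * J1\<close> vanish, and the two copies split off together as a retract of dimension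
  \<open>d + d\<close>.\<close>

lemma multiplicity_ge_2:
  assumes \<tau>: "representation n K \<tau>" and H: "unitary_form n K \<tau> H"
    and data: "hw_data n d \<rho> (flag_pow n e) V \<phi>" and d: "0 < d"
    and P1: "\<Psi>\<^sub>1 \<in> carrier_mat 1 K" "semi_invariant n \<tau> (flag_pow n e) \<Psi>\<^sub>1" "\<Psi>\<^sub>1 \<noteq> 0\<^sub>m 1 K"
    and P2': "\<Psi>\<^sub>2' \<in> carrier_mat 1 K" "semi_invariant n \<tau> (flag_pow n e) \<Psi>\<^sub>2'"
    and indep: "\<And>k. \<Psi>\<^sub>2' + k \<cdot>\<^sub>m \<Psi>\<^sub>1 \<noteq> 0\<^sub>m 1 K"
  shows "2 \<le> multiplicity_in n \<rho> \<tau>"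
proof -
  obtain fs where fs: "gramian n (flag_pow n e) fs"
    using flag_section_flag_pow[of n e] by (auto simp: flag_section_def)
  obtain H\<^sub>1 c where H1: "unitary_form n d \<rho> H\<^sub>1" and c: "c \<noteq> 0" and form: "\<And>g h. g \<in> SL n \<Longrightarrow> h \<in> SL n \<Longrightarrow>
      (hc (\<rho> g * V) * H\<^sub>1 * (\<rho> h * V)) $$ (0, 0) = c * flag_pow n e (hc g * h)"
    using hw_form_exists[OF data fs] by blast
  have pos: "gram_pos K H" using H by (simp add: unitary_form_def)
  have Hc: "H \<in> carrier_mat K K" by (rule gram_pos_carrier[OF pos])
  obtain w1 where w1: "w1 \<in> carrier_mat K 1" "H * w1 = hc \<Psi>\<^sub>1" using gram_pos_solve[OF pos P1(1)] .
  define k where "k = - (\<Psi>\<^sub>2' * w1) $$ (0, 0) / (\<Psi>\<^sub>1 * w1) $$ (0, 0)"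
  define \<Psi>\<^sub>2 where "\<Psi>\<^sub>2 = \<Psi>\<^sub>2' + k \<cdot>\<^sub>m \<Psi>\<^sub>1"
  have P2: "\<Psi>\<^sub>2 \<in> carrier_mat 1 K" "semi_invariant n \<tau> (flag_pow n e) \<Psi>\<^sub>2" "\<Psi>\<^sub>2 \<noteq> 0\<^sub>m 1 K"
    using P1(1) semi_invariant_diff[OF \<tau> P1(1,2) P2'] indep by (simp_all add: \<Psi>\<^sub>2_def)
  obtain w2 where w2: "w2 \<in> carrier_mat K 1" "H * w2 = hc \<Psi>\<^sub>2" using gram_pos_solve[OF pos P2(1)] .
  let ?t1 = "(\<Psi>\<^sub>1 * w1) $$ (0, 0) / c" and ?t2 = "(\<Psi>\<^sub>2 * w2) $$ (0, 0) / c"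
  have t: "?t1 \<noteq> 0" "?t2 \<noteq> 0"
    using gram_pos_pairing_nonzero[OF pos P1(1,3) w1] gram_pos_pairing_nonzero[OF pos P2(1,3) w2] c by simp_all
  have z21: "(\<Psi>\<^sub>2 * w1) $$ (0, 0) = 0"
  proof -
    have "\<Psi>\<^sub>2 * w1 = \<Psi>\<^sub>2' * w1 + (k \<cdot>\<^sub>m \<Psi>\<^sub>1) * w1"
      unfolding \<Psi>\<^sub>2_def by (rule add_mult_distrib_mat[OF P2'(1) smult_carrier_mat[OF P1(1)] w1(1)])
    also have "(k \<cdot>\<^sub>m \<Psi>\<^sub>1) * w1 = k \<cdot>\<^sub>m (\<Psi>\<^sub>1 * w1)" by (rule mult_smult_assoc_mat[OF P1(1) w1(1)])
    finally have "\<Psi>\<^sub>2 * w1 = \<Psi>\<^sub>2' * w1 + k \<cdot>\<^sub>m (\<Psi>\<^sub>1 * w1)" .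
    moreover have "(\<Psi>\<^sub>2' * w1 + k \<cdot>\<^sub>m (\<Psi>\<^sub>1 * w1)) $$ (0, 0) = (\<Psi>\<^sub>2' * w1) $$ (0, 0) + (k \<cdot>\<^sub>m (\<Psi>\<^sub>1 * w1)) $$ (0, 0)"
      by (rule add_index_carrier[OF mult_carrier_mat[OF P2'(1) w1(1)]
          smult_carrier_mat[OF mult_carrier_mat[OF P1(1) w1(1)]]]) simp_all
    moreover have "(k \<cdot>\<^sub>m (\<Psi>\<^sub>1 * w1)) $$ (0, 0) = k * (\<Psi>\<^sub>1 * w1) $$ (0, 0)"
      by (rule smult_index_carrier[OF mult_carrier_mat[OF P1(1) w1(1)]]) simp_all
    moreover have "(\<Psi>\<^sub>1 * w1) $$ (0, 0) \<noteq> 0" by (rule gram_pos_pairing_nonzero[OF pos P1(1,3) w1])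
    ultimately show ?thesis by (simp add: k_def)
  qed
  \<comment> \<open>The form is Hermitian, so this pairing is the conjugate of the one in
    \<open>z21\<close>.\<close>
  have z12: "(\<Psi>\<^sub>1 * w2) $$ (0, 0) = 0"
  proof -
    have hw1: "hc w1 \<in> carrier_mat 1 K" using w1 by simp
    have "\<Psi>\<^sub>1 = hc w1 * H"
      using hc_mult_carrier[OF Hc w1(1)] w1(2) gram_pos_hc[OF pos] by simp
    then have "\<Psi>\<^sub>1 * w2 = hc w1 * hc \<Psi>\<^sub>2" using assoc_mult_mat[OF hw1 Hc w2(1)] w2(2) by simp
    also have "\<dots> = hc (\<Psi>\<^sub>2 * w1)" by (rule hc_mult_carrier[OF P2(1) w1(1), symmetric])
    also have "\<dots> $$ (0, 0) = cnj ((\<Psi>\<^sub>2 * w1) $$ (0, 0))"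
      using mult_carrier_mat[OF P2(1) w1(1)] by (intro hc_index) auto
    finally show ?thesis using z21 by simp
  qed
  obtain J1 L1 where J1: "J1 \<in> carrier_mat K d" "\<And>g. g \<in> SL n \<Longrightarrow> J1 * (\<rho> g * V) = \<tau> g * w1"
    "\<And>g. g \<in> SL n \<Longrightarrow> J1 * \<rho> g = \<tau> g * J1"
    and L1: "L1 \<in> carrier_mat d K" "\<And>g. g \<in> SL n \<Longrightarrow> L1 * \<tau> g = \<rho> g * L1" "H\<^sub>1 * L1 = hc J1 * H"
    using intertwiners_exist[OF \<tau> H data H1 c form P1(1,2) w1] by blast
  obtain J2 L2 where J2: "J2 \<in> carrier_mat K d" "\<And>g. g \<in> SL n \<Longrightarrow> J2 * (\<rho> g * V) = \<tau> g * w2"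
    "\<And>g. g \<in> SL n \<Longrightarrow> J2 * \<rho> g = \<tau> g * J2"
    and L2: "L2 \<in> carrier_mat d K" "\<And>g. g \<in> SL n \<Longrightarrow> L2 * \<tau> g = \<rho> g * L2" "H\<^sub>1 * L2 = hc J2 * H"
    using intertwiners_exist[OF \<tau> H data H1 c form P2(1,2) w2] by blast
  have LJ: "L1 * J1 = ?t1 \<cdot>\<^sub>m 1\<^sub>m d"
    by (rule intertwiners_product[OF \<tau> H data H1 c form P1(1,2) w1 P1(1,2) w1 J1(1,2) J1(1,2) L1(1,3)])
  have LJ2: "L2 * J2 = ?t2 \<cdot>\<^sub>m 1\<^sub>m d"
    by (rule intertwiners_product[OF \<tau> H data H1 c form P2(1,2) w2 P2(1,2) w2 J2(1,2) J2(1,2) L2(1,3)])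
  have LJ3: "L1 * J2 = ((\<Psi>\<^sub>1 * w2) $$ (0, 0) / c) \<cdot>\<^sub>m 1\<^sub>m d"
    by (rule intertwiners_product[OF \<tau> H data H1 c form P1(1,2) w1 P2(1,2) w2 J1(1,2) J2(1,2) L1(1,3)])
  have LJ4: "L2 * J1 = ((\<Psi>\<^sub>2 * w1) $$ (0, 0) / c) \<cdot>\<^sub>m 1\<^sub>m d"
    by (rule intertwiners_product[OF \<tau> H data H1 c form P2(1,2) w2 P1(1,2) w1 J2(1,2) J1(1,2) L2(1,3)])
  define M1 where "M1 = 1 / ?t1 \<cdot>\<^sub>m L1"
  define M2 where "M2 = 1 / ?t2 \<cdot>\<^sub>m L2"
  have M: "M1 \<in> carrier_mat d K" "M2 \<in> carrier_mat d K" using L1 L2 by (simp_all add: M1_def M2_def)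
  have MJ: "M1 * J1 = 1\<^sub>m d" "M2 * J2 = 1\<^sub>m d" "M1 * J2 = 0\<^sub>m d d" "M2 * J1 = 0\<^sub>m d d"
    unfolding M1_def M2_def mult_smult_assoc_mat[OF L1(1) J1(1)] mult_smult_assoc_mat[OF L1(1) J2(1)]
      mult_smult_assoc_mat[OF L2(1) J1(1)] mult_smult_assoc_mat[OF L2(1) J2(1)]
      LJ LJ2 LJ3 LJ4 z12 z21
    using t by (auto intro!: eq_matI)
  have Mi: "M1 * \<tau> g = \<rho> g * M1" "M2 * \<tau> g = \<rho> g * M2" if g: "g \<in> SL n" for g
    unfolding M1_def M2_def
    by (rule smult_intertwiner[OF L1(1) representation_carrier[OF \<tau> g] hw_dataD(7)[OF data g] L1(2)[OF g]]
      smult_intertwiner[OF L2(1) representation_carrier[OF \<tau> g] hw_dataD(7)[OF data g] L2(2)[OF g]])+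
  \<comment> \<open>block matrices with an empty second row or column serve as horizontal and vertical concatenation\<close>
  define J where "J = four_block_mat J1 J2 (0\<^sub>m 0 d) (0\<^sub>m 0 d)"
  define L where "L = four_block_mat M1 (0\<^sub>m d 0) M2 (0\<^sub>m d 0)"
  define \<sigma> where "\<sigma> g = four_block_mat (\<rho> g) (0\<^sub>m d d) (0\<^sub>m d d) (\<rho> g)" for g
  have Jc: "J \<in> carrier_mat K (d + d)" and Lc: "L \<in> carrier_mat (d + d) K"
    using four_block_carrier_mat[OF J1(1), of "0\<^sub>m 0 d" 0 d J2 "0\<^sub>m 0 d"]
      four_block_carrier_mat[OF M(1), of "0\<^sub>m d 0" d 0 "0\<^sub>m d 0" M2] by (simp_all add: J_def L_def)
  have \<sigma>c: "\<sigma> g \<in> carrier_mat (d + d) (d + d)" if "g \<in> SL n" for g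
    using hw_dataD(7)[OF data that] by (simp add: \<sigma>_def)
  have LJ1: "L * J = 1\<^sub>m (d + d)"
  proof -
    have "L * J = four_block_mat (M1 * J1 + 0\<^sub>m d 0 * 0\<^sub>m 0 d) (M1 * J2 + 0\<^sub>m d 0 * 0\<^sub>m 0 d)
        (M2 * J1 + 0\<^sub>m d 0 * 0\<^sub>m 0 d) (M2 * J2 + 0\<^sub>m d 0 * 0\<^sub>m 0 d)"
      unfolding L_def J_def by (rule mult_four_block_mat) (use M J1 J2 in auto)
    then show ?thesis unfolding MJ by simp
  qed
  \<comment> \<open>A single matrix is given empty borders, so that its products with
    \<open>J\<close> and \<open>L\<close> follow the block multiplication rule.\<close>
  have t_block: "four_block_mat X (0\<^sub>m K 0) (0\<^sub>m 0 K) (0\<^sub>m 0 0) = X" if "X \<in> carrier_mat K K" for X :: "complex mat"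
    using that by (intro eq_matI) auto
  have Ji: "J * \<sigma> g = \<tau> g * J" if g: "g \<in> SL n" for g
  proof -
    note r = hw_dataD(7)[OF data g] and tg = representation_carrier[OF \<tau> g]
    have "J * \<sigma> g = four_block_mat (J1 * \<rho> g + J2 * 0\<^sub>m d d) (J1 * 0\<^sub>m d d + J2 * \<rho> g)
        (0\<^sub>m 0 d * \<rho> g + 0\<^sub>m 0 d * 0\<^sub>m d d) (0\<^sub>m 0 d * 0\<^sub>m d d + 0\<^sub>m 0 d * \<rho> g)"
      unfolding J_def \<sigma>_def by (rule mult_four_block_mat) (use r J1(1) J2(1) in auto)
    also have "\<dots> = four_block_mat (\<tau> g * J1) (\<tau> g * J2) (0\<^sub>m 0 d) (0\<^sub>m 0 d)"
      using r J1(1) J2(1) tg by (simp add: J1(3)[OF g] J2(3)[OF g])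
    also have "\<dots> = four_block_mat (\<tau> g * J1 + 0\<^sub>m K 0 * 0\<^sub>m 0 d) (\<tau> g * J2 + 0\<^sub>m K 0 * 0\<^sub>m 0 d)
        (0\<^sub>m 0 K * J1 + 0\<^sub>m 0 0 * 0\<^sub>m 0 d) (0\<^sub>m 0 K * J2 + 0\<^sub>m 0 0 * 0\<^sub>m 0 d)"
      using J1(1) J2(1) tg by simp
    also have "\<dots> = four_block_mat (\<tau> g) (0\<^sub>m K 0) (0\<^sub>m 0 K) (0\<^sub>m 0 0) * J"
      unfolding J_def by (rule mult_four_block_mat[symmetric]) (use tg J1(1) J2(1) in auto)
    finally show ?thesis unfolding t_block[OF tg] .
  qed
  have Li: "L * \<tau> g = \<sigma> g * L" if g: "g \<in> SL n" for g
  proof -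
    note r = hw_dataD(7)[OF data g] and tg = representation_carrier[OF \<tau> g]
    have "\<sigma> g * L = four_block_mat (\<rho> g * M1 + 0\<^sub>m d d * M2) (\<rho> g * 0\<^sub>m d 0 + 0\<^sub>m d d * 0\<^sub>m d 0)
        (0\<^sub>m d d * M1 + \<rho> g * M2) (0\<^sub>m d d * 0\<^sub>m d 0 + \<rho> g * 0\<^sub>m d 0)"
      unfolding L_def \<sigma>_def by (rule mult_four_block_mat) (use r M in auto)
    also have "\<dots> = four_block_mat (M1 * \<tau> g) (0\<^sub>m d 0) (M2 * \<tau> g) (0\<^sub>m d 0)"
      using r M tg by (simp add: Mi[OF g])
    also have "\<dots> = four_block_mat (M1 * \<tau> g + 0\<^sub>m d 0 * 0\<^sub>m 0 K) (M1 * 0\<^sub>m K 0 + 0\<^sub>m d 0 * 0\<^sub>m 0 0)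
        (M2 * \<tau> g + 0\<^sub>m d 0 * 0\<^sub>m 0 K) (M2 * 0\<^sub>m K 0 + 0\<^sub>m d 0 * 0\<^sub>m 0 0)"
      using M tg by simp
    also have "\<dots> = L * four_block_mat (\<tau> g) (0\<^sub>m K 0) (0\<^sub>m 0 K) (0\<^sub>m 0 0)"
      unfolding L_def by (rule mult_four_block_mat[symmetric]) (use tg M in auto)
    finally show ?thesis unfolding t_block[OF tg] by simp
  qed
  from split_off_subrepresentation[OF \<tau> \<sigma>c Jc Lc LJ1 Ji Li]
  obtain m \<tau>' P Q where rep': "representation n m \<tau>'" and sim: "\<And>g. g \<in> SL n \<Longrightarrow> similar_mat_wit (\<tau> g)
      (four_block_mat (\<sigma> g) (0\<^sub>m (d + d) m) (0\<^sub>m m (d + d)) (\<tau>' g)) P Q" by blast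
  have "isomorphic_reps n \<tau> (\<lambda>g. diag_block_mat (replicate 2 (\<rho> g) @ [\<tau>' g]))"
    unfolding isomorphic_reps_def
  proof (intro exI ballI)
    fix g assume g: "g \<in> SL n"
    have "diag_block_mat (replicate 2 (\<rho> g) @ [\<tau>' g]) = diag_block_mat [\<rho> g, \<rho> g, \<tau>' g]"
      by (simp add: numeral_2_eq_2)
    also have "\<dots> = four_block_mat (\<sigma> g) (0\<^sub>m (d + d) m) (0\<^sub>m m (d + d)) (\<tau>' g)"
      using assoc_four_block_mat[of "\<rho> g" "\<rho> g" "\<tau>' g"] hw_dataD(7)[OF data g] representation_carrier[OF rep' g]
      by (simp add: diag_block_mat.simps(2)[of "\<rho> g" "[\<rho> g, \<tau>' g]"] diag_block_mat.simps(2)[of "\<rho> g" "[\<tau>' g]"]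
          Let_def \<sigma>_def del: diag_block_mat.simps)
    finally show "similar_mat_wit (\<tau> g) (diag_block_mat (replicate 2 (\<rho> g) @ [\<tau>' g])) P Q" using sim[OF g] by simp
  qed
  then show ?thesis by (rule multiplicity_ge[OF \<tau> hw_dataD(1)[OF data] d rep'])
qed

section \<open>Weights and assembly of the proof\<close>

lemma eps_carrier [simp]: "eps n i \<in> carrier_vec n"
  by (simp add: eps_def)

text \<open>Dominance of all three weights makes \<open>nat\<close> faithful on their coordinates,
  so the integer identity passes to natural exponents in subtraction-free form.\<close>

lemma weight_exponents:
  assumes ij: "i < j" "j \<le> n" and k: "k < n" and dom: "dominant n la" "dominant n mu"
    and dnu: "dominant n (la + mu - int N \<cdot>\<^sub>v (eps n i - eps n j))"
  shows "nat ((la + mu - int N \<cdot>\<^sub>v (eps n i - eps n j)) $ k) + (if k = i then N else 0) + (if Suc k = j then N else 0) =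
      nat (la $ k) + nat (mu $ k) + (if Suc k = i then N else 0) + (if k = j then N else 0)"
proof -
  have c: "la \<in> carrier_vec n" "mu \<in> carrier_vec n" using dom by (simp_all add: dominant_def)
  have pos: "0 \<le> la $ k" "0 \<le> mu $ k" "0 \<le> (la + mu - int N \<cdot>\<^sub>v (eps n i - eps n j)) $ k"
    using dom dnu k by (simp_all add: dominant_def)
  have "(la + mu - int N \<cdot>\<^sub>v (eps n i - eps n j)) $ k = la $ k + mu $ k -
      int N * ((if k = i then 1 else 0) - (if Suc k = i then 1 else 0) - ((if k = j then 1 else 0) - (if Suc k = j then 1 else 0)))"
    using c k by (simp add: eps_def)
  then show ?thesis using pos ij by (auto split: if_splits)
qed

theorem corollary1:
  fixes n N :: nat
    and \<beta> la mu :: "int vec"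
    and dl dm dv :: nat
    and Vl Vm Vv :: "complex mat \<Rightarrow> complex mat"
  assumes "1 \<le> N"
    and "\<beta> \<in> positive_roots n"
    and "dominant n la"
    and "dominant n mu"
    and "dominant n (la + mu - int N \<cdot>\<^sub>v \<beta>)"
    and "\<And>i. i < n \<Longrightarrow> la $ i < int N \<or> mu $ i < int N \<Longrightarrow>
           \<beta> - simple_root n i \<notin> roots n \<union> {0\<^sub>v n}"
    and "irreducible_of_highest_weight n la dl Vl"
    and "irreducible_of_highest_weight n mu dm Vm"
    and "irreducible_of_highest_weight n (la + mu - int N \<cdot>\<^sub>v \<beta>) dv Vv"
  shows "appears_in n Vv (tensor_rep Vl Vm) \<and>
         (\<beta> \<notin> simple_root n ` {..<n} \<longrightarrow> 2 \<le> multiplicity_in n Vv (tensor_rep Vl Vm))"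
proof -
  obtain i j where ij: "i < j" "j \<le> n" and \<beta>: "\<beta> = eps n i - eps n j"
    using assms(2) by (auto simp: positive_roots_def)
  define a where "a k = nat (la $ k)" for k
  define b where "b k = nat (mu $ k)" for k
  define f where "f k = nat ((la + mu - int N \<cdot>\<^sub>v \<beta>) $ k)" for k
  \<comment> \<open>Hypothesis (2) is used in contrapositive form at the two ends of
    \<open>\<beta>\<close>, the sum of the simple roots with indices \<open>i, ..., j - 1\<close>:
    removing the first or the last of them leaves a root or 0.\<close>
  have i_root: "\<beta> - simple_root n i \<in> roots n \<union> {0\<^sub>v n}"
  proof -
    have "\<beta> - simple_root n i = eps n (Suc i) - eps n j"
      by (intro eq_vecI) (simp_all add: \<beta> simple_root_def eps_def)
    moreover have "eps n (Suc i) - eps n j \<in> roots n" if "Suc i \<noteq> j"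
      unfolding roots_def mem_Collect_eq by (intro exI[of _ "Suc i"] exI[of _ j]) (use ij that in simp)
    ultimately show ?thesis by (cases "Suc i = j") simp_all
  qed
  have j_root: "\<beta> - simple_root n (j - 1) \<in> roots n \<union> {0\<^sub>v n}"
  proof -
    have "\<beta> - simple_root n (j - 1) = eps n i - eps n (j - 1)"
      using ij by (intro eq_vecI) (simp_all add: \<beta> simple_root_def eps_def)
    moreover have "eps n i - eps n (j - 1) \<in> roots n" if "i \<noteq> j - 1"
      unfolding roots_def mem_Collect_eq by (intro exI[of _ i] exI[of _ "j - 1"]) (use ij that in simp)
    ultimately show ?thesis by (cases "i = j - 1") simp_all
  qed
  have "i < n" "j - 1 < n" using ij by simp_all
  then have ge: "\<not> (la $ i < int N \<or> mu $ i < int N)" "\<not> (la $ (j - 1) < int N \<or> mu $ (j - 1) < int N)"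
    using assms(6) i_root j_root by blast+
  have nat_ge: "N \<le> nat x" if "\<not> x < int N" for x using that by linarith
  have N: "N \<le> a i" "N \<le> b i" "N \<le> a (j - 1)" "N \<le> b (j - 1)"
    unfolding a_def b_def by (rule nat_ge, use ge in blast)+
  have wt: "f k + (if k = i then N else 0) + (if Suc k = j then N else 0) =
      a k + b k + (if Suc k = i then N else 0) + (if k = j then N else 0)" if "k < n" for k
    unfolding \<beta> f_def a_def b_def by (rule weight_exponents[OF ij that assms(3,4) assms(5)[unfolded \<beta>]])
  have wt': "f k + (if k = i then N else 0) + (if Suc k = j then N else 0) =
      b k + a k + (if Suc k = i then N else 0) + (if k = j then N else 0)" if "k < n" for k
    using wt[OF that] by simp
  obtain Ul \<phi>l where l: "hw_data n dl Vl (flag_pow n a) Ul \<phi>l"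
    using hw_data_exists[OF assms(7,3)] unfolding a_def[abs_def] by blast
  obtain Um \<phi>m where m: "hw_data n dm Vm (flag_pow n b) Um \<phi>m"
    using hw_data_exists[OF assms(8,4)] unfolding b_def[abs_def] by blast
  obtain Uv \<phi>v where v: "hw_data n dv Vv (flag_pow n f) Uv \<phi>v"
    using hw_data_exists[OF assms(9,5)] unfolding f_def[abs_def] by blast
  have dv: "0 < dv" using assms(9) by (simp add: irreducible_of_highest_weight_def irreducible_rep_def)
  note rl = hw_dataD(1)[OF l] and rm = hw_dataD(1)[OF m]
  let ?\<tau> = "tensor_rep Vl Vm"
  have \<tau>: "representation n (dl * dm) ?\<tau>" by (rule representation_tensor[OF rl rm])
  obtain fs where fs: "gramian n (flag_pow n a) fs"
    using flag_section_flag_pow[of n a] by (auto simp: flag_section_def)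
  obtain gs where gs: "gramian n (flag_pow n b) gs"
    using flag_section_flag_pow[of n b] by (auto simp: flag_section_def)
  obtain Hl Hm where "unitary_form n dl Vl Hl" "unitary_form n dm Vm Hm"
    using hw_form_exists[OF l fs] hw_form_exists[OF m gs] by (elim exE conjE)
  then have H: "unitary_form n (dl * dm) ?\<tau> (kronecker Hl Hm)" by (rule unitary_form_tensor[OF rl rm])
  let ?v = "\<lambda>g h. kronecker (Vl g * Ul) (Vm h * Um)"
  \<comment> \<open>The first function takes its minors of size \<open>i + 1\<close> in the factor
    \<open>Vl\<close>, the second in the factor \<open>Vm\<close>. Together they call for all four
    inequalities in \<open>N\<close>.\<close>
  let ?F1 = "plucker_section n N i j a b" and ?F2 = "plucker_section n N i j b a"
  obtain \<Psi>\<^sub>1 where P1: "\<Psi>\<^sub>1 \<in> carrier_mat 1 (dl * dm)"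
    and E1: "\<And>g h. g \<in> SL n \<Longrightarrow> h \<in> SL n \<Longrightarrow> (\<Psi>\<^sub>1 * ?v g h) $$ (0, 0) = ?F1 g h"
    using bisection_functional[OF l m bisection_plucker_section[of i j n N a b, OF ij N(1) N(4)]] by blast
  obtain \<Psi>\<^sub>2 where P2: "\<Psi>\<^sub>2 \<in> carrier_mat 1 (dl * dm)"
    and E2: "\<And>g h. g \<in> SL n \<Longrightarrow> h \<in> SL n \<Longrightarrow> (\<Psi>\<^sub>2 * ?v g h) $$ (0, 0) = ?F2 h g"
    using bisection_functional[OF l m bisection_swap[OF bisection_plucker_section[of i j n N b a, OF ij N(2) N(3)]]] by blast
  have S1: "semi_invariant n ?\<tau> (flag_pow n f) \<Psi>\<^sub>1"
    by (rule tensor_semi_invariant[where Q = ?F1, OF l m P1 E1])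
      (assumption | rule plucker_section_lower_mult[OF ij N(1) N(4) wt])+
  have S2: "semi_invariant n ?\<tau> (flag_pow n f) \<Psi>\<^sub>2"
    by (rule tensor_semi_invariant[where Q = "\<lambda>g h. ?F2 h g", OF l m P2 E2])
      (assumption | rule plucker_section_lower_mult[OF ij N(2) N(3) wt'])+
  have vc: "?v g h \<in> carrier_mat (dl * dm) 1" if "g \<in> SL n" "h \<in> SL n" for g h
    using kronecker_carrier[OF hw_dataD(8)[OF l that(1)] hw_dataD(8)[OF m that(2)]] by simp
  have nz: "\<Psi>\<^sub>1 \<noteq> 0\<^sub>m 1 (dl * dm)"
  proof
    assume z: "\<Psi>\<^sub>1 = 0\<^sub>m 1 (dl * dm)"
    obtain g where g: "g \<in> SL n" "?F1 g (1\<^sub>m (Suc n)) \<noteq> 0" using plucker_section_nonzero[OF ij] by blast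
    have "\<Psi>\<^sub>1 * ?v g (1\<^sub>m (Suc n)) = 0\<^sub>m 1 1" unfolding z by (rule left_mult_zero_mat[OF vc[OF g(1) SL_one]])
    then show False using E1[OF g(1) SL_one] g(2) by simp
  qed
  have "1 \<le> multiplicity_in n Vv ?\<tau>" by (rule multiplicity_ge_1[OF \<tau> H v dv P1 S1 nz])
  moreover have "2 \<le> multiplicity_in n Vv ?\<tau>" if ns: "\<beta> \<notin> simple_root n ` {..<n}"
  proof (rule multiplicity_ge_2[OF \<tau> H v dv P1 S1 nz P2 S2])
    have "Suc i \<noteq> j"
    proof
      assume "Suc i = j"
      then have "\<beta> = simple_root n i" "i < n" using ij by (simp_all add: \<beta> simple_root_def)
      then show False using ns by blast
    qed
    then have ij': "Suc i < j" using ij by simp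
    \<comment> \<open>At the pair of \<open>g\<close> and the identity the first covector vanishes
      and the second does not, so the second is no multiple of the first.\<close>
    obtain g where g: "g \<in> SL n" "?F1 g (1\<^sub>m (Suc n)) = 0" "?F2 (1\<^sub>m (Suc n)) g \<noteq> 0"
      using plucker_section_separating[OF ij' ij(2), of N a b b a] assms(1) by auto
    fix k
    note c = vc[OF g(1) SL_one]
    show "\<Psi>\<^sub>2 + k \<cdot>\<^sub>m \<Psi>\<^sub>1 \<noteq> 0\<^sub>m 1 (dl * dm)"
    proof
      assume z: "\<Psi>\<^sub>2 + k \<cdot>\<^sub>m \<Psi>\<^sub>1 = 0\<^sub>m 1 (dl * dm)"
      have "0\<^sub>m 1 1 = (\<Psi>\<^sub>2 + k \<cdot>\<^sub>m \<Psi>\<^sub>1) * ?v g (1\<^sub>m (Suc n))"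
        unfolding z by (rule left_mult_zero_mat[OF c, symmetric])
      also have "\<dots> = \<Psi>\<^sub>2 * ?v g (1\<^sub>m (Suc n)) + k \<cdot>\<^sub>m (\<Psi>\<^sub>1 * ?v g (1\<^sub>m (Suc n)))"
        unfolding add_mult_distrib_mat[OF P2 smult_carrier_mat[OF P1] c] mult_smult_assoc_mat[OF P1 c] ..
      finally have "0 = (\<Psi>\<^sub>2 * ?v g (1\<^sub>m (Suc n)) + k \<cdot>\<^sub>m (\<Psi>\<^sub>1 * ?v g (1\<^sub>m (Suc n)))) $$ (0, 0)"
        by (rule subst) simp
      also have "\<dots> = (\<Psi>\<^sub>2 * ?v g (1\<^sub>m (Suc n))) $$ (0, 0) + k * (\<Psi>\<^sub>1 * ?v g (1\<^sub>m (Suc n))) $$ (0, 0)"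
        using add_index_carrier[OF mult_carrier_mat[OF P2 c] smult_carrier_mat[OF mult_carrier_mat[OF P1 c]], of 0 0 k]
          smult_index_carrier[OF mult_carrier_mat[OF P1 c], of 0 0 k] by simp
      finally show False using E1[OF g(1) SL_one] E2[OF g(1) SL_one] g(2,3) by simp
    qed
  qed
  ultimately show ?thesis by (simp add: appears_in_def)
qed

end
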